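(* Fix $\kappa>0$ and $0<\delta\le 1/2$. There exists $\gamma(\kappa,\delta)>0$ such that the following holds. Suppose $n\ge\gamma(\kappa,\delta)$ and $D=(d_1,\ldots,d_n)$ is a $\delta$-tame degree sequence with $d_1+\ldots+d_n\equiv 0\pmod 2$, with maximum entropy matrix $z=(\zeta_{\{j,k\}})$. Let $S\subset E$ satisfy $|S|\ge\delta n^2$, where $E$ is the set of all unordered pairs $\{j,k\}$, $1\le j\ne k\le n$. For $G\in G(D)$ let $\sigma_S(G)$ be the number of edges of $G$ belonging to $S$, and let $\sigma_S(z)=\sum_{\{j,k\}\in S}\zeta_{\{j,k\}}$. Let $\epsilon=\delta\frac{\ln n}{\sqrt n}$. If $\epsilon\le 1$, then for a graph $G$ chosen uniformly at random from $G(D)$, $$\mathbf{P}\big\{(1-\epsilon)\sigma_S(z)\le\sigma_S(G)\le(1+\epsilon)\sigma_S(z)\big\}\ \ge\ 1-2n^{-\kappa n}.$$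
   Context: For a vector $D=(d_1,\ldots,d_n)$ of positive integers, $G(D)$ is the set of graphs (undirected, no loops, no multiple edges) on vertex set $\{1,\ldots,n\}$ in which vertex $k$ has degree $d_k$; graphs are viewed as subsets of the edge set $E$ of the complete graph $K_n$. Coordinates of $\mathbb{R}^{\binom n2}$ are indexed by unordered pairs $\{j,k\}$. $\mathcal{P}(D)$ is the polytope of $x=(\xi_{\{j,k\}})$ with $\sum_{j:\,j\ne k}\xi_{\{j,k\}}=d_k$ ($k=1,\ldots,n$) and $0\le\xi_{\{j,k\}}\le1$. $H(x)=\sum_{\{j,k\}}\big(\xi_{\{j,k\}}\ln\frac1{\xi_{\{j,k\}}}+(1-\xi_{\{j,k\}})\ln\frac1{1-\xi_{\{j,k\}}}\big)$; if $\mathcal{P}(D)\ne\emptyset$ its unique maximizer $z=(\zeta_{\{j,k\}})$ on $\mathcal{P}(D)$ is the maximum entropy matrix. $D$ is $\delta$-tame ($0<\delta\le1/2$) if $\mathcal{P}(D)\ne\emptyset$ and $\delta\le\zeta_{\{j,k\}}\le1-\delta$ for all $j\ne k$. *)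

theory Defs
  imports "HOL-Probability.Probability"
begin

definition complete_edges :: "nat \<Rightarrow> nat set set" where
  "complete_edges n = {{j, k} | j k. j \<in> {1..n} \<and> k \<in> {1..n} \<and> j \<noteq> k}"

definition graphs_with_degrees :: "nat \<Rightarrow> (nat \<Rightarrow> nat) \<Rightarrow> nat set set set" where
  "graphs_with_degrees n d =
     {G. G \<subseteq> complete_edges n \<and> (\<forall>k\<in>{1..n}. card {e \<in> G. k \<in> e} = d k)}"

(* A point of R^E, with E the edge set of K_n, is a function on edges that takes the
   fixed value undefined outside E, so that distinct functions are distinct points. *)
definition degree_polytope :: "nat \<Rightarrow> (nat \<Rightarrow> nat) \<Rightarrow> (nat set \<Rightarrow> real) set" where
  "degree_polytope n d =
     {x \<in> complete_edges n \<rightarrow>\<^sub>E {0..1}.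
        \<forall>k\<in>{1..n}. (\<Sum>j\<in>{1..n} - {k}. x {j, k}) = real (d k)}"

(* At the boundary values 0 and 1 the summand is 0, the usual convention 0 ln (1/0) = 0. *)
definition edge_entropy :: "nat \<Rightarrow> (nat set \<Rightarrow> real) \<Rightarrow> real" where
  "edge_entropy n x =
     (\<Sum>e\<in>complete_edges n. x e * ln (1 / x e) + (1 - x e) * ln (1 / (1 - x e)))"

(* On a nonempty polytope the maximizer exists (compactness) and is unique (strict
   concavity of the entropy), so this predicate holds of exactly one z. *)
definition max_entropy_matrix :: "nat \<Rightarrow> (nat \<Rightarrow> nat) \<Rightarrow> (nat set \<Rightarrow> real) \<Rightarrow> bool" where
  "max_entropy_matrix n d z \<longleftrightarrow> is_arg_max (edge_entropy n) (\<lambda>x. x \<in> degree_polytope n d) z"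

definition tame :: "real \<Rightarrow> nat \<Rightarrow> (nat \<Rightarrow> nat) \<Rightarrow> bool" where
  "tame \<delta> n d \<longleftrightarrow>
     degree_polytope n d \<noteq> {} \<and>
     (\<forall>z. max_entropy_matrix n d z \<longrightarrow> (\<forall>e\<in>complete_edges n. \<delta> \<le> z e \<and> z e \<le> 1 - \<delta>))"

end

theory Submission
  imports Defs "HOL-Real_Asymp.Real_Asymp"
begin

text \<open>
  Let every edge \<open>e\<close> of the complete graph be present independently with probability \<open>z e\<close>.
  First-order optimality of \<open>z\<close> shows that all graphs with degree sequence \<open>d\<close> have the same
  probability, so the uniform measure on them is this product measure conditioned on the degrees.
  Since \<open>S\<close> has order \<open>n\<^sup>2\<close> edges, a Chernoff bound for the product measure gives a failure
  probability \<open>exp (- c n (ln n)\<^sup>2)\<close>, and it suffices that the degrees are equal to \<open>d\<close> with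
  probability at least \<open>exp (- C n ln n)\<close>.

  For that lower bound split the vertices into two halves \<open>A\<close> and \<open>B\<close>. The edges inside the halves are
  typical with probability 1/2, and fixing \<open>O(n ln n)\<close> of them inside \<open>A\<close> (possible because the
  degree sum is even) balances the remaining degrees on the two sides. What remains is to hit prescribed
  row and column sums in a random bipartite graph when they deviate from their means by
  \<open>O(sqrt (n ln n))\<close>. For \<open>N = 2^k\<close> independent copies with \<open>N\<close> huge, hitting \<open>N\<close> times the
  margins in total is easy. One descends from \<open>2 N\<close> to \<open>N\<close> copies by exchanging edges between the
  two groups of copies so that both have the same degrees; as in Schrijver's lower bound for the number of
  Eulerian orientations, a fraction \<open>n^(- O(n))\<close> of all exchanges does this. The number of copies
  doubles while the loss per step grows only polynomially with it, so the total loss per copy is a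
  convergent series.
\<close>

subsection \<open>Balanced signings\<close>

text \<open>The exchange argument dictates the bipartition. Cancelling two edges at a common vertex
  must leave a vector of the same kind. Zero and the differences of two unit vectors are closed
  under this, and orienting every edge between the two sides of a bipartition makes its incidence
  vector such a difference. For a general graph the vectors are sums of two unit vectors, and
  cancelling along an odd cycle leaves twice a unit vector, which no single edge cancels.

  The price is a balance condition: prescribed degrees of a bipartite graph have equal sums over the
  two sides. By double counting, this means that the edges inside \<open>A\<close> minus those
  inside \<open>B\<close> number exactly half the difference of the two degree sums, the integer
  \<open>\<tau>\<close> below. A random choice of inner edges misses \<open>\<tau>\<close> by order
  \<open>n\<close>, so a reserve of edges is kept to correct it. The pairs among about
  \<open>4 * sqrt (n / \<delta>)\<close> vertices are enough, and they move every degree by only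
  \<open>O(sqrt n)\<close>, which is less than the fluctuation \<open>sqrt (n ln n)\<close> allowed
  anyway.\<close>

definition flip_sign :: "'i set \<Rightarrow> 'i \<Rightarrow> int" where
  "flip_sign T i = (if i \<in> T then - 1 else 1)"

text \<open>A zero sum of signs has as many plus as minus signs, so either class is half of
  \<open>J\<close>. In the elimination below, every balanced signing therefore has the same number
  of partners that cancel \<open>p\<close>, which makes a double count of signings and partners
  exact.\<close>

lemma half_opposite_signs:
  fixes s :: "'i \<Rightarrow> int"
  assumes "finite J" and "\<And>i. i \<in> J \<Longrightarrow> \<bar>s i\<bar> = 1" and "sum s J = 0" and "p \<in> J"
  shows "2 * card {q \<in> J - {p}. s q = - s p} = card J"
proof -
  let ?N = "{q \<in> J. s q = - s p}" and ?P = "{q \<in> J. s q = s p}"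
  have sp: "\<bar>s p\<bar> = 1" using assms by blast
  have eq: "{q \<in> J - {p}. s q = - s p} = ?N" using sp by auto
  have J: "J = ?N \<union> ?P" using assms(2) sp by fastforce
  have disj: "?N \<inter> ?P = {}" using sp by auto
  have fin: "finite ?N" "finite ?P" using assms(1) by auto
  have "sum s J = sum s ?N + sum s ?P"
    by (subst J, rule sum.union_disjoint) (use fin disj in auto)
  also have "sum s ?N = - s p * int (card ?N)" by simp
  also have "sum s ?P = s p * int (card ?P)" by simp
  finally have "0 = - s p * int (card ?N) + s p * int (card ?P)"
    unfolding assms(3) .
  hence "s p * (int (card ?P) - int (card ?N)) = 0"
    unfolding right_diff_distrib by linarith
  moreover have "s p \<noteq> 0" using sp by auto
  ultimately have "int (card ?P) - int (card ?N) = 0" by (metis mult_eq_0_iff)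
  hence "card ?P = card ?N" by linarith
  moreover have "card J = card ?N + card ?P"
    by (subst J, rule card_Un_disjoint) (use fin disj in auto)
  ultimately show ?thesis unfolding eq by simp
qed

text \<open>
  Eliminate the coordinates one by one. In coordinate \<open>v\<close> fix a vector \<open>p\<close> with nonzero entry: in a
  balanced signing exactly half of the vectors with nonzero entry cancel it, and imposing cancellation
  with a given \<open>q\<close> merges \<open>p\<close> and \<open>q\<close> into one vector that vanishes at \<open>v\<close>.
\<close>
lemma card_balanced_signings:
  fixes a :: "'i \<Rightarrow> 'v \<Rightarrow> int"
  assumes "finite V" and "finite I" and "card I \<le> K"
    and "\<And>i. i \<in> I \<Longrightarrow> (\<Sum>v\<in>V. a i v) = 0"
    and "\<And>i. i \<in> I \<Longrightarrow> (\<Sum>v\<in>V. \<bar>a i v\<bar>) \<le> 2"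
    and "\<And>v. v \<in> V \<Longrightarrow> even (\<Sum>i\<in>I. a i v)"
  shows "2 ^ card I \<le> (K + 1) ^ card V *
    card {T \<in> Pow I. \<forall>v\<in>V. (\<Sum>i\<in>I. flip_sign T i * a i v) = 0}"
  using assms
proof (induction V arbitrary: I a rule: finite_induct)
  case empty
  thus ?case by (simp add: card_Pow flip: Pow_def)
next
  case (insert v W)
  define Good where "Good I a = {T \<in> Pow I. \<forall>u\<in>insert v W. (\<Sum>i\<in>I. flip_sign T i * a i u) = 0}"
    for I :: "'i set" and a :: "'i \<Rightarrow> 'v \<Rightarrow> int"
  define Inc where "Inc I a = {i \<in> I. a i v \<noteq> 0}" for I :: "'i set" and a :: "'i \<Rightarrow> 'v \<Rightarrow> int"
  \<comment> \<open>The first factor counts only the vectors that meet \<open>v\<close>; its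
    \<open>+ 1\<close> covers the case that none does. \<open>K\<close> bounds all index sets that
    occur, so it stays fixed while vectors are merged.\<close>
  have inner: "2 ^ card I \<le> (card (Inc I a) + 1) * (K + 1) ^ card W * card (Good I a)"
    if "finite I" "card I \<le> K"
      "\<And>i. i \<in> I \<Longrightarrow> (\<Sum>u\<in>insert v W. a i u) = 0"
      "\<And>i. i \<in> I \<Longrightarrow> (\<Sum>u\<in>insert v W. \<bar>a i u\<bar>) \<le> 2"
      "\<And>u. u \<in> insert v W \<Longrightarrow> even (\<Sum>i\<in>I. a i u)" for I a
    using that
  proof (induction "card (Inc I a)" arbitrary: I a rule: less_induct)
    case less
    note prems = less.prems
    let ?J = "Inc I a"
    have finJ: "finite ?J" using prems(1) by (simp add: Inc_def)
    \<comment> \<open>Zero sum and norm at most 2 allow only zero and differences of two unit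
      vectors.\<close>
    have unit: "\<bar>a i v\<bar> = 1" if "i \<in> ?J" for i
    proof -
      have i: "i \<in> I" "a i v \<noteq> 0" using that by (auto simp: Inc_def)
      have "a i v = - (\<Sum>u\<in>W. a i u)" using prems(3)[OF i(1)] insert.hyps by simp
      hence "\<bar>a i v\<bar> \<le> (\<Sum>u\<in>W. \<bar>a i u\<bar>)" using sum_abs[of "a i" W] by simp
      moreover have "\<bar>a i v\<bar> + (\<Sum>u\<in>W. \<bar>a i u\<bar>) \<le> 2" using prems(4)[OF i(1)] insert.hyps by simp
      ultimately show ?thesis using i(2) by linarith
    qed
    show ?case
    proof (cases "?J = {}")
      case True
      hence z: "a i v = 0" if "i \<in> I" for i using that by (auto simp: Inc_def)
      have "Good I a = {T \<in> Pow I. \<forall>u\<in>W. (\<Sum>i\<in>I. flip_sign T i * a i u) = 0}"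
        using z by (auto simp: Good_def)
      moreover have "2 ^ card I \<le> (K + 1) ^ card W *
          card {T \<in> Pow I. \<forall>u\<in>W. (\<Sum>i\<in>I. flip_sign T i * a i u) = 0}"
        using prems insert.hyps z by (intro insert.IH) auto
      ultimately show ?thesis using True by simp
    next
      case False
      then obtain p where p: "p \<in> ?J" by auto
      hence pI: "p \<in> I" by (simp add: Inc_def)
      define rel where "rel q T \<longleftrightarrow> flip_sign T q * a q v = - (flip_sign T p * a p v)" for q T
      have Jsum: "(\<Sum>i\<in>?J. flip_sign T i * a i v) = 0" if "T \<in> Good I a" for T
      proof -
        have "(\<Sum>i\<in>I. flip_sign T i * a i v) = (\<Sum>i\<in>?J. flip_sign T i * a i v)"
          using prems(1) by (intro sum.mono_neutral_right) (auto simp: Inc_def)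
        thus ?thesis using that by (simp add: Good_def)
      qed
      have half: "2 * card {q \<in> ?J - {p}. rel q T} = card ?J" if "T \<in> Good I a" for T
        unfolding rel_def using finJ unit p Jsum[OF that]
        by (intro half_opposite_signs) (auto simp: flip_sign_def abs_mult)
      have finG: "finite (Good I a)" using prems(1) by (simp add: Good_def)
      \<comment> \<open>All entries at \<open>v\<close> in \<open>?J\<close> are odd, so parity
        excludes a lone \<open>p\<close> without a partner.\<close>
      have evenJ: "even (card ?J)"
      proof -
        have "even (\<Sum>i\<in>I. a i v)" using prems(5) by simp
        moreover have "(\<Sum>i\<in>I. a i v) = (\<Sum>i\<in>?J. a i v)"
          using prems(1) by (intro sum.mono_neutral_right) (auto simp: Inc_def)
        moreover have "even (\<Sum>i\<in>?J. a i v) \<longleftrightarrow> even (card {i \<in> ?J. odd (a i v)})"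
          using finJ by (rule even_sum_iff)
        moreover have "odd (a i v)" if "i \<in> ?J" for i
          using unit[OF that] by (auto simp: abs_if split: if_splits)
        hence "{i \<in> ?J. odd (a i v)} = ?J" by blast
        ultimately show ?thesis by simp
      qed
      have cJ: "card ?J \<ge> 2"
        using evenJ p finJ by (metis Suc_1 Suc_leI card_gt_0_iff empty_iff even_Suc
            even_zero le_neq_implies_less less_one not_less One_nat_def)
      have merge: "2 ^ (card I - 1) \<le> (card ?J - 1) * (K + 1) ^ card W * card {T \<in> Good I a. rel q T}"
        if q: "q \<in> ?J - {p}" for q
      proof -
        have qI: "q \<in> I" "q \<noteq> p" using q by (auto simp: Inc_def)
        \<comment> \<open>With this sign \<open>a p - e * a q\<close> vanishes at \<open>v\<close>.
          The merged vector keeps the index \<open>p\<close>, and \<open>q\<close> leaves the index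
          set.\<close>
        define e where "e = a p v * a q v"
        have e1: "\<bar>e\<bar> = 1" using unit p q by (simp add: e_def abs_mult)
        define b where "b i = (if i = p then (\<lambda>u. a p u - e * a q u) else a i)" for i
        let ?I = "I - {q}"
        have qv: "a q v * a q v = 1" "a p v * a p v = 1"
          using unit[of q] unit[of p] q p by (auto simp: abs_if split: if_splits)
        have bpv: "b p v = 0" using qv by (simp add: b_def e_def mult.assoc)
        have Jb: "Inc ?I b = ?J - {p, q}" using bpv by (auto simp: Inc_def b_def)
        have cJb: "card (Inc ?I b) = card ?J - 2"
          unfolding Jb using p q finJ by (subst card_Diff_subset) auto
        \<comment> \<open>Both vectors lose a unit entry at \<open>v\<close>, so what is left has
          norm at most 1 + 1.\<close>
        have norm: "(\<Sum>u\<in>insert v W. \<bar>b i u\<bar>) \<le> 2" if "i \<in> ?I" for i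
        proof (cases "i = p")
          case True
          have "(\<Sum>u\<in>W. \<bar>b p u\<bar>) \<le> (\<Sum>u\<in>W. \<bar>a p u\<bar> + \<bar>a q u\<bar>)"
          proof (rule sum_mono)
            fix u
            have "\<bar>a p u - e * a q u\<bar> \<le> \<bar>a p u\<bar> + \<bar>e * a q u\<bar>" by linarith
            also have "\<bar>e * a q u\<bar> = \<bar>a q u\<bar>" using e1 by (simp add: abs_mult)
            finally show "\<bar>b p u\<bar> \<le> \<bar>a p u\<bar> + \<bar>a q u\<bar>" by (simp add: b_def)
          qed
          also have "\<dots> = (\<Sum>u\<in>W. \<bar>a p u\<bar>) + (\<Sum>u\<in>W. \<bar>a q u\<bar>)" by (rule sum.distrib)
          finally show ?thesis
            using prems(4)[OF pI] prems(4)[OF qI(1)] unit[OF p] unit[of q] q True bpv insert.hyps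
            by simp
        next
          case False
          thus ?thesis using prems(4)[of i] that by (simp add: b_def)
        qed
        have zero: "(\<Sum>u\<in>insert v W. b i u) = 0" if "i \<in> ?I" for i
        proof (cases "i = p")
          case True
          have "(\<Sum>u\<in>insert v W. b p u) = (\<Sum>u\<in>insert v W. a p u) - e * (\<Sum>u\<in>insert v W. a q u)"
            unfolding sum_distrib_left sum_subtractf[symmetric] by (rule sum.cong) (simp_all add: b_def)
          thus ?thesis using True prems(3)[OF pI] prems(3)[OF qI(1)] by simp
        next
          case False
          thus ?thesis using prems(3)[of i] that by (simp add: b_def)
        qed
        have split: "(\<Sum>i\<in>I. f i) = f q + f p + (\<Sum>i\<in>I - {q} - {p}. f i)" for f :: "'i \<Rightarrow> int"
          using prems(1) pI qI by (simp add: sum.remove[of _ q] sum.remove[of _ p])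
        have split': "(\<Sum>i\<in>?I. f i) = f p + (\<Sum>i\<in>I - {q} - {p}. f i)" for f :: "'i \<Rightarrow> int"
          using prems(1) pI qI by (simp add: sum.remove[of _ p])
        \<comment> \<open>Merging changes the sum at \<open>u\<close> by
          \<open>(1 + e) * a q u\<close>, an even number because \<open>e\<close> is a sign.\<close>
        have par: "even (\<Sum>i\<in>?I. b i u)" if "u \<in> insert v W" for u
        proof -
          have "(\<Sum>i\<in>I - {q} - {p}. b i u) = (\<Sum>i\<in>I - {q} - {p}. a i u)"
            by (rule sum.cong) (auto simp: b_def)
          hence "(\<Sum>i\<in>?I. b i u) = (\<Sum>i\<in>I. a i u) - (1 + e) * a q u"
            by (simp add: split split' b_def algebra_simps)
          moreover have "even (1 + e)" using e1 by (auto simp: abs_if split: if_splits)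
          ultimately show ?thesis using prems(5)[OF that] by simp
        qed
        have IH: "2 ^ card ?I \<le> (card (Inc ?I b) + 1) * (K + 1) ^ card W * card (Good ?I b)"
        proof (rule less.hyps)
          show "card (Inc ?I b) < card ?J" using cJb cJ by simp
          show "finite ?I" using prems(1) by simp
          show "card ?I \<le> K" using prems(2) by (meson card_Diff1_le le_trans)
        qed (use norm zero par in blast)+
        \<comment> \<open>A signing of the merged family determines the sign of \<open>q\<close>: it
          is \<open>- e\<close> times the sign of \<open>p\<close>.\<close>
        define ext where "ext T = (if flip_sign T p * e = 1 then insert q T else T)" for T
        have "card (Good ?I b) \<le> card {T \<in> Good I a. rel q T}"
        proof (rule card_inj_on_le)
          show "inj_on ext (Good ?I b)"
          proof (rule inj_onI)
            fix S T assume "S \<in> Good ?I b" "T \<in> Good ?I b" "ext S = ext T"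
            moreover have "X = ext X - {q}" if "X \<in> Good ?I b" for X
              using that by (auto simp: Good_def ext_def)
            ultimately show "S = T" by metis
          qed
          show "finite {T \<in> Good I a. rel q T}" using finG by simp
          show "ext ` Good ?I b \<subseteq> {T \<in> Good I a. rel q T}"
          proof clarify
            fix T assume T: "T \<in> Good ?I b"
            hence TI: "T \<subseteq> ?I" by (auto simp: Good_def)
            have fs: "\<bar>flip_sign T p\<bar> = 1" by (simp add: flip_sign_def)
            have fq: "flip_sign (ext T) q = - (flip_sign T p * e)"
              using TI fs e1 by (auto simp: ext_def flip_sign_def abs_if split: if_splits)
            have fo: "flip_sign (ext T) i = flip_sign T i" if "i \<noteq> q" for i
              using that by (simp add: ext_def flip_sign_def)
            have "(\<Sum>i\<in>I. flip_sign (ext T) i * a i u) = 0" if u: "u \<in> insert v W" for u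
            proof -
              have "(\<Sum>i\<in>I - {q} - {p}. flip_sign (ext T) i * a i u)
                  = (\<Sum>i\<in>I - {q} - {p}. flip_sign T i * b i u)"
                by (rule sum.cong) (auto simp: b_def fo)
              hence "(\<Sum>i\<in>I. flip_sign (ext T) i * a i u) = (\<Sum>i\<in>?I. flip_sign T i * b i u)"
                unfolding split split' using fq fo[of p] qI
                by (simp add: b_def algebra_simps)
              moreover have "\<forall>u\<in>insert v W. (\<Sum>i\<in>?I. flip_sign T i * b i u) = 0"
                using T unfolding Good_def by blast
              ultimately show ?thesis using u by metis
            qed
            moreover have "ext T \<subseteq> I" using TI qI by (auto simp: ext_def)
            moreover have "rel q (ext T)"
              unfolding rel_def fq fo[OF qI(2)[symmetric]]
              using qv by (simp add: e_def algebra_simps)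
            ultimately show "ext T \<in> Good I a \<and> rel q (ext T)" by (simp add: Good_def)
          qed
        qed
        hence "2 ^ card ?I \<le> (card (Inc ?I b) + 1) * (K + 1) ^ card W * card {T \<in> Good I a. rel q T}"
          using IH by (meson le_trans mult_le_mono2)
        thus ?thesis using cJb cJ prems(1) qI
          by (simp add: card_Diff_singleton Suc_diff_Suc numeral_2_eq_2)
      qed
      \<comment> \<open>After a merge \<open>card ?J - 2\<close> vectors meet \<open>v\<close>, so
        the induction hypothesis contributes the factor \<open>card ?J - 1\<close>. This is also the
        number of possible partners, and it cancels in the double count of pairs of a signing and a
        partner.\<close>
      have "(card ?J - 1) * 2 ^ (card I - 1)
          = (\<Sum>q\<in>?J - {p}. 2 ^ (card I - 1))" using p finJ by simp
      also have "\<dots> \<le> (\<Sum>q\<in>?J - {p}. (card ?J - 1) * (K + 1) ^ card W * card {T \<in> Good I a. rel q T})"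
        by (rule sum_mono) (rule merge)
      also have "\<dots> = (card ?J - 1) * (K + 1) ^ card W * (\<Sum>q\<in>?J - {p}. card {T \<in> Good I a. rel q T})"
        by (simp add: sum_distrib_left)
      also have "(\<Sum>q\<in>?J - {p}. card {T \<in> Good I a. rel q T})
          = (\<Sum>T\<in>Good I a. card {q \<in> ?J - {p}. rel q T})"
        using finJ finG by (intro sum_multicount_gen) auto
      finally have "2 * ((card ?J - 1) * 2 ^ (card I - 1))
          \<le> (card ?J - 1) * (K + 1) ^ card W * (\<Sum>T\<in>Good I a. 2 * card {q \<in> ?J - {p}. rel q T})"
        by (simp add: sum_distrib_left[symmetric])
      also have "(\<Sum>T\<in>Good I a. 2 * card {q \<in> ?J - {p}. rel q T}) = card (Good I a) * card ?J"
        using half by simp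
      finally have "(card ?J - 1) * (2 * 2 ^ (card I - 1))
          \<le> (card ?J - 1) * ((K + 1) ^ card W * (card (Good I a) * card ?J))"
        by (simp add: algebra_simps)
      hence "2 * 2 ^ (card I - 1) \<le> (K + 1) ^ card W * (card (Good I a) * card ?J)"
        using cJ by (subst (asm) mult_le_cancel1) simp
      moreover have "2 * 2 ^ (card I - 1) = (2::nat) ^ card I"
        using pI prems(1) by (metis card_gt_0_iff empty_iff power_minus_mult mult.commute)
      ultimately show ?thesis by (simp add: algebra_simps)
    qed
  qed
  have "2 ^ card I \<le> (card (Inc I a) + 1) * (K + 1) ^ card W * card (Good I a)"
    using insert.prems by (intro inner) auto
  also have "card (Inc I a) \<le> card I"
    using insert.prems(1) by (intro card_mono) (auto simp: Inc_def)
  hence "(card (Inc I a) + 1) * (K + 1) ^ card W * card (Good I a)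
      \<le> (K + 1) * (K + 1) ^ card W * card (Good I a)"
    using insert.prems(2) by (intro mult_le_mono) auto
  finally show ?case using insert.hyps by (simp add: Good_def)
qed

subsection \<open>Independent copies\<close>

definition bern_weight :: "('e \<Rightarrow> real) \<Rightarrow> 'e set \<Rightarrow> 'e set \<Rightarrow> real" where
  "bern_weight p E X = (\<Prod>e\<in>E. if e \<in> X then p e else 1 - p e)"

lemma bern_weight_nonneg:
  "(\<And>e. e \<in> E \<Longrightarrow> 0 \<le> p e \<and> p e \<le> 1) \<Longrightarrow> 0 \<le> bern_weight p E X"
  unfolding bern_weight_def by (rule prod_nonneg) auto

text \<open>Expanding the right-hand product decides for each element whether it lies in
  \<open>X\<close>. Constant \<open>g\<close> and \<open>h\<close> give the total mass; exponentials
  give the moment generating function of the Chernoff bound.\<close>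

lemma sum_bern_weight_prod:
  assumes "finite E"
  shows "(\<Sum>X\<in>Pow E. bern_weight p E X * (\<Prod>e\<in>E. if e \<in> X then g e else h e)) =
    (\<Prod>e\<in>E. p e * g e + (1 - p e) * h e)"
proof -
  have "(\<Prod>e\<in>E. p e * g e + (1 - p e) * h e)
      = (\<Sum>X\<in>Pow E. (\<Prod>e\<in>X. p e * g e) * (\<Prod>e\<in>E - X. (1 - p e) * h e))"
    using assms by (rule prod_add)
  also have "\<dots> = (\<Sum>X\<in>Pow E. bern_weight p E X * (\<Prod>e\<in>E. if e \<in> X then g e else h e))"
  proof (rule sum.cong[OF refl])
    fix X assume "X \<in> Pow E"
    hence X: "X \<subseteq> E" by simp
    have "bern_weight p E X * (\<Prod>e\<in>E. if e \<in> X then g e else h e)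
        = (\<Prod>e\<in>E. if e \<in> X then p e * g e else (1 - p e) * h e)"
      unfolding bern_weight_def prod.distrib[symmetric] by (rule prod.cong) auto
    also have "\<dots> = (\<Prod>e\<in>E \<inter> {e. e \<in> X}. p e * g e) * (\<Prod>e\<in>E \<inter> - {e. e \<in> X}. (1 - p e) * h e)"
      using assms by (rule prod.If_cases)
    also have "E \<inter> {e. e \<in> X} = X" using X by auto
    also have "E \<inter> - {e. e \<in> X} = E - X" by auto
    finally show "(\<Prod>e\<in>X. p e * g e) * (\<Prod>e\<in>E - X. (1 - p e) * h e)
      = bern_weight p E X * (\<Prod>e\<in>E. if e \<in> X then g e else h e)" by simp
  qed
  finally show ?thesis by simp
qed

lemma sum_bern_weight: "finite E \<Longrightarrow> (\<Sum>X\<in>Pow E. bern_weight p E X) = 1"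
  using sum_bern_weight_prod[of E p "\<lambda>_. 1" "\<lambda>_. 1"] by simp

lemma bern_weight_Un:
  assumes "finite E" "finite F" "E \<inter> F = {}" "X \<subseteq> E" "Y \<subseteq> F"
  shows "bern_weight p (E \<union> F) (X \<union> Y) = bern_weight p E X * bern_weight p F Y"
proof -
  have "bern_weight p (E \<union> F) (X \<union> Y) = (\<Prod>e\<in>E. if e \<in> X \<union> Y then p e else 1 - p e) *
      (\<Prod>e\<in>F. if e \<in> X \<union> Y then p e else 1 - p e)"
    unfolding bern_weight_def using assms by (intro prod.union_disjoint) auto
  also have "(\<Prod>e\<in>E. if e \<in> X \<union> Y then p e else 1 - p e) = bern_weight p E X"
    unfolding bern_weight_def using assms by (intro prod.cong) auto
  also have "(\<Prod>e\<in>F. if e \<in> X \<union> Y then p e else 1 - p e) = bern_weight p F Y"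
    unfolding bern_weight_def using assms by (intro prod.cong) auto
  finally show ?thesis .
qed

lemma bern_weight_image:
  assumes "inj_on f E" "X \<subseteq> E"
  shows "bern_weight p (f ` E) (f ` X) = bern_weight (\<lambda>e. p (f e)) E X"
proof -
  have "bern_weight p (f ` E) (f ` X) = (\<Prod>e\<in>E. if f e \<in> f ` X then p (f e) else 1 - p (f e))"
    unfolding bern_weight_def using assms by (simp add: prod.reindex)
  also have "\<dots> = bern_weight (\<lambda>e. p (f e)) E X"
    unfolding bern_weight_def using assms by (intro prod.cong) (auto simp: inj_on_image_mem_iff)
  finally show ?thesis .
qed

lemma sum_Pow_Un:
  assumes "E \<inter> F = {}"
  shows "sum g (Pow (E \<union> F)) = (\<Sum>(X, Y)\<in>Pow E \<times> Pow F. g (X \<union> Y))"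
proof (rule sum.reindex_bij_witness[where i = "\<lambda>(X, Y). X \<union> Y" and j = "\<lambda>Z. (Z \<inter> E, Z \<inter> F)"])
  fix b assume "b \<in> Pow E \<times> Pow F"
  thus "(\<lambda>Z. (Z \<inter> E, Z \<inter> F)) ((\<lambda>(X, Y). X \<union> Y) b) = b"
    using assms by (auto split: prod.splits)
qed (auto simp: Int_Un_distrib[symmetric] Int_absorb2)

text \<open>
  Exchanging \<open>X\<close> and \<open>Y\<close> on a set \<open>T\<close> preserves the product weight and the sum of the two
  statistics, and signs the difference of the statistics by \<open>T\<close>.
\<close>
lemma square_prob_ge_doubled:
  fixes a :: "'j \<Rightarrow> 'v \<Rightarrow> int" and c :: "'v \<Rightarrow> int"
  assumes "finite V" "finite J"
    and "\<And>j. j \<in> J \<Longrightarrow> (\<Sum>v\<in>V. a j v) = 0"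
    and "\<And>j. j \<in> J \<Longrightarrow> (\<Sum>v\<in>V. \<bar>a j v\<bar>) \<le> 2"
    and p: "\<And>j. j \<in> J \<Longrightarrow> 0 \<le> p j \<and> p j \<le> 1"
  shows "(\<Sum>(X, Y) | X \<subseteq> J \<and> Y \<subseteq> J \<and> (\<forall>v\<in>V. (\<Sum>j\<in>X. a j v) + (\<Sum>j\<in>Y. a j v) = 2 * c v).
      bern_weight p J X * bern_weight p J Y)
    \<le> (real (card J) + 1) ^ card V *
      (\<Sum>X | X \<subseteq> J \<and> (\<forall>v\<in>V. (\<Sum>j\<in>X. a j v) = c v). bern_weight p J X)\<^sup>2"
proof -
  define s where "s X v = (\<Sum>j\<in>X. a j v)" for X v
  define D where "D = {(X, Y). X \<subseteq> J \<and> Y \<subseteq> J \<and> (\<forall>v\<in>V. s X v + s Y v = 2 * c v)}"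
  define G where "G = {X. X \<subseteq> J \<and> (\<forall>v\<in>V. s X v = c v)}"
  define w where "w = (\<lambda>(X, Y). bern_weight p J X * bern_weight p J Y)"
  define swap where "swap T = (\<lambda>(X, Y). ((X - T) \<union> (Y \<inter> T), (Y - T) \<union> (X \<inter> T)))" for T :: "'j set"
  define L where "L = (real (card J) + 1) ^ card V"
  have finPJ: "finite (Pow J \<times> Pow J)" using assms(2) by simp
  have finD: "finite D" by (rule finite_subset[OF _ finPJ]) (auto simp: D_def)
  have w0: "w z \<ge> 0" for z
    unfolding w_def using p by (auto split: prod.splits intro!: mult_nonneg_nonneg bern_weight_nonneg)
  have sP: "s X v = (\<Sum>j\<in>J. of_bool (j \<in> X) * a j v)" if "X \<subseteq> J" for X v
  proof -
    have "(\<Sum>j\<in>J. of_bool (j \<in> X) * a j v) = (\<Sum>j\<in>X. of_bool (j \<in> X) * a j v)"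
      using that assms(2) by (intro sum.mono_neutral_right) auto
    thus ?thesis by (simp add: s_def)
  qed
  have sw_w: "w (swap T z) = w z" if "z \<in> Pow J \<times> Pow J" for T z
    unfolding w_def swap_def bern_weight_def
    by (auto simp: prod.distrib[symmetric] intro!: prod.cong split: prod.splits)
  \<comment> \<open>For a fixed pair, the exchange sets that equalize the two statistics contain all
    balanced signings of the differences, hence a fraction of at least \<open>1 / L\<close> of all
    sets.\<close>
  have count: "2 ^ card J * w z \<le> L * (\<Sum>T\<in>Pow J. if swap T z \<in> G \<times> G then w z else 0)"
    if z: "z \<in> D" for z
  proof -
    obtain X Y where XY: "z = (X, Y)" "X \<subseteq> J" "Y \<subseteq> J" "\<And>v. v \<in> V \<Longrightarrow> s X v + s Y v = 2 * c v"
      using z by (auto simp: D_def)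
    \<comment> \<open>\<open>b j\<close> is the contribution of \<open>j\<close> to the difference
      of the two statistics. It vanishes where \<open>X\<close> and \<open>Y\<close> agree, and
      exchanging on \<open>T\<close> multiplies it by \<open>flip_sign T j\<close>.\<close>
    define b where "b j v = (of_bool (j \<in> X) - of_bool (j \<in> Y)) * a j v" for j v
    let ?B = "{T \<in> Pow J. \<forall>v\<in>V. (\<Sum>j\<in>J. flip_sign T j * b j v) = 0}"
    have "2 ^ card J \<le> (card J + 1) ^ card V * card ?B"
    proof (rule card_balanced_signings)
      fix j assume j: "j \<in> J"
      show "(\<Sum>v\<in>V. b j v) = 0"
        unfolding b_def sum_distrib_left[symmetric] using assms(3)[OF j] by simp
      have "(\<Sum>v\<in>V. \<bar>b j v\<bar>) \<le> (\<Sum>v\<in>V. \<bar>a j v\<bar>)"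
        by (rule sum_mono) (auto simp: b_def)
      thus "(\<Sum>v\<in>V. \<bar>b j v\<bar>) \<le> 2" using assms(4)[OF j] by simp
    next
      fix v assume v: "v \<in> V"
      \<comment> \<open>The even target \<open>2 * c v\<close> is what supplies the parity
        hypothesis of \<open>card_balanced_signings\<close>.\<close>
      have "(\<Sum>j\<in>J. b j v) = s X v - s Y v"
        using XY by (simp add: sP b_def left_diff_distrib sum_subtractf)
      also have "\<dots> = 2 * (c v - s Y v)" using XY(4)[OF v] by simp
      finally show "even (\<Sum>j\<in>J. b j v)" by simp
    qed (use assms in auto)
    also have "card ?B \<le> card {T \<in> Pow J. swap T z \<in> G \<times> G}"
    proof (rule card_mono)
      show "?B \<subseteq> {T \<in> Pow J. swap T z \<in> G \<times> G}"
      proof clarify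
        fix T assume T: "T \<subseteq> J" "\<forall>v\<in>V. (\<Sum>j\<in>J. flip_sign T j * b j v) = 0"
        let ?X = "(X - T) \<union> (Y \<inter> T)" and ?Y = "(Y - T) \<union> (X \<inter> T)"
        have sub: "?X \<subseteq> J" "?Y \<subseteq> J" using XY by auto
        have "s ?X v = c v \<and> s ?Y v = c v" if v: "v \<in> V" for v
        proof -
          have "s ?X v - s ?Y v = (\<Sum>j\<in>J. flip_sign T j * b j v)"
            unfolding sP[OF sub(1)] sP[OF sub(2)] sum_subtractf[symmetric]
            by (rule sum.cong) (auto simp: b_def flip_sign_def)
          moreover have "s ?X v + s ?Y v = s X v + s Y v"
            unfolding sP[OF sub(1)] sP[OF sub(2)] sP[OF XY(2)] sP[OF XY(3)] sum.distrib[symmetric]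
            by (rule sum.cong) auto
          ultimately show ?thesis using T(2) XY(4)[OF v] v by simp
        qed
        thus "T \<in> Pow J \<and> swap T z \<in> G \<times> G"
          using T(1) sub by (simp add: XY(1) swap_def G_def)
      qed
    qed (use assms(2) in auto)
    finally have "2 ^ card J \<le> (card J + 1) ^ card V * card {T \<in> Pow J. swap T z \<in> G \<times> G}"
      by (simp add: mult_le_mono2)
    hence "real (2 ^ card J) \<le> real ((card J + 1) ^ card V * card {T \<in> Pow J. swap T z \<in> G \<times> G})"
      by (rule of_nat_mono)
    hence "2 ^ card J \<le> L * real (card {T \<in> Pow J. swap T z \<in> G \<times> G})"
      by (simp add: L_def add.commute)
    hence "2 ^ card J * w z \<le> L * real (card {T \<in> Pow J. swap T z \<in> G \<times> G}) * w z"
      using w0 by (rule mult_right_mono)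
    also have "real (card {T \<in> Pow J. swap T z \<in> G \<times> G}) * w z
        = (\<Sum>T\<in>Pow J. if swap T z \<in> G \<times> G then w z else 0)"
      using assms(2) by (subst sum.inter_filter[symmetric]) auto
    hence "L * real (card {T \<in> Pow J. swap T z \<in> G \<times> G}) * w z
        = L * (\<Sum>T\<in>Pow J. if swap T z \<in> G \<times> G then w z else 0)" by (simp add: mult.assoc)
    finally show ?thesis .
  qed
  \<comment> \<open>For a fixed \<open>T\<close> the exchange is a weight-preserving involution, so
    the pairs that it sends into \<open>G \<times> G\<close> weigh no more than
    \<open>G \<times> G\<close>.\<close>
  have each: "(\<Sum>z\<in>D. if swap T z \<in> G \<times> G then w z else 0) \<le> sum w (G \<times> G)" for T
  proof -
    have DP: "D \<subseteq> Pow J \<times> Pow J" by (auto simp: D_def)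
    have GP: "G \<subseteq> Pow J" by (auto simp: G_def)
    have "swap T (swap T z) = z" for z
      by (auto simp: swap_def split: prod.splits)
    hence inj: "inj (swap T)" by (metis injI)
    have "(\<Sum>z\<in>D. if swap T z \<in> G \<times> G then w z else 0) = sum w {z \<in> D. swap T z \<in> G \<times> G}"
      using finD by (simp add: sum.inter_filter)
    also have "\<dots> = (\<Sum>z\<in>{z \<in> D. swap T z \<in> G \<times> G}. w (swap T z))"
    proof (rule sum.cong[OF refl])
      fix z assume "z \<in> {z \<in> D. swap T z \<in> G \<times> G}"
      hence "z \<in> Pow J \<times> Pow J" using DP by blast
      thus "w z = w (swap T z)" by (simp only: sw_w)
    qed
    also have "\<dots> = sum w (swap T ` {z \<in> D. swap T z \<in> G \<times> G})"
      using inj by (subst sum.reindex) (auto intro: inj_on_subset)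
    also have "\<dots> \<le> sum w (G \<times> G)"
      using w0 finite_subset[OF GP] assms(2) by (intro sum_mono2) auto
    finally show ?thesis .
  qed
  have "2 ^ card J * sum w D \<le> (\<Sum>z\<in>D. L * (\<Sum>T\<in>Pow J. if swap T z \<in> G \<times> G then w z else 0))"
    unfolding sum_distrib_left by (rule sum_mono) (use count in \<open>simp add: sum_distrib_left\<close>)
  also have "\<dots> = L * (\<Sum>T\<in>Pow J. \<Sum>z\<in>D. if swap T z \<in> G \<times> G then w z else 0)"
    unfolding sum_distrib_left[symmetric] by (subst sum.swap) simp
  also have "\<dots> \<le> L * (\<Sum>T\<in>Pow J. sum w (G \<times> G))"
    by (intro mult_left_mono sum_mono each) (simp add: L_def)
  also have "\<dots> = 2 ^ card J * (L * sum w (G \<times> G))"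
    using assms(2) by (simp add: card_Pow)
  finally have "sum w D \<le> L * sum w (G \<times> G)" by simp
  also have "sum w (G \<times> G) = (\<Sum>X\<in>G. bern_weight p J X)\<^sup>2"
    by (simp add: w_def power2_eq_square sum_product sum.cartesian_product)
  finally show ?thesis
    by (simp add: D_def G_def w_def L_def s_def case_prod_unfold)
qed

text \<open>
  The probability that \<open>N\<close> independent random subsets of \<open>E\<close> have incidence sums adding up to \<open>N * c\<close>.
\<close>
definition copies_prob ::
  "'v set \<Rightarrow> ('e \<Rightarrow> 'v \<Rightarrow> int) \<Rightarrow> ('v \<Rightarrow> int) \<Rightarrow> ('e \<Rightarrow> real) \<Rightarrow> 'e set \<Rightarrow> nat \<Rightarrow> real" where
  "copies_prob V a c p E N =
    (\<Sum>X | X \<subseteq> {..<N} \<times> E \<and> (\<forall>v\<in>V. (\<Sum>j\<in>X. a (snd j) v) = int N * c v).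
      bern_weight (\<lambda>j. p (snd j)) ({..<N} \<times> E) X)"

lemma sum_Pow_image:
  "inj_on f E \<Longrightarrow> sum g (Pow (f ` E)) = (\<Sum>X\<in>Pow E. g (f ` X))"
  using sum.reindex[OF inj_on_image_Pow, of f E g] by (simp add: image_Pow_surj)

lemma copies_prob_1:
  assumes "finite E"
  shows "copies_prob V a c p E 1 =
    (\<Sum>X | X \<subseteq> E \<and> (\<forall>v\<in>V. (\<Sum>e\<in>X. a e v) = c v). bern_weight p E X)"
proof -
  let ?f = "\<lambda>e. (0::nat, e)"
  have inj: "inj_on ?f S" for S by (auto intro: inj_onI)
  have E: "{..<1} \<times> E = ?f ` E" by auto
  have "copies_prob V a c p E 1 = (\<Sum>X\<in>Pow (?f ` E).
      if \<forall>v\<in>V. (\<Sum>j\<in>X. a (snd j) v) = c v then bern_weight (\<lambda>j. p (snd j)) (?f ` E) X else 0)"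
    unfolding copies_prob_def E using assms by (subst sum.inter_filter[symmetric]) auto
  also have "\<dots> = (\<Sum>X\<in>Pow E. if \<forall>v\<in>V. (\<Sum>e\<in>X. a e v) = c v then bern_weight p E X else 0)"
    unfolding sum_Pow_image[OF inj]
  proof (rule sum.cong[OF refl])
    fix X assume "X \<in> Pow E"
    hence "bern_weight (\<lambda>j. p (snd j)) (?f ` E) (?f ` X) = bern_weight p E X"
      by (subst bern_weight_image) (use inj in auto)
    moreover have "(\<Sum>j\<in>?f ` X. a (snd j) v) = (\<Sum>e\<in>X. a e v)" for v
      by (subst sum.reindex) (use inj in auto)
    ultimately show "(if \<forall>v\<in>V. (\<Sum>j\<in>?f ` X. a (snd j) v) = c v
        then bern_weight (\<lambda>j. p (snd j)) (?f ` E) (?f ` X) else 0) =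
      (if \<forall>v\<in>V. (\<Sum>e\<in>X. a e v) = c v then bern_weight p E X else 0)" by simp
  qed
  also have "\<dots> = (\<Sum>X | X \<subseteq> E \<and> (\<forall>v\<in>V. (\<Sum>e\<in>X. a e v) = c v). bern_weight p E X)"
    using assms by (subst sum.inter_filter[symmetric]) auto
  finally show ?thesis .
qed

text \<open>The first \<open>N\<close> and the last \<open>N\<close> copies are independent samples
  from the same product space. Shifting the second group onto the first turns the event into the one
  of \<open>square_prob_ge_doubled\<close>, with pairs of a copy and an edge as coordinates.\<close>

lemma copies_prob_double:
  fixes a :: "'e \<Rightarrow> 'v \<Rightarrow> int"
  assumes "finite V" "finite E"
    and "\<And>e. e \<in> E \<Longrightarrow> (\<Sum>v\<in>V. a e v) = 0"
    and "\<And>e. e \<in> E \<Longrightarrow> (\<Sum>v\<in>V. \<bar>a e v\<bar>) \<le> 2"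
    and "\<And>e. e \<in> E \<Longrightarrow> 0 \<le> p e \<and> p e \<le> 1"
  shows "copies_prob V a c p E (2 * N) \<le> (real (N * card E) + 1) ^ card V * (copies_prob V a c p E N)\<^sup>2"
proof -
  let ?J = "{..<N} \<times> E" and ?f = "\<lambda>(i::nat, e::'e). (i + N, e)"
  let ?a = "\<lambda>j. a (snd j)" and ?p = "\<lambda>j. p (snd j)"
  let ?C = "\<lambda>X. \<forall>v\<in>V. (\<Sum>j\<in>X. ?a j v) = int (2 * N) * c v"
  have inj: "inj_on ?f S" for S by (auto intro: inj_onI)
  have split: "{..<2 * N} \<times> E = ?J \<union> ?f ` ?J"
  proof (intro equalityI subsetI)
    fix x assume x: "x \<in> {..<2 * N} \<times> E"
    show "x \<in> ?J \<union> ?f ` ?J"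
    proof (cases "fst x < N")
      case False
      hence "x = ?f (fst x - N, snd x)" by (auto split: prod.splits)
      moreover have "(fst x - N, snd x) \<in> ?J" using x False by auto
      ultimately show ?thesis by blast
    qed (use x in auto)
  qed auto
  have disj: "?J \<inter> ?f ` ?J = {}" by auto
  have fin: "finite ?J" using assms(2) by simp
  have s: "(\<Sum>j\<in>X \<union> ?f ` Y. ?a j v) = (\<Sum>j\<in>X. ?a j v) + (\<Sum>j\<in>Y. ?a j v)"
    if "X \<subseteq> ?J" "Y \<subseteq> ?J" for X Y v
  proof -
    have "X \<inter> ?f ` Y = {}" using that disj by blast
    hence "(\<Sum>j\<in>X \<union> ?f ` Y. ?a j v) = (\<Sum>j\<in>X. ?a j v) + (\<Sum>j\<in>?f ` Y. ?a j v)"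
      using that fin by (intro sum.union_disjoint) (auto intro: finite_subset)
    thus ?thesis using inj by (simp add: sum.reindex case_prod_unfold)
  qed
  have wt: "bern_weight ?p (?J \<union> ?f ` ?J) (X \<union> ?f ` Y) = bern_weight ?p ?J X * bern_weight ?p ?J Y"
    if "X \<subseteq> ?J" "Y \<subseteq> ?J" for X Y
  proof -
    have "bern_weight ?p (?J \<union> ?f ` ?J) (X \<union> ?f ` Y)
        = bern_weight ?p ?J X * bern_weight ?p (?f ` ?J) (?f ` Y)"
      using that fin disj by (intro bern_weight_Un) auto
    also have "bern_weight ?p (?f ` ?J) (?f ` Y) = bern_weight ?p ?J Y"
      using inj that by (subst bern_weight_image) (auto simp: case_prod_unfold)
    finally show ?thesis .
  qed
  have "copies_prob V a c p E (2 * N) = (\<Sum>X\<in>Pow ({..<2 * N} \<times> E).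
      if ?C X then bern_weight ?p ({..<2 * N} \<times> E) X else 0)"
    unfolding copies_prob_def using assms(2) by (subst sum.inter_filter[symmetric]) auto
  also have "\<dots> = (\<Sum>(X, Y)\<in>Pow ?J \<times> Pow (?f ` ?J).
      if ?C (X \<union> Y) then bern_weight ?p (?J \<union> ?f ` ?J) (X \<union> Y) else 0)"
    unfolding split by (rule sum_Pow_Un[OF disj])
  also have "\<dots> = (\<Sum>X\<in>Pow ?J. \<Sum>Y\<in>Pow ?J.
      if ?C (X \<union> ?f ` Y) then bern_weight ?p (?J \<union> ?f ` ?J) (X \<union> ?f ` Y) else 0)"
    unfolding sum.cartesian_product[symmetric] sum_Pow_image[OF inj] ..
  also have "\<dots> = (\<Sum>X\<in>Pow ?J. \<Sum>Y\<in>Pow ?J.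
      if \<forall>v\<in>V. (\<Sum>j\<in>X. ?a j v) + (\<Sum>j\<in>Y. ?a j v) = 2 * (int N * c v)
      then bern_weight ?p ?J X * bern_weight ?p ?J Y else 0)"
  proof (intro sum.cong refl)
    fix X Y assume "X \<in> Pow ?J" "Y \<in> Pow ?J"
    hence XY: "X \<subseteq> ?J" "Y \<subseteq> ?J" by auto
    show "(if ?C (X \<union> ?f ` Y) then bern_weight ?p (?J \<union> ?f ` ?J) (X \<union> ?f ` Y) else 0) =
      (if \<forall>v\<in>V. (\<Sum>j\<in>X. ?a j v) + (\<Sum>j\<in>Y. ?a j v) = 2 * (int N * c v)
      then bern_weight ?p ?J X * bern_weight ?p ?J Y else 0)"
      unfolding s[OF XY] wt[OF XY] by (simp add: mult.assoc)
  qed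
  also have "\<dots> = (\<Sum>(X, Y) | X \<subseteq> ?J \<and> Y \<subseteq> ?J \<and>
      (\<forall>v\<in>V. (\<Sum>j\<in>X. ?a j v) + (\<Sum>j\<in>Y. ?a j v) = 2 * (int N * c v)).
      bern_weight ?p ?J X * bern_weight ?p ?J Y)"
    unfolding sum.cartesian_product case_prod_unfold
    by (subst sum.inter_filter[symmetric]) (use fin in \<open>auto intro!: sum.cong\<close>)
  also have "\<dots> \<le> (real (card ?J) + 1) ^ card V *
      (\<Sum>X | X \<subseteq> ?J \<and> (\<forall>v\<in>V. (\<Sum>j\<in>X. ?a j v) = int N * c v). bern_weight ?p ?J X)\<^sup>2"
    using assms fin by (intro square_prob_ge_doubled) auto
  also have "card ?J = N * card E" by (simp add: card_cartesian_product)
  finally show ?thesis by (simp add: copies_prob_def)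
qed

lemma copies_prob_nonneg:
  "(\<And>e. e \<in> E \<Longrightarrow> 0 \<le> p e \<and> p e \<le> 1) \<Longrightarrow> 0 \<le> copies_prob V a c p E N"
  unfolding copies_prob_def by (intro sum_nonneg bern_weight_nonneg) auto

text \<open>The weight \<open>(2 ^ (k + 1) * m) ^ card V\<close>, where
  \<open>m = card E + 1\<close>, is chosen such that the doubling inequality becomes "the next
  weighted probability is at most the square of the present one": the loss \<open>2 ^ k * m\<close>
  times the next weight base \<open>2 ^ (k + 2) * m\<close> is the square of
  \<open>2 ^ (k + 1) * m\<close>. This sums the series of losses in closed form.\<close>

lemma copies_prob_power2:
  fixes a :: "'e \<Rightarrow> 'v \<Rightarrow> int"
  assumes "finite V" "finite E"
    and "\<And>e. e \<in> E \<Longrightarrow> (\<Sum>v\<in>V. a e v) = 0"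
    and "\<And>e. e \<in> E \<Longrightarrow> (\<Sum>v\<in>V. \<bar>a e v\<bar>) \<le> 2"
    and "\<And>e. e \<in> E \<Longrightarrow> 0 \<le> p e \<and> p e \<le> 1"
  shows "copies_prob V a c p E (2 ^ k) * (2 ^ (k + 1) * (real (card E) + 1)) ^ card V
    \<le> ((2 * (real (card E) + 1)) ^ card V * copies_prob V a c p E 1) ^ (2 ^ k)"
proof (induction k)
  case 0
  thus ?case by (simp add: mult.commute)
next
  case (Suc k)
  let ?P = "copies_prob V a c p E" and ?m = "real (card E) + 1" and ?V = "card V"
  have power_commute: "(b\<^sup>2) ^ v = (b ^ v)\<^sup>2" for b :: real and v :: nat
    by (simp only: power_mult[symmetric] mult.commute)
  have m: "real (2 ^ k * card E) + 1 \<le> 2 ^ k * ?m"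
    by (simp add: algebra_simps)
  have "?P (2 ^ Suc k) \<le> (real (2 ^ k * card E) + 1) ^ ?V * (?P (2 ^ k))\<^sup>2"
    using copies_prob_double[where N = "2 ^ k" and c = c, OF assms] by simp
  also have "\<dots> \<le> (2 ^ k * ?m) ^ ?V * (?P (2 ^ k))\<^sup>2"
    using m by (intro mult_right_mono power_mono) auto
  finally have "?P (2 ^ Suc k) * (2 ^ (Suc k + 1) * ?m) ^ ?V
      \<le> (2 ^ k * ?m) ^ ?V * (?P (2 ^ k))\<^sup>2 * (2 ^ (Suc k + 1) * ?m) ^ ?V"
    by (intro mult_right_mono) auto
  also have "\<dots> = (?P (2 ^ k))\<^sup>2 * ((2 ^ k * ?m) * (2 ^ (Suc k + 1) * ?m)) ^ ?V"
    by (simp only: power_mult_distrib ac_simps)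
  also have "(2 ^ k * ?m) * (2 ^ (Suc k + 1) * ?m) = (2 ^ (k + 1) * ?m)\<^sup>2"
    by (simp add: power2_eq_square)
  also have "(?P (2 ^ k))\<^sup>2 * ((2 ^ (k + 1) * ?m)\<^sup>2) ^ ?V = (?P (2 ^ k) * (2 ^ (k + 1) * ?m) ^ ?V)\<^sup>2"
    by (simp only: power_mult_distrib[of "?P (2 ^ k)"] power_commute)
  also have "\<dots> \<le> (((2 * ?m) ^ ?V * ?P 1) ^ (2 ^ k))\<^sup>2"
    using Suc.IH copies_prob_nonneg[of E p V a c "2 ^ k"] assms(5) by (intro power_mono) auto
  also have "\<dots> = ((2 * ?m) ^ ?V * ?P 1) ^ (2 ^ Suc k)"
    by (simp only: power_mult[symmetric] power_Suc mult.commute)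
  finally show ?case .
qed

section \<open>Binomial lower bounds and the case of many copies\<close>

text \<open>The ratio of consecutive terms passes 1 at \<open>M\<close>. These are the binomial
  probabilities with parameter \<open>M / N\<close>, multiplied by \<open>N ^ N\<close> to avoid
  division; so the mode is at the mean.\<close>

lemma binomial_mode:
  assumes "M \<le> N" "N > 0" "k \<le> N"
  shows "real (N choose k) * real M ^ k * real (N - M) ^ (N - k)
    \<le> real (N choose M) * real M ^ M * real (N - M) ^ (N - M)"
proof -
  define t where "t k = real (N choose k) * real M ^ k * real (N - M) ^ (N - k)" for k
  have t0: "t k \<ge> 0" for k by (simp add: t_def)
  have rat: "t (Suc k) * (real (Suc k) * real (N - M)) = t k * (real (N - k) * real M)" if "k < N" for k
  proof -
    have "Suc k * (N choose Suc k) = (N - k) * (N choose k)"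
      using that by (metis Suc_times_binomial_eq binomial_absorb_comp binomial_absorption)
    hence e: "real (Suc k) * real (N choose Suc k) = real (N - k) * real (N choose k)"
      by (metis of_nat_mult)
    have "N - k = Suc (N - Suc k)" using that by simp
    hence "t k * (real (N - k) * real M)
        = real M ^ Suc k * real (N - M) ^ (N - Suc k) * real (N - M) * (real (N - k) * real (N choose k))"
      by (simp only: t_def power_Suc ac_simps)
    also have "\<dots> = t (Suc k) * (real (Suc k) * real (N - M))"
      unfolding e[symmetric] by (simp only: t_def ac_simps)
    finally show ?thesis by simp
  qed
  \<comment> \<open>For \<open>N = M\<close> the factor \<open>N - M\<close> in \<open>rat\<close>
    is zero and cannot be cancelled, but then \<open>t k\<close> contains a positive power of zero.
    In \<open>down\<close> the same happens for \<open>M = 0\<close>.\<close>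
  have up: "t k \<le> t (Suc k)" if "k < M" for k
  proof (cases "N = M")
    case True
    have "t k = 0" using that True by (simp add: t_def)
    thus ?thesis using t0 by simp
  next
    case False
    have kN: "k < N" using that assms by simp
    have pos: "real (Suc k) * real (N - M) > 0" using False assms by simp
    have "Suc k * (N - M) \<le> (N - k) * M"
    proof -
      have "Suc k * (N - M) \<le> M * (N - k)" using that by (intro mult_le_mono) auto
      thus ?thesis by (simp add: mult.commute)
    qed
    hence "real (Suc k) * real (N - M) \<le> real (N - k) * real M" by (metis of_nat_le_iff of_nat_mult)
    hence "t k * (real (Suc k) * real (N - M)) \<le> t k * (real (N - k) * real M)"
      using t0 by (rule mult_left_mono)
    also have "\<dots> = t (Suc k) * (real (Suc k) * real (N - M))" using rat[OF kN] by simp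
    finally show ?thesis using pos by (metis mult_le_cancel_right_pos)
  qed
  have down: "t (Suc k) \<le> t k" if "M \<le> k" "k < N" for k
  proof (cases "M = 0")
    case True
    thus ?thesis using t0 by (simp add: t_def)
  next
    case False
    have pos: "real (N - k) * real M > 0" using False that by simp
    have "(N - k) * M \<le> Suc k * (N - M)"
    proof -
      have "(N - k) * M \<le> (N - M) * Suc k" using that by (intro mult_le_mono) auto
      thus ?thesis by (simp add: mult.commute)
    qed
    hence "real (N - k) * real M \<le> real (Suc k) * real (N - M)" by (metis of_nat_le_iff of_nat_mult)
    hence "t (Suc k) * (real (N - k) * real M) \<le> t (Suc k) * (real (Suc k) * real (N - M))"
      using t0 by (rule mult_left_mono)
    also have "\<dots> = t k * (real (N - k) * real M)" using rat[OF that(2)] by simp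
    finally show ?thesis using pos by (metis mult_le_cancel_right_pos)
  qed
  have "t k \<le> t M"
  proof (cases "k \<le> M")
    case True
    thus ?thesis
    proof (induction k rule: inc_induct)
      case (step j)
      thus ?case using up[of j] by simp
    qed simp
  next
    case False
    hence "M \<le> k" by simp
    thus ?thesis using assms(3)
    proof (induction k rule: dec_induct)
      case (step j)
      thus ?case using down[of j] by simp
    qed simp
  qed
  thus ?thesis by (simp add: t_def)
qed

text \<open>The \<open>N + 1\<close> probabilities add up to 1 and none exceeds the one at the
  mode.\<close>

lemma binomial_peak_ge:
  assumes "M \<le> N" "N > 0"
  defines "x \<equiv> real M / real N"
  shows "1 \<le> (real N + 1) * (real (N choose M) * x ^ M * (1 - x) ^ (N - M))"
proof -
  let ?s = "\<lambda>k. real (N choose k) * x ^ k * (1 - x) ^ (N - k)"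
  have x1: "1 - x = real (N - M) / real N"
    using assms by (simp add: x_def field_simps of_nat_diff)
  have sc: "?s k = (real (N choose k) * real M ^ k * real (N - M) ^ (N - k)) / real N ^ N" if "k \<le> N" for k
  proof -
    have "real N ^ N = real N ^ k * real N ^ (N - k)" using that by (simp flip: power_add)
    thus ?thesis unfolding x1 unfolding x_def by (simp add: power_divide)
  qed
  have "1 = (x + (1 - x)) ^ N" by simp
  also have "\<dots> = (\<Sum>k\<le>N. ?s k)" by (rule binomial_ring)
  also have "\<dots> \<le> (\<Sum>k\<le>N. ?s M)"
  proof (rule sum_mono)
    fix k assume "k \<in> {..N}"
    thus "?s k \<le> ?s M"
      unfolding sc[OF assms(1)] using sc[of k] binomial_mode[OF assms(1,2), of k]
      by (simp add: divide_right_mono)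
  qed
  finally show ?thesis by (simp add: add.commute)
qed

text \<open>Apply \<open>ln y \<le> y - 1\<close> to both logarithms. The result is the chi-square
  distance, which is quadratic in the deviation.\<close>

lemma relative_entropy_le:
  fixes x p :: real
  assumes "0 < x" "x < 1" "0 < p" "p < 1"
  shows "x * ln (x / p) + (1 - x) * ln ((1 - x) / (1 - p)) \<le> (x - p)\<^sup>2 / (p * (1 - p))"
proof -
  have "x * ln (x / p) \<le> x * (x / p - 1)"
    using assms by (intro mult_left_mono ln_le_minus_one) auto
  moreover have "(1 - x) * ln ((1 - x) / (1 - p)) \<le> (1 - x) * ((1 - x) / (1 - p) - 1)"
    using assms by (intro mult_left_mono ln_le_minus_one) auto
  moreover have "x * (x / p - 1) + (1 - x) * ((1 - x) / (1 - p) - 1) = (x - p)\<^sup>2 / (p * (1 - p))"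
    using assms by (simp add: field_simps power2_eq_square)
  ultimately show ?thesis by linarith
qed

text \<open>Changing the parameter from \<open>M / N\<close> to \<open>p\<close> multiplies the peak
  probability by the exponential of \<open>- N\<close> times the relative entropy. The constant
  \<open>2 / \<delta>\<close> comes from \<open>p * (1 - p) \<ge> \<delta> * (1 - \<delta>) \<ge>
  \<delta> / 2\<close>.\<close>

lemma binomial_prob_ge:
  fixes p \<delta> :: real
  assumes "0 < M" "M < N" "0 < \<delta>" "\<delta> \<le> 1 / 2" "\<delta> \<le> p" "p \<le> 1 - \<delta>"
  shows "exp (- real N * (2 * (real M / real N - p)\<^sup>2 / \<delta>)) / (real N + 1)
    \<le> real (N choose M) * p ^ M * (1 - p) ^ (N - M)"
proof -
  define x where "x = real M / real N"
  have x: "0 < x" "x < 1" using assms by (auto simp: x_def)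
  have p: "0 < p" "p < 1" using assms by auto
  define y where "y = real (N choose M) * p ^ M * (1 - p) ^ (N - M)"
  have y: "y > 0" using p assms by (simp add: y_def zero_less_binomial)
  have NM: "real (N - M) = real N * (1 - x)" "real M = real N * x"
    using assms by (auto simp: x_def field_simps of_nat_diff)
  have pk: "1 \<le> (real N + 1) * (real (N choose M) * x ^ M * (1 - x) ^ (N - M))"
    using binomial_peak_ge[of M N] assms by (simp add: x_def)
  have e: "real (N choose M) * x ^ M * (1 - x) ^ (N - M) = y * (x / p) ^ M * ((1 - x) / (1 - p)) ^ (N - M)"
    using p by (simp add: y_def power_divide)
  have lnp: "ln ((x / p) ^ M * ((1 - x) / (1 - p)) ^ (N - M))
      = real N * (x * ln (x / p) + (1 - x) * ln ((1 - x) / (1 - p)))"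
    using x p by (subst ln_mult) (auto simp: ln_realpow NM algebra_simps)
  have pq: "\<delta> / 2 \<le> p * (1 - p)"
  proof -
    have "0 \<le> (p - \<delta>) * ((1 - \<delta>) - p)" using assms by (intro mult_nonneg_nonneg) auto
    hence "\<delta> * (1 - \<delta>) \<le> p * (1 - p)" by (simp add: algebra_simps)
    moreover have "\<delta> * (1 / 2) \<le> \<delta> * (1 - \<delta>)" using assms by (intro mult_left_mono) auto
    ultimately show ?thesis by simp
  qed
  have "(x - p)\<^sup>2 / (p * (1 - p)) \<le> (x - p)\<^sup>2 / (\<delta> / 2)"
    using pq assms p by (intro divide_left_mono) auto
  hence kl: "x * ln (x / p) + (1 - x) * ln ((1 - x) / (1 - p)) \<le> 2 * (x - p)\<^sup>2 / \<delta>"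
    using relative_entropy_le[OF x p] by (simp add: mult.commute)
  have "(x / p) ^ M * ((1 - x) / (1 - p)) ^ (N - M)
      = exp (real N * (x * ln (x / p) + (1 - x) * ln ((1 - x) / (1 - p))))"
    unfolding lnp[symmetric] using x p by simp
  also have "\<dots> \<le> exp (real N * (2 * (x - p)\<^sup>2 / \<delta>))"
    unfolding exp_le_cancel_iff by (intro mult_left_mono kl) auto
  finally have b: "(x / p) ^ M * ((1 - x) / (1 - p)) ^ (N - M) \<le> exp (real N * (2 * (x - p)\<^sup>2 / \<delta>))" .
  have "1 \<le> (real N + 1) * (y * ((x / p) ^ M * ((1 - x) / (1 - p)) ^ (N - M)))"
    using pk unfolding e by (simp add: mult.assoc)
  also have "\<dots> \<le> (real N + 1) * (y * exp (real N * (2 * (x - p)\<^sup>2 / \<delta>)))"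
    using b y by (intro mult_left_mono) auto
  finally have "exp (- real N * (2 * (x - p)\<^sup>2 / \<delta>)) * 1 \<le>
      exp (- real N * (2 * (x - p)\<^sup>2 / \<delta>)) * ((real N + 1) * (y * exp (real N * (2 * (x - p)\<^sup>2 / \<delta>))))"
    by (intro mult_left_mono) auto
  also have "\<dots> = (real N + 1) * y" by (simp add: exp_minus field_simps)
  finally show ?thesis by (simp add: x_def y_def field_simps)
qed

text \<open>The numbers of copies containing the various edges are independent binomial variables.
  The induction splits off all copies of one edge.\<close>

lemma prob_multiplicities:
  fixes p :: "'e \<Rightarrow> real"
  assumes "finite E" and "\<And>e. e \<in> E \<Longrightarrow> M e \<le> N"
  shows "(\<Sum>X | X \<subseteq> {..<N} \<times> E \<and> (\<forall>e\<in>E. card {i. (i, e) \<in> X} = M e).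
      bern_weight (\<lambda>j. p (snd j)) ({..<N} \<times> E) X)
    = (\<Prod>e\<in>E. real (N choose M e) * p e ^ M e * (1 - p e) ^ (N - M e))"
  using assms
proof (induction E rule: finite_induct)
  case empty
  have "{X. X \<subseteq> {..<N} \<times> {} \<and> (\<forall>e\<in>{}. card {i. (i, e) \<in> X} = M e)} = {{}}" by auto
  thus ?case by (simp add: bern_weight_def)
next
  case (insert e E)
  let ?p = "\<lambda>j::nat \<times> 'e. p (snd j)" and ?J = "{..<N} \<times> E" and ?K = "(\<lambda>i. (i, e)) ` {..<N}"
  let ?C = "\<lambda>E X. \<forall>e\<in>E. card {i. (i, e) \<in> X} = M e"
  have inj: "inj_on (\<lambda>i. (i, e)) S" for S :: "nat set" by (auto intro: inj_onI)
  have split: "{..<N} \<times> insert e E = ?J \<union> ?K" by auto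
  have disj: "?J \<inter> ?K = {}" using insert.hyps by auto
  have fin: "finite ?J" "finite ?K" using insert.hyps by auto
  have C: "?C (insert e E) (X \<union> (\<lambda>i. (i, e)) ` Y) \<longleftrightarrow> ?C E X \<and> card Y = M e"
    if "X \<subseteq> ?J" "Y \<subseteq> {..<N}" for X Y
  proof -
    have "{i. (i, e) \<in> X \<union> (\<lambda>i. (i, e)) ` Y} = Y" using that insert.hyps by auto
    moreover have "{i. (i, f) \<in> X \<union> (\<lambda>i. (i, e)) ` Y} = {i. (i, f) \<in> X}" if "f \<in> E" for f
      using that insert.hyps by auto
    ultimately show ?thesis by auto
  qed
  have single: "bern_weight ?p ?K ((\<lambda>i. (i, e)) ` Y) = p e ^ card Y * (1 - p e) ^ (N - card Y)"
    if "Y \<subseteq> {..<N}" for Y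
  proof -
    have "bern_weight ?p ?K ((\<lambda>i. (i, e)) ` Y) = (\<Prod>i\<in>{..<N}. if i \<in> Y then p e else 1 - p e)"
      using inj that by (subst bern_weight_image) (auto simp: bern_weight_def)
    also have "\<dots> = p e ^ card ({..<N} \<inter> {i. i \<in> Y}) * (1 - p e) ^ card ({..<N} \<inter> - {i. i \<in> Y})"
      by (subst prod.If_cases) auto
    also have "{..<N} \<inter> {i. i \<in> Y} = Y" using that by auto
    also have "{..<N} \<inter> - {i. i \<in> Y} = {..<N} - Y" by auto
    also have "card ({..<N} - Y) = N - card Y" using that by (simp add: card_Diff_subset finite_subset)
    finally show ?thesis .
  qed
  have "(\<Sum>X | X \<subseteq> {..<N} \<times> insert e E \<and> ?C (insert e E) X. bern_weight ?p ({..<N} \<times> insert e E) X)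
      = (\<Sum>X\<in>Pow ({..<N} \<times> insert e E).
          if ?C (insert e E) X then bern_weight ?p ({..<N} \<times> insert e E) X else 0)"
    using insert.hyps by (subst sum.inter_filter[symmetric]) auto
  also have "\<dots> = (\<Sum>(X, Y)\<in>Pow ?J \<times> Pow ?K.
          if ?C (insert e E) (X \<union> Y) then bern_weight ?p (?J \<union> ?K) (X \<union> Y) else 0)"
    unfolding split by (rule sum_Pow_Un[OF disj])
  also have "\<dots> = (\<Sum>X\<in>Pow ?J. \<Sum>Y\<in>Pow {..<N}.
          if ?C (insert e E) (X \<union> (\<lambda>i. (i, e)) ` Y)
          then bern_weight ?p (?J \<union> ?K) (X \<union> (\<lambda>i. (i, e)) ` Y) else 0)"
    unfolding sum.cartesian_product[symmetric] sum_Pow_image[OF inj] ..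
  also have "\<dots> = (\<Sum>X\<in>Pow ?J. \<Sum>Y\<in>Pow {..<N}.
          (if ?C E X then bern_weight ?p ?J X else 0) *
          (if card Y = M e then p e ^ M e * (1 - p e) ^ (N - M e) else 0))"
  proof (intro sum.cong refl)
    fix X Y assume "X \<in> Pow ?J" "Y \<in> Pow {..<N}"
    hence XY: "X \<subseteq> ?J" "Y \<subseteq> {..<N}" by auto
    have "bern_weight ?p (?J \<union> ?K) (X \<union> (\<lambda>i. (i, e)) ` Y)
        = bern_weight ?p ?J X * bern_weight ?p ?K ((\<lambda>i. (i, e)) ` Y)"
      using XY fin disj by (intro bern_weight_Un) auto
    thus "(if ?C (insert e E) (X \<union> (\<lambda>i. (i, e)) ` Y)
          then bern_weight ?p (?J \<union> ?K) (X \<union> (\<lambda>i. (i, e)) ` Y) else 0)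
      = (if ?C E X then bern_weight ?p ?J X else 0) *
          (if card Y = M e then p e ^ M e * (1 - p e) ^ (N - M e) else 0)"
      unfolding C[OF XY] using single[OF XY(2)] by auto
  qed
  also have "\<dots> = (\<Sum>X\<in>Pow ?J. if ?C E X then bern_weight ?p ?J X else 0) *
      (\<Sum>Y\<in>Pow {..<N}. if card Y = M e then p e ^ M e * (1 - p e) ^ (N - M e) else 0)"
    by (simp only: sum_product)
  also have "(\<Sum>X\<in>Pow ?J. if ?C E X then bern_weight ?p ?J X else 0)
      = (\<Sum>X | X \<subseteq> ?J \<and> ?C E X. bern_weight ?p ?J X)"
    using fin by (subst sum.inter_filter[symmetric]) auto
  also have "\<dots> = (\<Prod>e\<in>E. real (N choose M e) * p e ^ M e * (1 - p e) ^ (N - M e))"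
    using insert.prems by (intro insert.IH) auto
  also have "(\<Sum>Y\<in>Pow {..<N}. if card Y = M e then p e ^ M e * (1 - p e) ^ (N - M e) else 0)
      = real (N choose M e) * p e ^ M e * (1 - p e) ^ (N - M e)"
  proof -
    have "card {Y \<in> Pow {..<N}. card Y = M e} = N choose M e"
      using n_subsets[of "{..<N}" "M e"] by simp
    thus ?thesis by (subst sum.inter_filter[symmetric]) auto
  qed
  finally show ?case using insert.hyps by (simp add: mult.commute)
qed

text \<open>Prescribing how many copies contain each edge forces all incidence sums, and this
  smaller event is a product of binomial events. This is the easy estimate for very many
  copies.\<close>

lemma copies_prob_ge_multiplicities:
  fixes a :: "'e \<Rightarrow> 'v \<Rightarrow> int" and p :: "'e \<Rightarrow> real"
  assumes "finite E" and "0 < \<delta>" "\<delta> \<le> 1 / 2"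
    and p: "\<And>e. e \<in> E \<Longrightarrow> \<delta> \<le> p e \<and> p e \<le> 1 - \<delta>"
    and M: "\<And>e. e \<in> E \<Longrightarrow> 0 < M e \<and> M e < N"
    and c: "\<And>v. v \<in> V \<Longrightarrow> (\<Sum>e\<in>E. int (M e) * a e v) = int N * c v"
  shows "(\<Prod>e\<in>E. exp (- real N * (2 * (real (M e) / real N - p e)\<^sup>2 / \<delta>)) / (real N + 1))
    \<le> copies_prob V a c p E N"
proof -
  let ?p = "\<lambda>j::nat \<times> 'e. p (snd j)" and ?J = "{..<N} \<times> E"
  have p01: "0 \<le> p e \<and> p e \<le> 1" if "e \<in> E" for e
    using p[OF that] assms(2) by linarith
  have s: "(\<Sum>j\<in>X. a (snd j) v) = (\<Sum>e\<in>E. int (M e) * a e v)"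
    if X: "X \<subseteq> ?J" and m: "\<forall>e\<in>E. card {i. (i, e) \<in> X} = M e" for X v
  proof -
    have "finite X" using X assms(1) by (meson finite_SigmaI finite_lessThan finite_subset)
    hence "(\<Sum>j\<in>X. a (snd j) v) = (\<Sum>e\<in>E. \<Sum>j | j \<in> X \<and> snd j = e. a (snd j) v)"
      using X assms(1) by (intro sum.group[symmetric]) auto
    also have "\<dots> = (\<Sum>e\<in>E. int (M e) * a e v)"
    proof (rule sum.cong[OF refl])
      fix e assume "e \<in> E"
      have "{j. j \<in> X \<and> snd j = e} = (\<lambda>i. (i, e)) ` {i. (i, e) \<in> X}" by force
      hence "card {j. j \<in> X \<and> snd j = e} = card {i. (i, e) \<in> X}"
        by (simp add: card_image inj_on_def)
      thus "(\<Sum>j | j \<in> X \<and> snd j = e. a (snd j) v) = int (M e) * a e v"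
        using m \<open>e \<in> E\<close> by simp
    qed
    finally show ?thesis .
  qed
  have "(\<Prod>e\<in>E. exp (- real N * (2 * (real (M e) / real N - p e)\<^sup>2 / \<delta>)) / (real N + 1))
      \<le> (\<Prod>e\<in>E. real (N choose M e) * p e ^ M e * (1 - p e) ^ (N - M e))"
    using assms by (intro prod_mono conjI binomial_prob_ge) auto
  also have "\<dots> = (\<Sum>X | X \<subseteq> ?J \<and> (\<forall>e\<in>E. card {i. (i, e) \<in> X} = M e). bern_weight ?p ?J X)"
    using M by (intro prob_multiplicities[symmetric] assms) (auto intro: less_imp_le)
  also have "\<dots> \<le> copies_prob V a c p E N"
    unfolding copies_prob_def
  proof (rule sum_mono2)
    show "finite {X. X \<subseteq> ?J \<and> (\<forall>v\<in>V. (\<Sum>j\<in>X. a (snd j) v) = int N * c v)}"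
      using assms(1) by simp
    show "{X. X \<subseteq> ?J \<and> (\<forall>e\<in>E. card {i. (i, e) \<in> X} = M e)}
        \<subseteq> {X. X \<subseteq> ?J \<and> (\<forall>v\<in>V. (\<Sum>j\<in>X. a (snd j) v) = int N * c v)}"
      using s c by auto
  qed (use p01 in \<open>auto intro!: bern_weight_nonneg\<close>)
  finally show ?thesis .
qed

text \<open>Estimate \<open>N\<close> copies from below and take the \<open>N\<close>-th root in
  \<open>copies_prob_power2\<close>. Exact multiplicities cost \<open>(N + 1) ^ card E\<close>,
  which is at most \<open>exp N\<close> for large \<open>N\<close> and leaves only the
  \<open>+ 1\<close> in the exponent; the term with \<open>\<eta>\<^sup>2\<close> pays for
  multiplicities away from their means.\<close>

lemma prob_incidence_ge:
  fixes a :: "'e \<Rightarrow> 'v \<Rightarrow> int" and p :: "'e \<Rightarrow> real"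
  assumes "finite V" "finite E" "0 < \<delta>" "\<delta> \<le> 1 / 2" "\<eta> \<ge> 0"
    and a0: "\<And>e. e \<in> E \<Longrightarrow> (\<Sum>v\<in>V. a e v) = 0"
    and a2: "\<And>e. e \<in> E \<Longrightarrow> (\<Sum>v\<in>V. \<bar>a e v\<bar>) \<le> 2"
    and p: "\<And>e. e \<in> E \<Longrightarrow> \<delta> \<le> p e \<and> p e \<le> 1 - \<delta>"
    and N: "N = 2 ^ k" "4 * real (card E) ^ 2 \<le> real N"
    and M: "\<And>e. e \<in> E \<Longrightarrow> 0 < M e \<and> M e < N \<and> \<bar>real (M e) / real N - p e\<bar> \<le> \<eta>"
    and c: "\<And>v. v \<in> V \<Longrightarrow> (\<Sum>e\<in>E. int (M e) * a e v) = int N * c v"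
  shows "exp (- (2 * \<eta>\<^sup>2 / \<delta> * real (card E) + 1)) \<le> (2 * (real (card E) + 1)) ^ card V *
    (\<Sum>X | X \<subseteq> E \<and> (\<forall>v\<in>V. (\<Sum>e\<in>X. a e v) = c v). bern_weight p E X)"
proof -
  let ?m = "card E" and ?P = "copies_prob V a c p E"
  define Q where "Q = (2 * (real ?m + 1)) ^ card V * ?P 1"
  define T where "T = 2 * \<eta>\<^sup>2 / \<delta> * real ?m + 1"
  have p01: "0 \<le> p e \<and> p e \<le> 1" if "e \<in> E" for e
    using p[OF that] assms(3) by linarith
  have N0: "N > 0" using N by simp
  \<comment> \<open>Compare \<open>ln (N + 1) \<le> 2 * sqrt N\<close> with
    \<open>2 * card E \<le> sqrt N\<close>.\<close>
  have lnN: "real ?m * ln (real N + 1) \<le> real N"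
  proof -
    have "ln (real N + 1) = 2 * ln (sqrt (real N + 1))" by (simp add: ln_sqrt)
    also have "\<dots> \<le> 2 * (sqrt (real N + 1) - 1)" using ln_le_minus_one[of "sqrt (real N + 1)"] by simp
    also have "sqrt (real N + 1) \<le> sqrt (real N) + 1"
      using sqrt_add_le_add_sqrt[of "real N" 1] by simp
    finally have "ln (real N + 1) \<le> 2 * sqrt (real N)" by simp
    moreover have "2 * real ?m \<le> sqrt (real N)"
      using N(2) by (intro real_le_rsqrt) (simp add: power_mult_distrib)
    ultimately have "(2 * real ?m) * ln (real N + 1) \<le> sqrt (real N) * (2 * sqrt (real N))"
      by (intro mult_mono) auto
    thus ?thesis by simp
  qed
  have Np: "(real N + 1) ^ ?m \<le> exp (real N)"
  proof -
    have "(real N + 1) ^ ?m = exp (real ?m * ln (real N + 1))"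
      by (simp add: exp_of_nat_mult)
    thus ?thesis using lnN by simp
  qed
  have "exp (- T) ^ N = exp (- real N * (2 * \<eta>\<^sup>2 / \<delta>)) ^ ?m / exp (real N)"
    unfolding exp_of_nat_mult[symmetric] exp_diff[symmetric] by (simp add: T_def algebra_simps)
  also have "\<dots> \<le> exp (- real N * (2 * \<eta>\<^sup>2 / \<delta>)) ^ ?m / (real N + 1) ^ ?m"
    using Np by (intro divide_left_mono) auto
  also have "\<dots> = (\<Prod>e\<in>E. exp (- real N * (2 * \<eta>\<^sup>2 / \<delta>)) / (real N + 1))"
    by (simp add: power_divide)
  also have "\<dots> \<le> (\<Prod>e\<in>E. exp (- real N * (2 * (real (M e) / real N - p e)\<^sup>2 / \<delta>)) / (real N + 1))"
  proof (intro prod_mono conjI divide_right_mono)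
    fix e assume "e \<in> E"
    hence "(real (M e) / real N - p e)\<^sup>2 \<le> \<eta>\<^sup>2"
      using M[of e] assms(5) by (metis abs_le_square_iff abs_of_nonneg)
    hence "real N * (2 * (real (M e) / real N - p e)\<^sup>2 / \<delta>) \<le> real N * (2 * \<eta>\<^sup>2 / \<delta>)"
      using assms(3) by (intro mult_left_mono divide_right_mono) auto
    thus "exp (- real N * (2 * \<eta>\<^sup>2 / \<delta>)) \<le> exp (- real N * (2 * (real (M e) / real N - p e)\<^sup>2 / \<delta>))"
      by simp
  qed auto
  also have "\<dots> \<le> ?P N"
    using assms by (intro copies_prob_ge_multiplicities) auto
  also have "\<dots> = ?P N * 1" by simp
  also have "\<dots> \<le> ?P (2 ^ k) * (2 ^ (k + 1) * (real ?m + 1)) ^ card V"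
    unfolding N(1)
  proof (intro mult_left_mono one_le_power copies_prob_nonneg p01)
    have "(1::real) * 1 \<le> 2 ^ (k + 1) * (real ?m + 1)"
      by (intro mult_mono one_le_power) auto
    thus "(1::real) \<le> 2 ^ (k + 1) * (real ?m + 1)" by simp
  qed
  also have "\<dots> \<le> Q ^ N"
    unfolding Q_def N(1) using assms(1,2) a0 a2 p01 by (intro copies_prob_power2) auto
  finally have "exp (- T) ^ N \<le> Q ^ N" .
  moreover have "Q \<ge> 0" unfolding Q_def using p01 by (intro mult_nonneg_nonneg copies_prob_nonneg) auto
  ultimately have "exp (- T) \<le> Q"
    using N0 by (metis Suc_pred power_le_imp_le_base)
  thus ?thesis by (simp only: T_def Q_def copies_prob_1[OF assms(2)])
qed

section \<open>Rounding a matrix with integer margins\<close>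

text \<open>Take floors outside one row and one column, whose entries are then forced by the
  margins. The corner collects the fractional parts of all floored entries, which explains the size
  of the error. Such a crude bound is enough because the matrix will be scaled by a huge
  \<open>N\<close> beforehand.\<close>

lemma integer_matrix_rounding:
  fixes y :: "'a \<Rightarrow> 'b \<Rightarrow> real" and R :: "'a \<Rightarrow> int" and C :: "'b \<Rightarrow> int"
  assumes fin: "finite A" "finite B" and "A \<noteq> {}" "B \<noteq> {}"
    and R: "\<And>i. i \<in> A \<Longrightarrow> (\<Sum>j\<in>B. y i j) = of_int (R i)"
    and C: "\<And>j. j \<in> B \<Longrightarrow> (\<Sum>i\<in>A. y i j) = of_int (C j)"
  shows "\<exists>M :: 'a \<Rightarrow> 'b \<Rightarrow> int. (\<forall>i\<in>A. (\<Sum>j\<in>B. M i j) = R i) \<and> (\<forall>j\<in>B. (\<Sum>i\<in>A. M i j) = C j) \<and>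
    (\<forall>i\<in>A. \<forall>j\<in>B. \<bar>of_int (M i j) - y i j\<bar> \<le> real (card A * card B))"
proof -
  obtain a b where ab: "a \<in> A" "b \<in> B" using assms by auto
  let ?A = "A - {a}" and ?B = "B - {b}"
  define F where "F i j = \<lfloor>y i j\<rfloor>" for i j
  define \<phi> where "\<phi> i j = y i j - of_int (F i j)" for i j
  have \<phi>: "0 \<le> \<phi> i j" "\<phi> i j \<le> 1" for i j unfolding \<phi>_def F_def by linarith+
  define M where "M i j = (if i = a then
      (if j = b then R a - (\<Sum>j\<in>?B. C j - (\<Sum>i\<in>?A. F i j)) else C j - (\<Sum>i\<in>?A. F i j))
      else if j = b then R i - (\<Sum>j\<in>?B. F i j) else F i j)" for i j
  have sA: "(\<Sum>i\<in>A. f i) = f a + (\<Sum>i\<in>?A. f i)" for f :: "'a \<Rightarrow> 'c::comm_monoid_add"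
    using fin ab by (intro sum.remove) auto
  have sB: "(\<Sum>j\<in>B. f j) = f b + (\<Sum>j\<in>?B. f j)" for f :: "'b \<Rightarrow> 'c::comm_monoid_add"
    using fin ab by (intro sum.remove) auto
  \<comment> \<open>Both margins add up all entries of \<open>y\<close>. Their equal totals make
    column \<open>b\<close> come out right, although the corner is defined through row
    \<open>a\<close>.\<close>
  have "real_of_int (\<Sum>i\<in>A. R i) = (\<Sum>i\<in>A. \<Sum>j\<in>B. y i j)" using R by simp
  also have "\<dots> = real_of_int (\<Sum>j\<in>B. C j)" by (subst sum.swap) (use C in simp)
  finally have RC: "(\<Sum>i\<in>A. R i) = (\<Sum>j\<in>B. C j)" by linarith
  have Ma: "(\<Sum>j\<in>?B. M a j) = (\<Sum>j\<in>?B. C j - (\<Sum>i\<in>?A. F i j))"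
    by (rule sum.cong) (auto simp: M_def)
  have Mb: "(\<Sum>i\<in>?A. M i b) = (\<Sum>i\<in>?A. R i - (\<Sum>j\<in>?B. F i j))"
    by (rule sum.cong) (auto simp: M_def)
  have "(\<Sum>j\<in>B. M i j) = R i" if i: "i \<in> A" for i
  proof (cases "i = a")
    case True
    thus ?thesis using Ma by (simp add: sB M_def)
  next
    case False
    hence "(\<Sum>j\<in>?B. M i j) = (\<Sum>j\<in>?B. F i j)" by (intro sum.cong) (auto simp: M_def)
    thus ?thesis using False by (simp add: sB M_def)
  qed
  moreover have "(\<Sum>i\<in>A. M i j) = C j" if j: "j \<in> B" for j
  proof (cases "j = b")
    case True
    have "(\<Sum>i\<in>A. M i b) = M a b + (\<Sum>i\<in>?A. R i - (\<Sum>j\<in>?B. F i j))"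
      by (simp only: sA Mb)
    also have "\<dots> = R a + (\<Sum>i\<in>?A. R i) - (\<Sum>j\<in>?B. C j)
        + ((\<Sum>j\<in>?B. \<Sum>i\<in>?A. F i j) - (\<Sum>i\<in>?A. \<Sum>j\<in>?B. F i j))"
      by (simp add: M_def sum_subtractf)
    also have "(\<Sum>j\<in>?B. \<Sum>i\<in>?A. F i j) = (\<Sum>i\<in>?A. \<Sum>j\<in>?B. F i j)" by (rule sum.swap)
    also have "R a + (\<Sum>i\<in>?A. R i) = C b + (\<Sum>j\<in>?B. C j)" using RC unfolding sA[of R] sB[of C] .
    finally show ?thesis using True by simp
  next
    case False
    hence "(\<Sum>i\<in>?A. M i j) = (\<Sum>i\<in>?A. F i j)" by (intro sum.cong) (auto simp: M_def)
    thus ?thesis using False by (simp add: sA M_def)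
  qed
  moreover have "\<bar>of_int (M i j) - y i j\<bar> \<le> real (card A * card B)" if ij: "i \<in> A" "j \<in> B" for i j
  proof -
    have cA: "card A \<ge> 1" and cB: "card B \<ge> 1"
      using fin ab by (auto simp: Suc_le_eq card_gt_0_iff)
    have cA': "card ?A \<le> card A" and cB': "card ?B \<le> card B" using fin by (auto intro: card_mono)
    have m1: "card ?A \<le> card A * card B" using cA' cB by (metis le_trans mult.right_neutral mult_le_mono2)
    have m2: "card ?B \<le> card A * card B" using cB' cA by (metis le_trans mult.left_neutral mult_le_mono1)
    have m3: "card ?B * card ?A \<le> card A * card B" using cA' cB' by (metis mult.commute mult_le_mono)
    have m4: "1 \<le> card A * card B" using cA cB by (metis mult.right_neutral mult_le_mono)
    have bd: "0 \<le> (\<Sum>j\<in>S. \<phi> i j)" "(\<Sum>j\<in>S. \<phi> i j) \<le> real (card S)" for i and S :: "'b set"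
      using \<phi> sum_bounded_above[of S "\<phi> i" 1] by (auto intro: sum_nonneg)
    have bd': "0 \<le> (\<Sum>i\<in>S. \<phi> i j)" "(\<Sum>i\<in>S. \<phi> i j) \<le> real (card S)" for j and S :: "'a set"
      using \<phi> sum_bounded_above[of S "\<lambda>i. \<phi> i j" 1] by (auto intro: sum_nonneg)
    have row: "of_int (R i) - (\<Sum>j\<in>?B. of_int (F i j)) - y i b = (\<Sum>j\<in>?B. \<phi> i j)"
      using R[OF ij(1)] by (simp add: sB \<phi>_def sum_subtractf)
    have col: "of_int (C j) - (\<Sum>i\<in>?A. of_int (F i j)) - y a j = (\<Sum>i\<in>?A. \<phi> i j)" if "j \<in> B" for j
      using C[OF that] by (simp add: sA \<phi>_def sum_subtractf)
    consider "i \<noteq> a" "j \<noteq> b" | "i \<noteq> a" "j = b" | "i = a" "j \<noteq> b" | "i = a" "j = b" by blast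
    thus ?thesis
    proof cases
      case 1
      hence "\<bar>of_int (M i j) - y i j\<bar> \<le> 1" using \<phi>[of i j] by (simp add: M_def \<phi>_def)
      thus ?thesis using m4 by linarith
    next
      case 2
      hence "of_int (M i j) - y i j = (\<Sum>j\<in>?B. \<phi> i j)" using row by (simp add: M_def)
      moreover have "0 \<le> (\<Sum>j\<in>?B. \<phi> i j)" "(\<Sum>j\<in>?B. \<phi> i j) \<le> real (card ?B)" by (rule bd)+
      ultimately show ?thesis using m2 by linarith
    next
      case 3
      hence "of_int (M i j) - y i j = (\<Sum>i\<in>?A. \<phi> i j)" using col[OF ij(2)] by (simp add: M_def)
      moreover have "0 \<le> (\<Sum>i\<in>?A. \<phi> i j)" "(\<Sum>i\<in>?A. \<phi> i j) \<le> real (card ?A)" by (rule bd')+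
      ultimately show ?thesis using m1 by linarith
    next
      case 4
      have "of_int (R a) = y a b + (\<Sum>j\<in>?B. y a j)" using R[OF ab(1)] by (simp add: sB)
      hence "of_int (M i j) - y i j = - (\<Sum>j\<in>?B. of_int (C j) - (\<Sum>i\<in>?A. of_int (F i j)) - y a j)"
        using 4 by (simp add: M_def sum_subtractf)
      also have "(\<Sum>j\<in>?B. of_int (C j) - (\<Sum>i\<in>?A. of_int (F i j)) - y a j) = (\<Sum>j\<in>?B. \<Sum>i\<in>?A. \<phi> i j)"
        by (rule sum.cong[OF refl]) (rule col, simp)
      finally have e: "of_int (M i j) - y i j = - (\<Sum>j\<in>?B. \<Sum>i\<in>?A. \<phi> i j)" .
      have "(\<Sum>j\<in>?B. \<Sum>i\<in>?A. \<phi> i j) \<le> real (card ?B) * real (card ?A)"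
        using bd' by (intro sum_bounded_above) auto
      moreover have "0 \<le> (\<Sum>j\<in>?B. \<Sum>i\<in>?A. \<phi> i j)" using \<phi> by (intro sum_nonneg) auto
      moreover have "real (card ?B) * real (card ?A) \<le> real (card A * card B)"
        using m3 by (metis of_nat_le_iff of_nat_mult)
      ultimately show ?thesis unfolding e by linarith
    qed
  qed
  ultimately show ?thesis by blast
qed

subsection \<open>Bipartite degree sequences and tail bounds\<close>

definition cross_edges :: "'v set \<Rightarrow> 'v set \<Rightarrow> 'v set set" where
  "cross_edges A B = (\<lambda>(x, y). {x, y}) ` (A \<times> B)"

lemma inj_on_cross:
  "A \<inter> B = {} \<Longrightarrow> inj_on (\<lambda>(x, y). {x, y}) (A \<times> B)"
  by (auto simp: inj_on_def doubleton_eq_iff)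

lemma finite_cross_edges: "finite A \<Longrightarrow> finite B \<Longrightarrow> finite (cross_edges A B)"
  by (simp add: cross_edges_def)

lemma card_cross_edges: "A \<inter> B = {} \<Longrightarrow> card (cross_edges A B) = card A * card B"
  by (simp add: cross_edges_def card_image inj_on_cross card_cartesian_product)

lemma cross_edges_commute: "cross_edges A B = cross_edges B A"
  by (force simp: cross_edges_def insert_commute)

lemma sum_cross_edges_at:
  assumes "finite A" "finite B" "A \<inter> B = {}" "x \<in> A"
  shows "(\<Sum>e\<in>cross_edges A B. of_bool (x \<in> e) * f e) = (\<Sum>y\<in>B. f {x, y} :: 'b :: comm_ring_1)"
proof -
  have "(\<Sum>e\<in>cross_edges A B. of_bool (x \<in> e) * f e) = (\<Sum>e\<in>(\<lambda>y. {x, y}) ` B. of_bool (x \<in> e) * f e)"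
    using assms by (intro sum.mono_neutral_right) (auto simp: cross_edges_def)
  also have "\<dots> = (\<Sum>y\<in>B. f {x, y})"
    using assms by (subst sum.reindex) (auto simp: inj_on_def doubleton_eq_iff)
  finally show ?thesis .
qed

text \<open>Correcting \<open>p\<close> to meet the margins exactly moves each entry by at most
  \<open>3 * \<theta>\<close>, and rounding after scaling by \<open>N\<close> by at most
  \<open>\<theta>\<close> more. So \<open>4 * \<theta> < \<delta>\<close> keeps the multiplicities
  strictly between 0 and \<open>N\<close>, and \<open>32\<close> is
  \<open>2 * 4\<^sup>2\<close>.\<close>

lemma prob_bipartite_degrees_ge:
  fixes p :: "'v set \<Rightarrow> real" and r :: "'v \<Rightarrow> int"
  assumes fin: "finite A" "finite B" and ne: "A \<noteq> {}" "B \<noteq> {}" and disj: "A \<inter> B = {}"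
    and \<delta>: "0 < \<delta>" "\<delta> \<le> 1 / 2" and \<theta>: "0 < \<theta>" "4 * \<theta> < \<delta>"
    and p: "\<And>e. e \<in> cross_edges A B \<Longrightarrow> \<delta> \<le> p e \<and> p e \<le> 1 - \<delta>"
    and rA: "\<And>x. x \<in> A \<Longrightarrow> \<bar>of_int (r x) - (\<Sum>y\<in>B. p {x, y})\<bar> \<le> \<theta> * real (card B)"
    and rB: "\<And>y. y \<in> B \<Longrightarrow> \<bar>of_int (r y) - (\<Sum>x\<in>A. p {x, y})\<bar> \<le> \<theta> * real (card A)"
    and bal: "sum r A = sum r B"
  shows "exp (- (32 * \<theta>\<^sup>2 / \<delta> * real (card A * card B) + 1))
    \<le> (2 * (real (card A * card B) + 1)) ^ (card A + card B) *
      (\<Sum>X | X \<subseteq> cross_edges A B \<and> (\<forall>v\<in>A \<union> B. int (card {e \<in> X. v \<in> e}) = r v).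
        bern_weight p (cross_edges A B) X)"
proof -
  let ?E = "cross_edges A B"
  define m where "m = card A * card B"
  have cE: "card ?E = m" using disj by (simp add: card_cross_edges m_def)
  have finE: "finite ?E" using fin by (rule finite_cross_edges)
  have cA: "real (card A) > 0" and cB: "real (card B) > 0"
    using fin ne by (auto simp: card_gt_0_iff)
  have m0: "real m > 0" using cA cB by (simp add: m_def)
  define \<rho> where "\<rho> x = of_int (r x) - (\<Sum>y\<in>B. p {x, y})" for x
  define \<gamma> where "\<gamma> y = of_int (r y) - (\<Sum>x\<in>A. p {x, y})" for y
  define \<Theta> where "\<Theta> = sum \<rho> A"
  have \<Theta>': "\<Theta> = sum \<gamma> B"
  proof -
    have "\<Theta> = of_int (sum r A) - (\<Sum>x\<in>A. \<Sum>y\<in>B. p {x, y})"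
      by (simp add: \<Theta>_def \<rho>_def sum_subtractf)
    also have "(\<Sum>x\<in>A. \<Sum>y\<in>B. p {x, y}) = (\<Sum>y\<in>B. \<Sum>x\<in>A. p {x, y})" by (rule sum.swap)
    finally show ?thesis by (simp add: bal \<gamma>_def sum_subtractf)
  qed
  have \<Theta>b: "\<bar>\<Theta>\<bar> \<le> \<theta> * real m"
  proof -
    have "\<bar>\<Theta>\<bar> \<le> (\<Sum>x\<in>A. \<bar>\<rho> x\<bar>)" unfolding \<Theta>_def by (rule sum_abs)
    also have "\<dots> \<le> (\<Sum>x\<in>A. \<theta> * real (card B))"
      by (rule sum_mono) (use rA in \<open>simp add: \<rho>_def\<close>)
    finally show ?thesis by (simp add: m_def mult.commute mult.left_commute)
  qed
  \<comment> \<open>Spread each row error over its row and each column error over its column. The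
    last term compensates for the total error \<open>\<Theta>\<close>, which would otherwise be
    counted twice.\<close>
  define x where "x i j = p {i, j} + \<rho> i / real (card B) + \<gamma> j / real (card A) - \<Theta> / real m" for i j
  have xp: "\<bar>x i j - p {i, j}\<bar> \<le> 3 * \<theta>" if "i \<in> A" "j \<in> B" for i j
  proof -
    have "\<bar>\<rho> i / real (card B)\<bar> \<le> \<theta>" using rA[OF that(1)] cB by (simp add: \<rho>_def field_simps)
    moreover have "\<bar>\<gamma> j / real (card A)\<bar> \<le> \<theta>" using rB[OF that(2)] cA by (simp add: \<gamma>_def field_simps)
    moreover have "\<bar>\<Theta> / real m\<bar> \<le> \<theta>" using \<Theta>b m0 by (simp add: field_simps)
    ultimately show ?thesis unfolding x_def by linarith
  qed
  have xrow: "(\<Sum>j\<in>B. x i j) = of_int (r i)" if "i \<in> A" for i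
  proof -
    have "(\<Sum>j\<in>B. x i j) = (\<Sum>j\<in>B. p {i, j}) + \<rho> i + \<Theta> / real (card A) - real (card B) * (\<Theta> / real m)"
      using cB by (simp add: x_def sum.distrib sum_subtractf \<Theta>' sum_divide_distrib)
    also have "real (card B) * (\<Theta> / real m) = \<Theta> / real (card A)" using cB by (simp add: m_def)
    finally show ?thesis by (simp add: \<rho>_def)
  qed
  have xcol: "(\<Sum>i\<in>A. x i j) = of_int (r j)" if "j \<in> B" for j
  proof -
    have "(\<Sum>i\<in>A. x i j) = (\<Sum>i\<in>A. p {i, j}) + \<gamma> j + \<Theta> / real (card B) - real (card A) * (\<Theta> / real m)"
      using cA by (simp add: x_def sum.distrib sum_subtractf \<Theta>_def sum_divide_distrib)
    also have "real (card A) * (\<Theta> / real m) = \<Theta> / real (card B)" using cA by (simp add: m_def)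
    finally show ?thesis by (simp add: \<gamma>_def)
  qed
  \<comment> \<open>The first summand is the size that \<open>prob_incidence_ge\<close> demands; the
    second makes the rounding error \<open>m\<close> at most \<open>\<theta> * N\<close>.\<close>
  obtain k where k: "4 * real m ^ 2 + real m / \<theta> \<le> 2 ^ k"
    using real_arch_pow[of 2 "4 * real m ^ 2 + real m / \<theta>"] by (auto intro: less_imp_le)
  define N where "N = (2::nat) ^ k"
  have N: "4 * real m ^ 2 + real m / \<theta> \<le> real N" "N > 0" using k by (simp_all add: N_def)
  have N1: "4 * real m ^ 2 \<le> real N" using N(1) \<theta> m0 by (smt (verit) divide_nonneg_pos)
  have N2: "real m \<le> \<theta> * real N"
  proof -
    have "real m / \<theta> \<le> real N" using N(1) by (smt (verit) zero_le_power2)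
    thus ?thesis using \<theta> by (simp add: field_simps)
  qed
  obtain M0 :: "'v \<Rightarrow> 'v \<Rightarrow> int" where
    M0r: "\<And>i. i \<in> A \<Longrightarrow> (\<Sum>j\<in>B. M0 i j) = int N * r i" and
    M0c: "\<And>j. j \<in> B \<Longrightarrow> (\<Sum>i\<in>A. M0 i j) = int N * r j" and
    M0b: "\<And>i j. i \<in> A \<Longrightarrow> j \<in> B \<Longrightarrow> \<bar>of_int (M0 i j) - real N * x i j\<bar> \<le> real m"
  proof -
    have R: "(\<Sum>j\<in>B. real N * x i j) = of_int (int N * r i)" if "i \<in> A" for i
      using xrow[OF that] by (simp add: sum_distrib_left[symmetric])
    have C: "(\<Sum>i\<in>A. real N * x i j) = of_int (int N * r j)" if "j \<in> B" for j
      using xcol[OF that] by (simp add: sum_distrib_left[symmetric])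
    show ?thesis
      using integer_matrix_rounding[OF fin ne, of "\<lambda>i j. real N * x i j" "\<lambda>i. int N * r i" "\<lambda>j. int N * r j", OF R C] that
      unfolding m_def by blast
  qed
  \<comment> \<open>An edge has exactly one end on each side, so the two descriptions recover its
    row and column.\<close>
  define M where "M e = nat (M0 (THE i. i \<in> e \<inter> A) (THE j. j \<in> e \<inter> B))" for e
  have Mij: "M {i, j} = nat (M0 i j)" if "i \<in> A" "j \<in> B" for i j
  proof -
    have "{i, j} \<inter> A = {i}" "{i, j} \<inter> B = {j}" using that disj by auto
    thus ?thesis by (simp add: M_def)
  qed
  have close: "\<bar>of_int (M0 i j) - real N * p {i, j}\<bar> \<le> real N * (4 * \<theta>)" if "i \<in> A" "j \<in> B" for i j
  proof -
    have "real N * x i j - real N * p {i, j} = real N * (x i j - p {i, j})" by (simp add: algebra_simps)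
    hence "\<bar>real N * x i j - real N * p {i, j}\<bar> \<le> real N * (3 * \<theta>)"
      using mult_left_mono[OF xp[OF that], of "real N"] by (simp add: abs_mult)
    thus ?thesis using M0b[OF that] N2 by (simp add: algebra_simps)
  qed
  have M: "0 < M0 i j \<and> M0 i j < int N" if ij: "i \<in> A" "j \<in> B" for i j
  proof -
    have e: "{i, j} \<in> ?E" using ij by (auto simp: cross_edges_def)
    have "real N * (4 * \<theta>) < real N * p {i, j}" "real N * p {i, j} < real N * (1 - 4 * \<theta>)"
      using p[OF e] \<theta> N(2) by (intro mult_strict_left_mono; simp)+
    hence "0 < real_of_int (M0 i j)" "real_of_int (M0 i j) < real N"
      using close[OF ij] by (simp_all add: algebra_simps)
    thus ?thesis by linarith
  qed
  \<comment> \<open>The opposite signs of the two sides make every incidence vector sum to zero;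
    \<open>c\<close> reverses the margins of \<open>B\<close> accordingly.\<close>
  define a :: "'v set \<Rightarrow> 'v \<Rightarrow> int" where "a e v = of_bool (v \<in> e) * (if v \<in> A then 1 else - 1)" for e v
  define c where "c v = (if v \<in> A then r v else - r v)" for v
  have sumV: "(\<Sum>v\<in>A \<union> B. of_bool (v \<in> {i, j}) * g v) = g i + g j" if "i \<in> A" "j \<in> B"
    for i j and g :: "'v \<Rightarrow> int"
  proof -
    have "(\<Sum>v\<in>A \<union> B. of_bool (v \<in> {i, j}) * g v) = (\<Sum>v\<in>{i, j}. of_bool (v \<in> {i, j}) * g v)"
      using that fin by (intro sum.mono_neutral_right) auto
    moreover have "i \<noteq> j" using that disj by auto
    ultimately show ?thesis by simp
  qed
  have cV: "card (A \<union> B) = card A + card B" using fin disj by (rule card_Un_disjoint)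
  have "exp (- (2 * (4 * \<theta>)\<^sup>2 / \<delta> * real (card ?E) + 1)) \<le> (2 * (real (card ?E) + 1)) ^ card (A \<union> B) *
    (\<Sum>X | X \<subseteq> ?E \<and> (\<forall>v\<in>A \<union> B. (\<Sum>e\<in>X. a e v) = c v). bern_weight p ?E X)"
  proof (rule prob_incidence_ge[where N = N and k = k and M = M])
    fix e assume "e \<in> ?E"
    then obtain i j where e: "e = {i, j}" "i \<in> A" "j \<in> B" by (auto simp: cross_edges_def)
    have jA: "j \<notin> A" using e disj by auto
    show "(\<Sum>v\<in>A \<union> B. a e v) = 0"
      unfolding a_def e(1) sumV[OF e(2,3)] using e jA by simp
    have "(\<Sum>v\<in>A \<union> B. \<bar>a e v\<bar>) = (\<Sum>v\<in>A \<union> B. of_bool (v \<in> e) * 1)"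
      by (rule sum.cong) (auto simp: a_def)
    also have "\<dots> = 2" unfolding e(1) sumV[OF e(2,3)] by simp
    finally show "(\<Sum>v\<in>A \<union> B. \<bar>a e v\<bar>) \<le> 2" by simp
    have "real (M e) = of_int (M0 i j)" using M[OF e(2,3)] by (simp add: e(1) Mij[OF e(2,3)])
    moreover have "0 < M e" "M e < N" using M[OF e(2,3)] by (auto simp: e(1) Mij[OF e(2,3)])
    moreover have "\<bar>of_int (M0 i j) / real N - p e\<bar> \<le> 4 * \<theta>"
    proof -
      have "of_int (M0 i j) / real N - p e = (of_int (M0 i j) - real N * p e) / real N"
        using N(2) by (simp add: field_simps)
      thus ?thesis using close[OF e(2,3)] N(2) by (simp add: e(1) field_simps)
    qed
    ultimately show "0 < M e \<and> M e < N \<and> \<bar>real (M e) / real N - p e\<bar> \<le> 4 * \<theta>" by simp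
  next
    fix v assume v: "v \<in> A \<union> B"
    have sgn: "(\<Sum>e\<in>?E. int (M e) * a e v) = (if v \<in> A then 1 else - 1) * (\<Sum>e\<in>?E. of_bool (v \<in> e) * int (M e))"
      by (simp add: a_def sum_distrib_left mult.commute mult.left_commute)
    show "(\<Sum>e\<in>?E. int (M e) * a e v) = int N * c v"
    proof (cases "v \<in> A")
      case True
      have "(\<Sum>e\<in>?E. of_bool (v \<in> e) * int (M e)) = (\<Sum>j\<in>B. int (M {v, j}))"
        by (rule sum_cross_edges_at) (use fin disj True in auto)
      also have "\<dots> = (\<Sum>j\<in>B. M0 v j)"
        using M True by (intro sum.cong) (auto simp: Mij less_imp_le)
      finally show ?thesis using True M0r by (simp add: sgn c_def)
    next
      case False
      hence vB: "v \<in> B" using v by simp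
      have "(\<Sum>e\<in>?E. of_bool (v \<in> e) * int (M e)) = (\<Sum>i\<in>A. int (M {v, i}))"
        unfolding cross_edges_commute[of A B] by (rule sum_cross_edges_at) (use fin disj vB in auto)
      also have "\<dots> = (\<Sum>i\<in>A. M0 i v)"
        using M vB by (intro sum.cong refl) (subst insert_commute, auto simp: Mij less_imp_le)
      finally show ?thesis using False vB M0c by (simp add: sgn c_def)
    qed
  qed (use fin finE \<delta> \<theta> p N1 in \<open>auto simp: N_def cE\<close>)
  also have "(\<lambda>X. X \<subseteq> ?E \<and> (\<forall>v\<in>A \<union> B. (\<Sum>e\<in>X. a e v) = c v))
      = (\<lambda>X. X \<subseteq> ?E \<and> (\<forall>v\<in>A \<union> B. int (card {e \<in> X. v \<in> e}) = r v))"
  proof (rule ext, rule conj_cong[OF refl], rule ball_cong[OF refl])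
    fix X v assume X: "X \<subseteq> ?E" and "v \<in> A \<union> B"
    have "finite X" using X finE by (rule finite_subset)
    hence "(\<Sum>e\<in>X. of_bool (v \<in> e)) = int (card {e \<in> X. v \<in> e})"
      by (simp add: sum.If_cases of_bool_def Collect_conj_eq)
    hence "(\<Sum>e\<in>X. a e v) = (if v \<in> A then 1 else - 1) * int (card {e \<in> X. v \<in> e})"
      by (simp add: a_def sum_distrib_right[symmetric] sum_negf)
    thus "((\<Sum>e\<in>X. a e v) = c v) = (int (card {e \<in> X. v \<in> e}) = r v)"
      by (simp add: c_def)
  qed
  finally show ?thesis by (simp only: cE cV m_def power_mult_distrib) (simp add: power2_eq_square)
qed

section \<open>Chernoff bounds for the product measure\<close>

text \<open>For negative \<open>u\<close> multiply by \<open>1 - u > 0\<close>: the right side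
  becomes \<open>1 - u ^ 3 \<ge> 1\<close>, the left side is at most 1 because
  \<open>1 - u \<le> exp (- u)\<close>.\<close>

lemma exp_le_quadratic:
  fixes u :: real
  assumes "\<bar>u\<bar> \<le> 1"
  shows "exp u \<le> 1 + u + u\<^sup>2"
proof (cases "u \<ge> 0")
  case True
  thus ?thesis using exp_bound[of u] assms by simp
next
  case False
  have "1 - u \<le> exp (- u)" using exp_ge_add_one_self[of "- u"] by simp
  hence "exp u * (1 - u) \<le> exp u * exp (- u)" by (intro mult_left_mono) auto
  hence "exp u * (1 - u) \<le> 1" by (simp add: exp_minus)
  also have "1 \<le> (1 + u + u\<^sup>2) * (1 - u)"
  proof -
    have "(1 + u + u\<^sup>2) * (1 - u) = 1 + (- u) * u\<^sup>2" by (simp add: algebra_simps power2_eq_square)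
    moreover have "0 \<le> (- u) * u\<^sup>2" using False by (intro mult_nonneg_nonneg) auto
    ultimately show ?thesis by linarith
  qed
  finally have "exp u * (1 - u) \<le> (1 + u + u\<^sup>2) * (1 - u)" .
  moreover have "1 - u > 0" using False by simp
  ultimately show ?thesis by (metis mult_le_cancel_right_pos)
qed

text \<open>Exponential moments: each centred term has moment generating function at most
  \<open>exp (l\<^sup>2 * \<bar>a e\<bar>)\<close> at \<open>l\<close>, and
  \<open>l = t / (2 * m)\<close> minimizes \<open>m * l\<^sup>2 - l * t\<close>. The assumption
  \<open>t \<le> 2 * m\<close> gives \<open>l \<le> 1\<close>, the range of the quadratic bound.
  Since \<open>m\<close> bounds the sum of the coefficients, the scale is the size of their support
  and not that of \<open>E\<close>.\<close>

lemma bern_weight_upper_tail: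
  fixes a :: "'e \<Rightarrow> real"
  assumes "finite E" "(\<Sum>e\<in>E. \<bar>a e\<bar>) \<le> m" "0 < m" "0 \<le> t" "t \<le> 2 * m"
    and p: "\<And>e. e \<in> E \<Longrightarrow> 0 \<le> p e \<and> p e \<le> 1"
    and a: "\<And>e. e \<in> E \<Longrightarrow> \<bar>a e\<bar> \<le> 1"
  shows "(\<Sum>X | X \<subseteq> E \<and> t < (\<Sum>e\<in>E. a e * (of_bool (e \<in> X) - p e)). bern_weight p E X)
    \<le> exp (- (t\<^sup>2 / (4 * m)))"
proof -
  define l where "l = t / (2 * m)"
  have l: "0 \<le> l" "l \<le> 1" using assms by (auto simp: l_def field_simps)
  let ?S = "\<lambda>X. \<Sum>e\<in>E. a e * (of_bool (e \<in> X) - p e)"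
  have w: "bern_weight p E X \<ge> 0" for X using p by (intro bern_weight_nonneg) auto
  have "(\<Sum>X | X \<subseteq> E \<and> t < ?S X. bern_weight p E X)
      \<le> (\<Sum>X | X \<subseteq> E \<and> t < ?S X. bern_weight p E X * exp (l * (?S X - t)))"
  proof (rule sum_mono)
    fix X assume "X \<in> {X. X \<subseteq> E \<and> t < ?S X}"
    hence "1 \<le> exp (l * (?S X - t))" using l by simp
    thus "bern_weight p E X \<le> bern_weight p E X * exp (l * (?S X - t))"
      using mult_left_mono[OF _ w[of X], of 1 "exp (l * (?S X - t))"] by simp
  qed
  also have "\<dots> \<le> (\<Sum>X\<in>Pow E. bern_weight p E X * exp (l * (?S X - t)))"
    using assms(1) w by (intro sum_mono2) auto
  also have "\<dots> = exp (- (l * t)) * (\<Sum>X\<in>Pow E. bern_weight p E X *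
      (\<Prod>e\<in>E. if e \<in> X then exp (l * a e * (1 - p e)) else exp (- (l * a e * p e))))"
    unfolding sum_distrib_left
  proof (rule sum.cong[OF refl])
    fix X
    have "exp (l * (?S X - t)) = exp (- (l * t)) * exp (\<Sum>e\<in>E. l * (a e * (of_bool (e \<in> X) - p e)))"
      by (simp add: algebra_simps sum_distrib_left flip: exp_add)
    also have "exp (\<Sum>e\<in>E. l * (a e * (of_bool (e \<in> X) - p e)))
        = (\<Prod>e\<in>E. if e \<in> X then exp (l * a e * (1 - p e)) else exp (- (l * a e * p e)))"
      unfolding exp_sum[OF assms(1)] by (rule prod.cong) (auto simp: mult.assoc)
    finally show "bern_weight p E X * exp (l * (?S X - t)) = exp (- (l * t)) * (bern_weight p E X *
      (\<Prod>e\<in>E. if e \<in> X then exp (l * a e * (1 - p e)) else exp (- (l * a e * p e))))" by simp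
  qed
  also have "(\<Sum>X\<in>Pow E. bern_weight p E X *
      (\<Prod>e\<in>E. if e \<in> X then exp (l * a e * (1 - p e)) else exp (- (l * a e * p e))))
      = (\<Prod>e\<in>E. p e * exp (l * a e * (1 - p e)) + (1 - p e) * exp (- (l * a e * p e)))"
    by (rule sum_bern_weight_prod[OF assms(1)])
  also have "\<dots> \<le> (\<Prod>e\<in>E. exp (l\<^sup>2 * \<bar>a e\<bar>))"
  proof (intro prod_mono conjI)
    fix e assume e: "e \<in> E"
    let ?u = "l * a e"
    have u: "\<bar>?u\<bar> \<le> l" using a[OF e] l mult_left_mono[of "\<bar>a e\<bar>" 1 l] by (simp add: abs_mult)
    show "0 \<le> p e * exp (?u * (1 - p e)) + (1 - p e) * exp (- (?u * p e))" using p[OF e] by simp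
    have "p e * exp (?u * (1 - p e)) + (1 - p e) * exp (- (?u * p e))
        = exp (- (?u * p e)) * (1 + p e * (exp ?u - 1))"
    proof -
      have "exp (?u * (1 - p e)) = exp (- (?u * p e)) * exp ?u"
        by (simp add: algebra_simps flip: exp_add)
      thus ?thesis by (simp add: algebra_simps)
    qed
    also have "\<dots> \<le> exp (- (?u * p e)) * exp (p e * (exp ?u - 1))"
      by (intro mult_left_mono exp_ge_add_one_self) auto
    also have "\<dots> = exp (p e * (exp ?u - 1 - ?u))" by (simp add: algebra_simps flip: exp_add)
    also have "\<dots> \<le> exp (1 * (l\<^sup>2 * \<bar>a e\<bar>))"
    proof -
      have "exp ?u - 1 - ?u \<le> ?u\<^sup>2" using exp_le_quadratic[of ?u] u l by simp
      also have "?u\<^sup>2 = l\<^sup>2 * (\<bar>a e\<bar> * \<bar>a e\<bar>)" by (simp add: power2_eq_square)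
      also have "\<dots> \<le> l\<^sup>2 * (\<bar>a e\<bar> * 1)" using a[OF e] by (intro mult_left_mono) auto
      finally have "p e * (exp ?u - 1 - ?u) \<le> p e * (l\<^sup>2 * \<bar>a e\<bar>)" using p[OF e] by (intro mult_left_mono) auto
      also have "\<dots> \<le> 1 * (l\<^sup>2 * \<bar>a e\<bar>)" using p[OF e] by (intro mult_right_mono) auto
      finally show ?thesis by simp
    qed
    finally show "p e * exp (?u * (1 - p e)) + (1 - p e) * exp (- (?u * p e)) \<le> exp (l\<^sup>2 * \<bar>a e\<bar>)" by simp
  qed
  also have "(\<Prod>e\<in>E. exp (l\<^sup>2 * \<bar>a e\<bar>)) = exp ((\<Sum>e\<in>E. \<bar>a e\<bar>) * l\<^sup>2)"
    using assms(1) by (simp add: exp_sum sum_distrib_left mult.commute)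
  also have "\<dots> \<le> exp (m * l\<^sup>2)" using assms(2) by (simp add: mult_right_mono)
  also have "exp (- (l * t)) * exp (m * l\<^sup>2) = exp (- (t\<^sup>2 / (4 * m)))"
    using assms(3) by (simp add: l_def power2_eq_square field_simps flip: exp_add)
  finally show ?thesis by simp
qed

lemma sum_Un_le:
  fixes f :: "'a \<Rightarrow> real"
  assumes "finite A" "finite B" "\<And>x. f x \<ge> 0"
  shows "sum f (A \<union> B) \<le> sum f A + sum f B"
  using sum.union_inter[OF assms(1,2), of f] sum_nonneg[of "A \<inter> B" f] assms(3) by simp

lemma sum_UN_le:
  fixes f :: "'a \<Rightarrow> real"
  assumes "finite I" "\<And>i. i \<in> I \<Longrightarrow> finite (A i)" "\<And>x. f x \<ge> 0"
  shows "sum f (\<Union>i\<in>I. A i) \<le> (\<Sum>i\<in>I. sum f (A i))"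
  using assms(1,2)
proof (induction I rule: finite_induct)
  case (insert i I)
  thus ?case using sum_Un_le[of "A i" "\<Union>i\<in>I. A i" f] assms(3) by fastforce
qed simp

lemma bern_weight_tail:
  fixes a :: "'e \<Rightarrow> real"
  assumes "finite E" "(\<Sum>e\<in>E. \<bar>a e\<bar>) \<le> m" "0 < m" "0 \<le> t" "t \<le> 2 * m"
    and p: "\<And>e. e \<in> E \<Longrightarrow> 0 \<le> p e \<and> p e \<le> 1"
    and a: "\<And>e. e \<in> E \<Longrightarrow> \<bar>a e\<bar> \<le> 1"
  shows "(\<Sum>X | X \<subseteq> E \<and> t < \<bar>\<Sum>e\<in>E. a e * (of_bool (e \<in> X) - p e)\<bar>. bern_weight p E X)
    \<le> 2 * exp (- (t\<^sup>2 / (4 * m)))"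
proof -
  let ?S = "\<lambda>a X. \<Sum>e\<in>E. a e * (of_bool (e \<in> X) - p e)"
  let ?P = "{X. X \<subseteq> E \<and> t < ?S a X}" and ?N = "{X. X \<subseteq> E \<and> t < ?S (\<lambda>e. - a e) X}"
  have neg: "?S (\<lambda>e. - a e) X = - ?S a X" for X by (simp add: sum_negf)
  have w: "bern_weight p E X \<ge> 0" for X using p by (intro bern_weight_nonneg) auto
  have "(\<Sum>X | X \<subseteq> E \<and> t < \<bar>?S a X\<bar>. bern_weight p E X) \<le> sum (bern_weight p E) (?P \<union> ?N)"
    unfolding neg using w assms(1) by (intro sum_mono2) auto
  also have "\<dots> \<le> sum (bern_weight p E) ?P + sum (bern_weight p E) ?N"
    using w assms(1) by (intro sum_Un_le) auto
  also have "sum (bern_weight p E) ?P \<le> exp (- (t\<^sup>2 / (4 * m)))"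
    using assms by (intro bern_weight_upper_tail) auto
  also have "sum (bern_weight p E) ?N \<le> exp (- (t\<^sup>2 / (4 * m)))"
    using assms by (intro bern_weight_upper_tail) auto
  finally show ?thesis by simp
qed

subsection \<open>Degree sequences of random graphs\<close>

lemma complete_edges_eq: "complete_edges n = {e. e \<subseteq> {1..n} \<and> card e = 2}"
  unfolding complete_edges_def by (auto simp: card_2_iff) blast

lemma finite_complete_edges: "finite (complete_edges n)"
  unfolding complete_edges_eq by (rule finite_subset[of _ "Pow {1..n}"]) auto

lemma card_complete_edges: "card (complete_edges n) = n * (n - 1) div 2"
  using n_subsets[of "{1..n}" 2] by (simp add: complete_edges_eq choose_two)

lemma card_complete_edges_le: "card (complete_edges n) \<le> n\<^sup>2"
  unfolding card_complete_edges power2_eq_square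
  by (meson diff_le_self div_le_dividend le_trans mult_le_mono2)

lemma sum_complete_edges_at:
  assumes "k \<in> {1..n}"
  shows "(\<Sum>e\<in>complete_edges n. of_bool (k \<in> e) * f e) = (\<Sum>j\<in>{1..n} - {k}. f {j, k} :: 'b :: comm_ring_1)"
proof -
  have "(\<Sum>e\<in>complete_edges n. of_bool (k \<in> e) * f e)
      = (\<Sum>e\<in>(\<lambda>j. {j, k}) ` ({1..n} - {k}). of_bool (k \<in> e) * f e)"
  proof (rule sum.mono_neutral_right)
    show "(\<lambda>j. {j, k}) ` ({1..n} - {k}) \<subseteq> complete_edges n"
      using assms unfolding complete_edges_def by blast
    show "\<forall>e\<in>complete_edges n - (\<lambda>j. {j, k}) ` ({1..n} - {k}). of_bool (k \<in> e) * f e = 0"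
    proof
      fix e assume e: "e \<in> complete_edges n - (\<lambda>j. {j, k}) ` ({1..n} - {k})"
      have "k \<notin> e"
      proof
        assume "k \<in> e"
        then obtain j where "e = {j, k}" "j \<in> {1..n}" "j \<noteq> k"
          using e by (auto simp: complete_edges_def insert_commute)
        thus False using e by auto
      qed
      thus "of_bool (k \<in> e) * f e = 0" by simp
    qed
  qed (rule finite_complete_edges)
  also have "\<dots> = (\<Sum>j\<in>{1..n} - {k}. f {j, k})"
    by (subst sum.reindex) (auto simp: inj_on_def doubleton_eq_iff)
  finally show ?thesis .
qed

lemma sum_of_bool_eq_card:
  "finite X \<Longrightarrow> (\<Sum>e\<in>X. of_bool (P e)) = of_nat (card {e \<in> X. P e})"
  by (simp add: sum.If_cases of_bool_def Collect_conj_eq)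

lemma sum_complete_edges_at_le:
  "(\<Sum>e\<in>complete_edges n. of_bool (k \<in> e) :: real) \<le> real n"
proof (cases "k \<in> {1..n}")
  case True
  have "(\<Sum>e\<in>complete_edges n. of_bool (k \<in> e) * (1::real)) = (\<Sum>j\<in>{1..n} - {k}. 1)"
    using True by (rule sum_complete_edges_at)
  thus ?thesis using True by simp
next
  case False
  hence "(\<Sum>e\<in>complete_edges n. of_bool (k \<in> e) :: real) = 0"
    by (intro sum.neutral) (auto simp: complete_edges_eq)
  thus ?thesis by simp
qed

lemma sum_vertices_incident:
  fixes f :: "'v set \<Rightarrow> 'b :: comm_ring_1"
  assumes "finite V" "\<And>e. e \<in> F \<Longrightarrow> e \<subseteq> V"
  shows "(\<Sum>v\<in>V. s v * (\<Sum>e\<in>F. of_bool (v \<in> e) * f e)) = (\<Sum>e\<in>F. f e * (\<Sum>v\<in>e. s v))"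
proof -
  have "(\<Sum>v\<in>V. s v * (\<Sum>e\<in>F. of_bool (v \<in> e) * f e))
      = (\<Sum>e\<in>F. \<Sum>v\<in>V. s v * (of_bool (v \<in> e) * f e))"
    unfolding sum_distrib_left by (rule sum.swap)
  also have "\<dots> = (\<Sum>e\<in>F. f e * (\<Sum>v\<in>e. s v))"
  proof (rule sum.cong[OF refl])
    fix e assume e: "e \<in> F"
    have "(\<Sum>v\<in>V. s v * (of_bool (v \<in> e) * f e)) = (\<Sum>v\<in>e. s v * (of_bool (v \<in> e) * f e))"
      using assms(1) assms(2)[OF e] by (intro sum.mono_neutral_right) auto
    also have "\<dots> = f e * (\<Sum>v\<in>e. s v)" by (simp add: sum_distrib_left mult.commute)
    finally show "(\<Sum>v\<in>V. s v * (of_bool (v \<in> e) * f e)) = f e * (\<Sum>v\<in>e. s v)" .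
  qed
  finally show ?thesis .
qed

text \<open>
  The edges among the first \<open>u\<close> vertices (\<open>Rs\<close> below) are not random: they are chosen such that the
  degrees still missing have equal sums over the two halves.
\<close>
lemma prob_graphs_with_degrees_ge_explicit:
  fixes \<delta> s :: real and d :: "nat \<Rightarrow> nat" and z :: "nat set \<Rightarrow> real"
  assumes \<delta>: "0 < \<delta>" "\<delta> \<le> 1 / 2" and n: "n \<ge> 2" and u: "u \<le> n div 2"
    and R: "8 * real n \<le> \<delta> * (real u * (real u - 1))"
    and s: "s\<^sup>2 = real n * ln (real n)" "s > 0" "2 * s \<le> real n" "60 * s < \<delta> * real n" "real u \<le> s"
    and z: "\<And>e. e \<in> complete_edges n \<Longrightarrow> \<delta> \<le> z e \<and> z e \<le> 1 - \<delta>"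
    and d: "\<And>k. k \<in> {1..n} \<Longrightarrow> (\<Sum>j\<in>{1..n} - {k}. z {j, k}) = real (d k)"
    and ev: "even (\<Sum>k\<in>{1..n}. d k)"
  shows "1 / 2 * \<delta> ^ (u\<^sup>2) * exp (- (32 * (15 * s / real n)\<^sup>2 / \<delta> * (real n)\<^sup>2 + 1))
    \<le> (2 * ((real n)\<^sup>2 + 1)) ^ n * (\<Sum>X\<in>graphs_with_degrees n d. bern_weight z (complete_edges n) X)"
proof -
  define h where "h = n div 2"
  define A where "A = {1..h}"
  define B where "B = {h + 1..n}"
  let ?V = "{1..n}" and ?E = "complete_edges n"
  have V: "?V = A \<union> B" and AB: "A \<inter> B = {}" and finAB: "finite A" "finite B"
    unfolding A_def B_def h_def by auto
  have h1: "1 \<le> h" "h < n" using n by (auto simp: h_def)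
  have neAB: "A \<noteq> {}" "B \<noteq> {}" using h1 by (auto simp: A_def B_def)
  have cardA: "real n \<le> 3 * real (card A)" and cardB: "real n \<le> 3 * real (card B)"
  proof -
    have "n \<le> 3 * h" "n \<le> 3 * (n - h)" using n unfolding h_def by presburger+
    thus "real n \<le> 3 * real (card A)" "real n \<le> 3 * real (card B)"
      by (simp_all add: A_def B_def)
  qed
  have cAB: "card A + card B = n" using h1 by (simp add: A_def B_def)
  \<comment> \<open>\<open>a\<close> counts inner edges with sign, \<open>A\<close> against
    \<open>B\<close>; \<open>\<sigma>\<close> does so for vertices. The signs at the two ends of a
    crossing edge cancel, those of an inner edge add up to \<open>2 * a e\<close>.\<close>
  define a :: "nat set \<Rightarrow> int" where "a e = (if e \<subseteq> A then 1 else - 1)" for e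
  define \<sigma> :: "nat \<Rightarrow> int" where "\<sigma> v = (if v \<in> A then 1 else - 1)" for v
  define In where "In = {e \<in> ?E. e \<subseteq> A \<or> e \<subseteq> B}"
  define Cr where "Cr = cross_edges A B"
  define Rs where "Rs = complete_edges u"
  define E0 where "E0 = In - Rs"
  have finE: "finite ?E" by (rule finite_complete_edges)
  have RsA: "e \<subseteq> A" if "e \<in> Rs" for e
    using that u by (force simp: Rs_def complete_edges_eq A_def h_def)
  have RsIn: "Rs \<subseteq> In"
    using RsA u by (force simp: In_def Rs_def complete_edges_eq)
  have InE: "In \<subseteq> ?E" by (auto simp: In_def)
  have CrE: "Cr \<subseteq> ?E"
    using AB unfolding Cr_def cross_edges_def complete_edges_eq V by (auto simp: card_insert_if)
  have InCr: "In \<inter> Cr = {}"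
    using AB by (auto simp: In_def Cr_def cross_edges_def)
  have EInCr: "?E = In \<union> Cr"
  proof
    show "?E \<subseteq> In \<union> Cr"
    proof
      fix e assume e: "e \<in> ?E"
      then obtain j k where jk: "e = {j, k}" "j \<in> ?V" "k \<in> ?V" by (auto simp: complete_edges_def)
      show "e \<in> In \<union> Cr"
      proof (cases "e \<subseteq> A \<or> e \<subseteq> B")
        case False
        hence "j \<in> A \<and> k \<in> B \<or> k \<in> A \<and> j \<in> B" using jk unfolding V by auto
        thus ?thesis using jk(1) by (auto simp: Cr_def cross_edges_def insert_commute)
      qed (use e in \<open>simp add: In_def\<close>)
    qed
  qed (use InE CrE in auto)
  have InE0: "In = E0 \<union> Rs" "E0 \<inter> Rs = {}" using RsIn by (auto simp: E0_def)
  have fin: "finite In" "finite E0" "finite Rs" "finite Cr"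
    using finE InE CrE by (auto simp: E0_def Rs_def finite_complete_edges intro: finite_subset)
  have z01: "0 \<le> z e \<and> z e \<le> 1" if "e \<in> ?E" for e using z[OF that] \<delta> by linarith
  have sInt: "(\<Sum>v\<in>e. \<sigma> v) = (if e \<in> In then 2 * a e else 0)" if e: "e \<in> ?E" for e
  proof -
    obtain j k where jk: "e = {j, k}" "j \<in> ?V" "k \<in> ?V" "j \<noteq> k"
      using e by (auto simp: complete_edges_def)
    have "(\<Sum>v\<in>e. \<sigma> v) = \<sigma> j + \<sigma> k" using jk by simp
    thus ?thesis using jk AB e unfolding V by (auto simp: \<sigma>_def a_def In_def)
  qed
  have Ad: "(\<Sum>e\<in>?E. of_bool (k \<in> e) * z e) = real (d k)" if "k \<in> ?V" for k
    using sum_complete_edges_at[OF that, of z] d[OF that] by simp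
  \<comment> \<open>In a graph with degrees \<open>d\<close> the signed number of inner edges must
    equal \<open>\<tau>\<close>. The even degree sum makes \<open>\<tau>\<close> an integer.\<close>
  obtain \<tau> :: int where \<tau>: "(\<Sum>v\<in>?V. \<sigma> v * int (d v)) = 2 * \<tau>"
  proof -
    have "(\<Sum>v\<in>?V. \<sigma> v * int (d v)) = (\<Sum>v\<in>?V. int (d v)) - 2 * (\<Sum>v\<in>B. int (d v))"
    proof -
      have "(\<Sum>v\<in>?V. \<sigma> v * int (d v)) = (\<Sum>v\<in>A. \<sigma> v * int (d v)) + (\<Sum>v\<in>B. \<sigma> v * int (d v))"
        unfolding V using finAB AB by (rule sum.union_disjoint)
      also have "(\<Sum>v\<in>A. \<sigma> v * int (d v)) = (\<Sum>v\<in>A. int (d v))"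
        by (rule sum.cong) (auto simp: \<sigma>_def)
      also have "(\<Sum>v\<in>B. \<sigma> v * int (d v)) = (\<Sum>v\<in>B. - int (d v))"
        using AB by (intro sum.cong) (auto simp: \<sigma>_def)
      also have "(\<Sum>v\<in>?V. int (d v)) = (\<Sum>v\<in>A. int (d v)) + (\<Sum>v\<in>B. int (d v))"
        unfolding V using finAB AB by (rule sum.union_disjoint)
      ultimately show ?thesis by (simp add: sum_negf)
    qed
    moreover have "even (\<Sum>v\<in>?V. int (d v))" using ev by (metis even_of_nat of_nat_sum)
    ultimately have "even (\<Sum>v\<in>?V. \<sigma> v * int (d v))" by simp
    thus ?thesis using that by (elim evenE) auto
  qed
  have \<tau>z: "of_int \<tau> = (\<Sum>e\<in>In. of_int (a e) * z e)"
  proof -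
    have "2 * of_int \<tau> = real_of_int (\<Sum>v\<in>?V. \<sigma> v * int (d v))" unfolding \<tau> by simp
    also have "\<dots> = (\<Sum>v\<in>?V. of_int (\<sigma> v) * (\<Sum>e\<in>?E. of_bool (v \<in> e) * z e))"
      using Ad by simp
    also have "\<dots> = (\<Sum>e\<in>?E. z e * (\<Sum>v\<in>e. of_int (\<sigma> v)))"
      by (rule sum_vertices_incident) (auto simp: complete_edges_eq)
    also have "\<dots> = (\<Sum>e\<in>?E. if e \<in> In then 2 * (of_int (a e) * z e) else 0)"
    proof (rule sum.cong[OF refl])
      fix e assume e: "e \<in> ?E"
      have "(\<Sum>v\<in>e. real_of_int (\<sigma> v)) = of_int (\<Sum>v\<in>e. \<sigma> v)" by simp
      thus "z e * (\<Sum>v\<in>e. of_int (\<sigma> v)) = (if e \<in> In then 2 * (of_int (a e) * z e) else 0)"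
        unfolding sInt[OF e] by simp
    qed
    also have "\<dots> = 2 * (\<Sum>e\<in>In. of_int (a e) * z e)"
      unfolding sum_distrib_left using finE InE by (subst sum.inter_restrict[symmetric]) (auto simp: Int_absorb1)
    finally show ?thesis by simp
  qed
  define dev where "dev Y = (\<Sum>e\<in>E0. of_int (a e) * (of_bool (e \<in> Y) - z e))" for Y
  define vdev where "vdev Y v = (\<Sum>e\<in>E0. of_bool (v \<in> e) * (of_bool (e \<in> Y) - z e))" for Y v
  \<comment> \<open>With these thresholds \<open>dev\<close> fails with probability at most
    \<open>2 * exp (- 4) \<le> 1 / 4\<close>, and each vertex with probability at most
    \<open>2 / n ^ 4\<close>; altogether at most 1/2, as \<open>n \<ge> 2\<close>.\<close>
  define Good where "Good = {Y. Y \<subseteq> E0 \<and> \<bar>dev Y\<bar> \<le> 4 * real n \<and> (\<forall>v\<in>?V. \<bar>vdev Y v\<bar> \<le> 4 * s)}"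
  have finGood: "finite Good" unfolding Good_def using fin by simp
  have zE0: "0 \<le> z e \<and> z e \<le> 1" if "e \<in> E0" for e using z01 that InE by (auto simp: E0_def)
  have half: "1 / 2 \<le> (\<Sum>Y\<in>Good. bern_weight z E0 Y)"
  proof -
    let ?w = "bern_weight z E0"
    have w: "?w Y \<ge> 0" for Y using zE0 by (intro bern_weight_nonneg) auto
    let ?D = "{Y. Y \<subseteq> E0 \<and> 4 * real n < \<bar>dev Y\<bar>}"
    let ?F = "\<lambda>v. {Y. Y \<subseteq> E0 \<and> 4 * s < \<bar>vdev Y v\<bar>}"
    have "sum ?w ?D \<le> 2 * exp (- ((4 * real n)\<^sup>2 / (4 * (real n)\<^sup>2)))"
      unfolding dev_def
    proof (rule bern_weight_tail)
      have "\<bar>real_of_int (a e)\<bar> = 1" for e by (simp add: a_def)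
      hence "(\<Sum>e\<in>E0. \<bar>real_of_int (a e)\<bar>) = real (card E0)" by simp
      also have "card E0 \<le> n\<^sup>2"
        using card_mono[OF finE, of E0] card_complete_edges_le[of n] InE by (force simp: E0_def)
      finally show "(\<Sum>e\<in>E0. \<bar>real_of_int (a e)\<bar>) \<le> (real n)\<^sup>2" by (simp flip: of_nat_power)
      show "4 * real n \<le> 2 * (real n)\<^sup>2" using n by (simp add: power2_eq_square)
    qed (use fin n zE0 in \<open>auto simp: a_def\<close>)
    also have "(4 * real n)\<^sup>2 / (4 * (real n)\<^sup>2) = 4" using n by (simp add: power2_eq_square)
    also have "2 * exp (- 4 :: real) \<le> 1 / 4"
    proof -
      have "(8::real) \<le> 2 ^ 4" by simp
      also have "\<dots> \<le> exp 1 ^ 4" using exp_ge_add_one_self[of 1] by (intro power_mono) auto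
      also have "\<dots> = exp (4 :: real)" by (simp flip: exp_of_nat_mult)
      finally have "8 \<le> exp (4 :: real)" .
      thus ?thesis by (simp add: exp_minus field_simps)
    qed
    finally have D: "sum ?w ?D \<le> 1 / 4" .
    have F: "sum ?w (?F v) \<le> 2 / real n ^ 4" for v
    proof -
      have "sum ?w (?F v) \<le> 2 * exp (- ((4 * s)\<^sup>2 / (4 * real n)))"
        unfolding vdev_def
      proof (rule bern_weight_tail)
        have "E0 \<subseteq> ?E" using InE by (auto simp: E0_def)
        hence "(\<Sum>e\<in>E0. \<bar>of_bool (v \<in> e) :: real\<bar>) \<le> (\<Sum>e\<in>?E. \<bar>of_bool (v \<in> e) :: real\<bar>)"
          by (intro sum_mono2[OF finE]) auto
        also have "\<dots> = (\<Sum>e\<in>?E. of_bool (v \<in> e))" by simp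
        also have "\<dots> \<le> real n" by (rule sum_complete_edges_at_le)
        finally show "(\<Sum>e\<in>E0. \<bar>of_bool (v \<in> e) :: real\<bar>) \<le> real n" .
      qed (use fin n zE0 s in auto)
      also have "(4 * s)\<^sup>2 / (4 * real n) = real 4 * ln (real n)"
        using s(1) n by (simp add: power_mult_distrib)
      also have "exp (- (real 4 * ln (real n))) = 1 / real n ^ 4"
        unfolding exp_minus exp_of_nat_mult using n by (simp add: inverse_eq_divide)
      finally show ?thesis by simp
    qed
    have "1 = sum ?w (Pow E0)" using fin by (simp add: sum_bern_weight)
    also have "\<dots> \<le> sum ?w (Good \<union> (?D \<union> (\<Union>v\<in>?V. ?F v)))"
      using w fin finGood by (intro sum_mono2) (auto simp: Good_def)
    also have "\<dots> \<le> sum ?w Good + sum ?w (?D \<union> (\<Union>v\<in>?V. ?F v))"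
      using w fin finGood by (intro sum_Un_le) auto
    also have "sum ?w (?D \<union> (\<Union>v\<in>?V. ?F v)) \<le> sum ?w ?D + sum ?w (\<Union>v\<in>?V. ?F v)"
      using w fin by (intro sum_Un_le) auto
    also have "sum ?w (\<Union>v\<in>?V. ?F v) \<le> (\<Sum>v\<in>?V. sum ?w (?F v))"
      using w fin by (intro sum_UN_le) auto
    also have "\<dots> \<le> (\<Sum>v\<in>?V. 2 / real n ^ 4)" by (rule sum_mono) (rule F)
    also have "\<dots> = 2 / real n ^ 3" using n by (simp add: power_eq_if)
    also have "\<dots> \<le> 2 / 2 ^ 3" using n by (intro divide_left_mono power_mono) auto
    finally show ?thesis using D by simp
  qed
  \<comment> \<open>The degrees within the halves deviate by at most \<open>5 * s\<close>:
    \<open>4 * s\<close> from \<open>Good\<close> and \<open>u \<le> s\<close> from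
    \<open>Rs\<close>. Each half has at least \<open>n / 3\<close> vertices, hence 15.\<close>
  define \<theta> where "\<theta> = 15 * s / real n"
  have \<theta>: "0 < \<theta>" "4 * \<theta> < \<delta>" using s n by (simp_all add: \<theta>_def field_simps)
  \<comment> \<open>The number of edges still needed is the sum of \<open>z\<close> over
    \<open>Rs\<close> minus \<open>dev Y\<close>. Since \<open>z\<close> stays away from 0 and 1,
    that sum keeps a distance of \<open>\<delta> * card Rs \<ge> 4 * n\<close> from both 0 and
    \<open>card Rs\<close>, which exceeds or equals \<open>\<bar>dev Y\<bar>\<close>.\<close>
  have ext: "\<exists>Q. Q \<subseteq> Rs \<and> int (card Q) = \<tau> - (\<Sum>e\<in>Y. a e)" if Y: "Y \<in> Good" for Y
  proof -
    have YE: "Y \<subseteq> E0" using Y by (simp add: Good_def)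
    define w where "w = \<tau> - (\<Sum>e\<in>Y. a e)"
    have "(\<Sum>e\<in>E0. of_int (a e) * of_bool (e \<in> Y)) = real_of_int (\<Sum>e\<in>Y. a e)"
      unfolding of_int_sum using fin YE by (intro sum.mono_neutral_cong_right) auto
    hence dY: "dev Y = of_int (\<Sum>e\<in>Y. a e) - (\<Sum>e\<in>E0. of_int (a e) * z e)"
      by (simp add: dev_def right_diff_distrib sum_subtractf)
    have "of_int \<tau> = (\<Sum>e\<in>E0. of_int (a e) * z e) + (\<Sum>e\<in>Rs. of_int (a e) * z e)"
      unfolding \<tau>z InE0(1) using fin InE0(2) by (intro sum.union_disjoint) auto
    also have "(\<Sum>e\<in>Rs. of_int (a e) * z e) = (\<Sum>e\<in>Rs. z e)"
      by (rule sum.cong) (auto simp: a_def RsA)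
    finally have w: "of_int w = (\<Sum>e\<in>Rs. z e) - dev Y" by (simp add: w_def dY)
    have zR: "\<delta> \<le> z e" "z e \<le> 1 - \<delta>" if "e \<in> Rs" for e
      using z that RsIn InE by auto
    have lo: "\<delta> * real (card Rs) \<le> (\<Sum>e\<in>Rs. z e)"
      using sum_bounded_below[of Rs \<delta> z] zR by (simp add: mult.commute)
    have hi: "(\<Sum>e\<in>Rs. z e) \<le> (1 - \<delta>) * real (card Rs)"
      using sum_bounded_above[of Rs z "1 - \<delta>"] zR by (simp add: mult.commute)
    have "real (card Rs) = real u * (real u - 1) / 2"
    proof (cases "u = 0")
      case False
      have "even (u * (u - 1))" by (cases "even u") auto
      thus ?thesis using False
        by (simp add: Rs_def card_complete_edges real_of_nat_div of_nat_diff)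
    qed (simp add: Rs_def card_complete_edges)
    hence "\<delta> * real (card Rs) = \<delta> * (real u * (real u - 1)) / 2" by simp
    hence big: "4 * real n \<le> \<delta> * real (card Rs)" using R by linarith
    have dv: "\<bar>dev Y\<bar> \<le> 4 * real n" using Y by (simp add: Good_def)
    have "0 \<le> real_of_int w" using w lo big dv by linarith
    moreover have "real_of_int w \<le> real (card Rs)" using w hi big dv by (simp add: algebra_simps)
    ultimately have "nat w \<le> card Rs" "0 \<le> w" by linarith+
    then obtain Q where "Q \<subseteq> Rs" "card Q = nat w" by (metis obtain_subset_with_card_n)
    thus ?thesis using \<open>0 \<le> w\<close> by (auto simp: w_def)
  qed
  then obtain q where q: "\<And>Y. Y \<in> Good \<Longrightarrow> q Y \<subseteq> Rs \<and> int (card (q Y)) = \<tau> - (\<Sum>e\<in>Y. a e)"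
    by metis
  define H where "H Y = Y \<union> q Y" for Y
  define r where "r Y v = int (d v) - int (card {e \<in> H Y. v \<in> e})" for Y v
  define T where "T Y = {X. X \<subseteq> Cr \<and> (\<forall>v\<in>A \<union> B. int (card {e \<in> X. v \<in> e}) = r Y v)}" for Y
  have HIn: "H Y \<subseteq> In" if "Y \<in> Good" for Y
    using q[OF that] that InE0(1) by (auto simp: H_def Good_def)
  define K where "K = (2 * ((real n)\<^sup>2 + 1)) ^ n"
  define x where "x = exp (- (32 * \<theta>\<^sup>2 / \<delta> * (real n)\<^sup>2 + 1))"
  have cABn: "real (card A * card B) \<le> (real n)\<^sup>2"
  proof -
    have "card A * card B \<le> n * n" using cAB by (intro mult_le_mono) auto
    thus ?thesis by (metis of_nat_le_iff of_nat_mult power2_eq_square)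
  qed
  have bip: "x \<le> K * (\<Sum>X\<in>T Y. bern_weight z Cr X)" if Y: "Y \<in> Good" for Y
  proof -
    have YE: "Y \<subseteq> E0" using Y by (simp add: Good_def)
    have finH: "finite (H Y)" using HIn[OF Y] fin by (auto intro: finite_subset)
    have dvH: "\<bar>(\<Sum>e\<in>In. of_bool (v \<in> e) * (of_bool (e \<in> H Y) - z e))\<bar> \<le> 5 * s" if v: "v \<in> ?V" for v
    proof -
      have "(\<Sum>e\<in>In. of_bool (v \<in> e) * (of_bool (e \<in> H Y) - z e))
          = (\<Sum>e\<in>E0. of_bool (v \<in> e) * (of_bool (e \<in> H Y) - z e))
            + (\<Sum>e\<in>Rs. of_bool (v \<in> e) * (of_bool (e \<in> H Y) - z e))"
        unfolding InE0(1) using fin InE0(2) by (intro sum.union_disjoint) auto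
      also have "(\<Sum>e\<in>E0. of_bool (v \<in> e) * (of_bool (e \<in> H Y) - z e)) = vdev Y v"
        unfolding vdev_def using q[OF Y] InE0(2) by (intro sum.cong) (auto simp: H_def)
      finally have e: "(\<Sum>e\<in>In. of_bool (v \<in> e) * (of_bool (e \<in> H Y) - z e))
        = vdev Y v + (\<Sum>e\<in>Rs. of_bool (v \<in> e) * (of_bool (e \<in> H Y) - z e))" .
      have "\<bar>\<Sum>e\<in>Rs. of_bool (v \<in> e) * (of_bool (e \<in> H Y) - z e)\<bar>
          \<le> (\<Sum>e\<in>Rs. \<bar>of_bool (v \<in> e) * (of_bool (e \<in> H Y) - z e)\<bar>)" by (rule sum_abs)
      also have "\<dots> \<le> (\<Sum>e\<in>Rs. of_bool (v \<in> e))"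
      proof (rule sum_mono)
        fix e assume "e \<in> Rs"
        hence "0 \<le> z e \<and> z e \<le> 1" using z01 RsIn InE by blast
        thus "\<bar>of_bool (v \<in> e) * (of_bool (e \<in> H Y) - z e)\<bar> \<le> of_bool (v \<in> e)" by auto
      qed
      also have "\<dots> \<le> real u" unfolding Rs_def by (rule sum_complete_edges_at_le)
      finally have "\<bar>\<Sum>e\<in>Rs. of_bool (v \<in> e) * (of_bool (e \<in> H Y) - z e)\<bar> \<le> s" using s by simp
      moreover have "\<bar>vdev Y v\<bar> \<le> 4 * s" using Y v by (simp add: Good_def)
      ultimately show ?thesis unfolding e by linarith
    qed
    have rz: "of_int (r Y v) - (\<Sum>e\<in>Cr. of_bool (v \<in> e) * z e)
        = - (\<Sum>e\<in>In. of_bool (v \<in> e) * (of_bool (e \<in> H Y) - z e))" if v: "v \<in> ?V" for v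
    proof -
      have "real (d v) = (\<Sum>e\<in>In. of_bool (v \<in> e) * z e) + (\<Sum>e\<in>Cr. of_bool (v \<in> e) * z e)"
        unfolding Ad[OF v, symmetric] EInCr using fin InCr by (intro sum.union_disjoint) auto
      moreover have "real (card {e \<in> H Y. v \<in> e}) = (\<Sum>e\<in>In. of_bool (v \<in> e) * of_bool (e \<in> H Y))"
        unfolding sum_of_bool_eq_card[OF finH, symmetric]
        using fin HIn[OF Y] by (intro sum.mono_neutral_cong_left) auto
      ultimately show ?thesis
        by (simp add: r_def right_diff_distrib sum_subtractf)
    qed
    have "exp (- (32 * \<theta>\<^sup>2 / \<delta> * real (card A * card B) + 1))
      \<le> (2 * (real (card A * card B) + 1)) ^ (card A + card B) *
        (\<Sum>X | X \<subseteq> cross_edges A B \<and> (\<forall>v\<in>A \<union> B. int (card {e \<in> X. v \<in> e}) = r Y v).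
          bern_weight z (cross_edges A B) X)"
    proof (rule prob_bipartite_degrees_ge[OF finAB neAB AB \<delta> \<theta>])
      fix e assume "e \<in> cross_edges A B"
      thus "\<delta> \<le> z e \<and> z e \<le> 1 - \<delta>" using z CrE by (auto simp: Cr_def)
    next
      fix v assume v: "v \<in> A"
      hence vV: "v \<in> ?V" unfolding V by simp
      have "(\<Sum>e\<in>Cr. of_bool (v \<in> e) * z e) = (\<Sum>y\<in>B. z {v, y})"
        unfolding Cr_def using finAB AB v by (rule sum_cross_edges_at)
      hence "\<bar>of_int (r Y v) - (\<Sum>y\<in>B. z {v, y})\<bar> \<le> 5 * s"
        using rz[OF vV] dvH[OF vV] by simp
      also have "5 * s \<le> \<theta> * real (card B)" using cardB s n by (simp add: \<theta>_def field_simps)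
      finally show "\<bar>of_int (r Y v) - (\<Sum>y\<in>B. z {v, y})\<bar> \<le> \<theta> * real (card B)" .
    next
      fix v assume v: "v \<in> B"
      hence vV: "v \<in> ?V" unfolding V by simp
      have "(\<Sum>e\<in>Cr. of_bool (v \<in> e) * z e) = (\<Sum>x\<in>A. z {v, x})"
        unfolding Cr_def cross_edges_commute[of A B] using finAB(2,1) AB v
        by (intro sum_cross_edges_at) auto
      hence "\<bar>of_int (r Y v) - (\<Sum>x\<in>A. z {x, v})\<bar> \<le> 5 * s"
        using rz[OF vV] dvH[OF vV] by (simp add: insert_commute)
      also have "5 * s \<le> \<theta> * real (card A)" using cardA s n by (simp add: \<theta>_def field_simps)
      finally show "\<bar>of_int (r Y v) - (\<Sum>x\<in>A. z {x, v})\<bar> \<le> \<theta> * real (card A)" .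
    next
      \<comment> \<open>The signed degree sum of \<open>H Y\<close> is twice its signed edge number,
        which \<open>q Y\<close> has adjusted to \<open>\<tau>\<close>; so the remaining degrees
        balance.\<close>
      have "(\<Sum>v\<in>?V. \<sigma> v * int (card {e \<in> H Y. v \<in> e})) = (\<Sum>v\<in>?V. \<sigma> v * (\<Sum>e\<in>H Y. of_bool (v \<in> e) * 1))"
        by (simp only: sum_of_bool_eq_card[OF finH] mult_1_right of_nat_id)
      also have "\<dots> = (\<Sum>e\<in>H Y. 1 * (\<Sum>v\<in>e. \<sigma> v))"
        using HIn[OF Y] InE by (intro sum_vertices_incident) (auto simp: complete_edges_eq)
      also have "\<dots> = (\<Sum>e\<in>H Y. 2 * a e)"
      proof (rule sum.cong[OF refl])
        fix e assume "e \<in> H Y"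
        hence "e \<in> In" "e \<in> ?E" using HIn[OF Y] InE by blast+
        thus "1 * (\<Sum>v\<in>e. \<sigma> v) = 2 * a e" by (simp add: sInt)
      qed
      also have "\<dots> = 2 * ((\<Sum>e\<in>Y. a e) + (\<Sum>e\<in>q Y. a e))"
      proof -
        have "finite Y" "finite (q Y)" "Y \<inter> q Y = {}"
          using finH YE q[OF Y] InE0(2) unfolding H_def by auto
        hence "(\<Sum>e\<in>H Y. a e) = (\<Sum>e\<in>Y. a e) + (\<Sum>e\<in>q Y. a e)"
          unfolding H_def by (rule sum.union_disjoint)
        thus ?thesis by (simp flip: sum_distrib_left)
      qed
      also have "(\<Sum>e\<in>q Y. a e) = int (card (q Y))"
      proof -
        have "a e = 1" if "e \<in> q Y" for e using q[OF Y] RsA[of e] that by (auto simp: a_def)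
        thus ?thesis by simp
      qed
      finally have "(\<Sum>v\<in>?V. \<sigma> v * int (card {e \<in> H Y. v \<in> e})) = 2 * \<tau>" using q[OF Y] by simp
      hence "(\<Sum>v\<in>?V. \<sigma> v * r Y v) = 0"
        using \<tau> by (simp add: r_def right_diff_distrib sum_subtractf)
      moreover have "(\<Sum>v\<in>?V. \<sigma> v * r Y v) = (\<Sum>v\<in>A. \<sigma> v * r Y v) + (\<Sum>v\<in>B. \<sigma> v * r Y v)"
        unfolding V using finAB AB by (rule sum.union_disjoint)
      moreover have "(\<Sum>v\<in>A. \<sigma> v * r Y v) = sum (r Y) A" by (rule sum.cong) (auto simp: \<sigma>_def)
      moreover have "(\<Sum>v\<in>B. \<sigma> v * r Y v) = (\<Sum>v\<in>B. - r Y v)"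
        using AB by (intro sum.cong) (auto simp: \<sigma>_def)
      ultimately show "sum (r Y) A = sum (r Y) B" by (simp add: sum_negf)
    qed
    also have "(\<Sum>X | X \<subseteq> cross_edges A B \<and> (\<forall>v\<in>A \<union> B. int (card {e \<in> X. v \<in> e}) = r Y v).
          bern_weight z (cross_edges A B) X) = (\<Sum>X\<in>T Y. bern_weight z Cr X)"
      by (simp add: T_def Cr_def)
    finally have b: "exp (- (32 * \<theta>\<^sup>2 / \<delta> * real (card A * card B) + 1))
      \<le> (2 * (real (card A * card B) + 1)) ^ n * (\<Sum>X\<in>T Y. bern_weight z Cr X)"
      unfolding cAB .
    have "x \<le> exp (- (32 * \<theta>\<^sup>2 / \<delta> * real (card A * card B) + 1))"
    proof -
      have "32 * \<theta>\<^sup>2 / \<delta> * real (card A * card B) \<le> 32 * \<theta>\<^sup>2 / \<delta> * (real n)\<^sup>2"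
        using cABn \<delta> by (intro mult_left_mono) auto
      thus ?thesis unfolding x_def by simp
    qed
    also note b
    also have "(2 * (real (card A * card B) + 1)) ^ n * (\<Sum>X\<in>T Y. bern_weight z Cr X)
        \<le> K * (\<Sum>X\<in>T Y. bern_weight z Cr X)"
      unfolding K_def using cABn z01 CrE
      by (intro mult_right_mono power_mono sum_nonneg bern_weight_nonneg) auto
    finally show ?thesis .
  qed
  \<comment> \<open>No graph arises twice: \<open>Y\<close> and \<open>X\<close> are its parts in
    \<open>E0\<close> and \<open>Cr\<close>, and the part in \<open>Rs\<close> is a function of
    \<open>Y\<close>. The probabilities of the resulting graphs can therefore be added.\<close>
  define f where "f = (\<lambda>(Y, X). H Y \<union> X)"
  define D where "D = Sigma Good T"
  have finT: "finite (T Y)" for Y unfolding T_def using fin by simp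
  have f: "f (Y, X) \<in> graphs_with_degrees n d" "f (Y, X) \<inter> E0 = Y" "f (Y, X) \<inter> Cr = X"
    "bern_weight z ?E (f (Y, X)) = bern_weight z E0 Y * bern_weight z Rs (q Y) * bern_weight z Cr X"
    if YX: "Y \<in> Good" "X \<in> T Y" for Y X
  proof -
    have YE: "Y \<subseteq> E0" and X: "X \<subseteq> Cr" and qR: "q Y \<subseteq> Rs"
      using YX q[OF YX(1)] by (auto simp: Good_def T_def)
    show "f (Y, X) \<inter> E0 = Y" "f (Y, X) \<inter> Cr = X"
      using YE X qR InE0 InCr by (auto simp: f_def H_def)
    have "card {e \<in> f (Y, X). v \<in> e} = d v" if v: "v \<in> ?V" for v
    proof -
      have fH: "finite (H Y)" "finite X" using HIn[OF YX(1)] X fin by (auto intro: finite_subset)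
      have "{e \<in> f (Y, X). v \<in> e} = {e \<in> H Y. v \<in> e} \<union> {e \<in> X. v \<in> e}" by (auto simp: f_def)
      moreover have "{e \<in> H Y. v \<in> e} \<inter> {e \<in> X. v \<in> e} = {}" using HIn[OF YX(1)] X InCr by auto
      ultimately have "card {e \<in> f (Y, X). v \<in> e} = card {e \<in> H Y. v \<in> e} + card {e \<in> X. v \<in> e}"
        using fH by (simp add: card_Un_disjoint)
      moreover have "int (card {e \<in> X. v \<in> e}) = r Y v" using YX(2) v unfolding V by (simp add: T_def)
      ultimately show ?thesis by (simp add: r_def)
    qed
    moreover have "f (Y, X) \<subseteq> ?E" using HIn[OF YX(1)] X InE CrE by (auto simp: f_def)
    ultimately show "f (Y, X) \<in> graphs_with_degrees n d" by (simp add: graphs_with_degrees_def)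
    have "bern_weight z (In \<union> Cr) (H Y \<union> X) = bern_weight z In (H Y) * bern_weight z Cr X"
      using HIn[OF YX(1)] X InCr fin by (intro bern_weight_Un) auto
    also have "bern_weight z In (H Y) = bern_weight z E0 Y * bern_weight z Rs (q Y)"
      unfolding H_def InE0(1) using YE qR InE0(2) fin by (intro bern_weight_Un) auto
    finally show "bern_weight z ?E (f (Y, X)) = bern_weight z E0 Y * bern_weight z Rs (q Y) * bern_weight z Cr X"
      by (simp add: f_def EInCr)
  qed
  have injf: "inj_on f D"
  proof (rule inj_onI)
    fix P P' assume PP: "P \<in> D" "P' \<in> D" "f P = f P'"
    obtain Y X Y' X' where e: "P = (Y, X)" "P' = (Y', X')" by (cases P, cases P')
    have "Y = Y'" using f(2)[of Y X] f(2)[of Y' X'] PP e by (auto simp: D_def)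
    moreover have "X = X'" using f(3)[of Y X] f(3)[of Y' X'] PP e by (auto simp: D_def)
    ultimately show "P = P'" using e by simp
  qed
  \<comment> \<open>This is the whole cost of fixing the edges in \<open>Rs\<close>: each of them is
    present, and absent, with probability at least \<open>\<delta>\<close>.\<close>
  have qw: "\<delta> ^ (u\<^sup>2) \<le> bern_weight z Rs (q Y)" for Y
  proof -
    have "\<delta> ^ (u\<^sup>2) \<le> \<delta> ^ card Rs"
      using \<delta> card_complete_edges_le[of u] by (intro power_decreasing) (auto simp: Rs_def)
    also have "\<dots> = (\<Prod>e\<in>Rs. \<delta>)" by simp
    also have "\<dots> \<le> bern_weight z Rs (q Y)"
      unfolding bern_weight_def
    proof (rule prod_mono)
      fix e assume "e \<in> Rs"
      hence "\<delta> \<le> z e \<and> z e \<le> 1 - \<delta>" using z RsIn InE by blast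
      thus "0 \<le> \<delta> \<and> \<delta> \<le> (if e \<in> q Y then z e else 1 - z e)" using \<delta> by auto
    qed
    finally show ?thesis .
  qed
  have wG: "bern_weight z ?E X \<ge> 0" for X using z01 by (intro bern_weight_nonneg) auto
  have w0: "bern_weight z E0 Y \<ge> 0" for Y using zE0 by (intro bern_weight_nonneg) auto
  have finG: "finite (graphs_with_degrees n d)"
    unfolding graphs_with_degrees_def using finE by simp
  have x0: "x \<ge> 0" by (simp add: x_def)
  have K0: "K \<ge> 0" by (simp add: K_def)
  have "1 / 2 * (\<delta> ^ (u\<^sup>2) * x) \<le> (\<Sum>Y\<in>Good. bern_weight z E0 Y) * (\<delta> ^ (u\<^sup>2) * x)"
    using half x0 \<delta> by (intro mult_right_mono) auto
  also have "\<dots> \<le> (\<Sum>Y\<in>Good. bern_weight z E0 Y * bern_weight z Rs (q Y) * (K * (\<Sum>X\<in>T Y. bern_weight z Cr X)))"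
    unfolding sum_distrib_right
  proof (rule sum_mono)
    fix Y assume Y: "Y \<in> Good"
    have "\<delta> ^ (u\<^sup>2) * x \<le> bern_weight z Rs (q Y) * (K * (\<Sum>X\<in>T Y. bern_weight z Cr X))"
      using qw[of Y] bip[OF Y] x0 \<delta> order_trans[OF _ qw[of Y], of 0] by (intro mult_mono) auto
    thus "bern_weight z E0 Y * (\<delta> ^ (u\<^sup>2) * x)
        \<le> bern_weight z E0 Y * bern_weight z Rs (q Y) * (K * (\<Sum>X\<in>T Y. bern_weight z Cr X))"
      using mult_left_mono[OF _ w0[of Y]] by (simp add: mult.assoc)
  qed
  also have "\<dots> = K * (\<Sum>Y\<in>Good. \<Sum>X\<in>T Y. bern_weight z E0 Y * bern_weight z Rs (q Y) * bern_weight z Cr X)"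
    by (simp add: sum_distrib_left mult_ac)
  also have "(\<Sum>Y\<in>Good. \<Sum>X\<in>T Y. bern_weight z E0 Y * bern_weight z Rs (q Y) * bern_weight z Cr X)
      = (\<Sum>Y\<in>Good. \<Sum>X\<in>T Y. bern_weight z ?E (f (Y, X)))"
    using f(4) by (intro sum.cong) auto
  also have "\<dots> = (\<Sum>P\<in>D. bern_weight z ?E (f P))"
    unfolding D_def using finGood finT by (subst sum.Sigma) (auto simp: case_prod_unfold)
  also have "\<dots> = sum (bern_weight z ?E) (f ` D)"
    using injf by (simp add: sum.reindex)
  also have "K * sum (bern_weight z ?E) (f ` D) \<le> K * sum (bern_weight z ?E) (graphs_with_degrees n d)"
    using wG finG f(1) K0 by (intro mult_left_mono sum_mono2) (auto simp: D_def)
  finally show ?thesis by (simp add: K_def x_def \<theta>_def mult.assoc)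
qed

text \<open>With \<open>s = sqrt (n ln n)\<close> and \<open>u\<close> of order
  \<open>sqrt (n / \<delta>)\<close> every loss in the explicit bound is
  \<open>exp (- O(n ln n))\<close>. The threshold for \<open>n\<close> must be uniform, so
  \<open>d\<close> and \<open>z\<close> are quantified inside the eventuality.\<close>

lemma prob_graphs_with_degrees_ge:
  fixes \<delta> :: real
  assumes \<delta>: "0 < \<delta>" "\<delta> \<le> 1 / 2"
  shows "\<exists>C. \<forall>\<^sub>F n in sequentially. \<forall>d z.
    (\<forall>e\<in>complete_edges n. \<delta> \<le> z e \<and> z e \<le> 1 - \<delta>) \<longrightarrow>
    (\<forall>k\<in>{1..n}. (\<Sum>j\<in>{1..n} - {k}. z {j, k}) = real (d k)) \<longrightarrow>
    even (\<Sum>k\<in>{1..n}. d k) \<longrightarrow>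
    exp (- (C * (real n * ln (real n))))
      \<le> (\<Sum>X\<in>graphs_with_degrees n d. bern_weight z (complete_edges n) X)"
proof -
  \<comment> \<open>\<open>7200 = 32 * 15\<^sup>2\<close> comes from the bipartite bound,
    \<open>ln (1 / \<delta>)\<close> from \<open>\<delta> ^ (u\<^sup>2)\<close> with
    \<open>u\<^sup>2 \<le> L\<close>, and 4 of the 6 from the factor
    \<open>(2 * (n\<^sup>2 + 1)) ^ n \<le> n ^ (4 * n)\<close>. The other 2 absorb the factor 1/2
    and the \<open>+ 1\<close> in the exponent, as \<open>L \<ge> 1\<close>.\<close>
  define C where "C = 6 + ln (1 / \<delta>) + 7200 / \<delta>"
  let ?s = "\<lambda>n. sqrt (real n * ln (real n))"
  have "\<forall>\<^sub>F n in sequentially. 4 * sqrt (real n / \<delta>) + 2 \<le> ?s n"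
    using \<delta> by real_asymp
  moreover have "\<forall>\<^sub>F n in sequentially. 60 * ?s n < \<delta> * real n"
    using \<delta> by real_asymp
  moreover have "\<forall>\<^sub>F n in sequentially. 3 * ?s n \<le> real n"
    by real_asymp
  ultimately have "\<forall>\<^sub>F n in sequentially. 4 * sqrt (real n / \<delta>) + 2 \<le> ?s n \<and>
      60 * ?s n < \<delta> * real n \<and> 3 * ?s n \<le> real n \<and> n \<ge> 3"
    by (intro eventually_conj eventually_ge_at_top)
  hence "\<forall>\<^sub>F n in sequentially. \<forall>d z.
    (\<forall>e\<in>complete_edges n. \<delta> \<le> z e \<and> z e \<le> 1 - \<delta>) \<longrightarrow>
    (\<forall>k\<in>{1..n}. (\<Sum>j\<in>{1..n} - {k}. z {j, k}) = real (d k)) \<longrightarrow>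
    even (\<Sum>k\<in>{1..n}. d k) \<longrightarrow>
    exp (- (C * (real n * ln (real n))))
      \<le> (\<Sum>X\<in>graphs_with_degrees n d. bern_weight z (complete_edges n) X)"
  proof eventually_elim
    case (elim n)
    define L where "L = real n * ln (real n)"
    define s where "s = sqrt L"
    define q where "q = sqrt (real n / \<delta>)"
    have el: "4 * q + 2 \<le> s" "60 * s < \<delta> * real n" "3 * s \<le> real n" "n \<ge> 3"
      using elim by (auto simp: s_def L_def q_def)
    have q0: "q \<ge> 0" using \<delta> by (simp add: q_def)
    have s0: "s > 0" using el q0 by linarith
    hence L0: "L > 0" by (simp add: s_def)
    hence sL: "s\<^sup>2 = L" by (simp add: s_def)
    have "2 \<le> s" using el q0 by linarith
    hence L1: "1 \<le> L" using power_mono[of 2 s 2] sL by simp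
    \<comment> \<open>Then \<open>u - 1 \<ge> 4 * q\<close>, so
      \<open>\<delta> * u * (u - 1) \<ge> 16 * n\<close>: the reserve \<open>Rs\<close> is large
      enough.\<close>
    define u where "u = nat \<lceil>4 * q\<rceil> + 1"
    have u1: "4 * q \<le> real u - 1" "real u \<le> 4 * q + 2"
      unfolding u_def using q0 by linarith+
    hence us: "real u \<le> s" using el by linarith
    have uh: "u \<le> n div 2"
    proof -
      have "3 * real u \<le> real n" using us el by linarith
      hence "3 * u \<le> n" by linarith
      thus ?thesis using el(4) by presburger
    qed
    have uR: "8 * real n \<le> \<delta> * (real u * (real u - 1))"
    proof -
      have "(4 * q)\<^sup>2 \<le> (real u - 1)\<^sup>2" using u1 q0 by (intro power_mono) auto
      also have "\<dots> \<le> real u * (real u - 1)"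
        using u1(1) q0 unfolding power2_eq_square by (intro mult_right_mono) auto
      finally have "\<delta> * (4 * q)\<^sup>2 \<le> \<delta> * (real u * (real u - 1))" using \<delta> by (intro mult_left_mono) auto
      moreover have "\<delta> * (4 * q)\<^sup>2 = 16 * real n" using \<delta> by (simp add: q_def power_mult_distrib)
      ultimately show ?thesis by simp
    qed
    show ?case
    proof (intro allI impI)
      fix d z
      assume z: "\<forall>e\<in>complete_edges n. \<delta> \<le> z e \<and> z e \<le> 1 - \<delta>"
        and d: "\<forall>k\<in>{1..n}. (\<Sum>j\<in>{1..n} - {k}. z {j, k}) = real (d k)"
        and ev: "even (\<Sum>k\<in>{1..n}. d k)"
      let ?S = "\<Sum>X\<in>graphs_with_degrees n d. bern_weight z (complete_edges n) X"
      have n0: "real n > 0" using el(4) by simp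
      have S0: "?S \<ge> 0"
      proof (intro sum_nonneg bern_weight_nonneg)
        fix e assume "e \<in> complete_edges n"
        hence "\<delta> \<le> z e \<and> z e \<le> 1 - \<delta>" using z by blast
        thus "0 \<le> z e \<and> z e \<le> 1" using \<delta> by linarith
      qed
      have "1 / 2 * \<delta> ^ (u\<^sup>2) * exp (- (32 * (15 * s / real n)\<^sup>2 / \<delta> * (real n)\<^sup>2 + 1))
        \<le> (2 * ((real n)\<^sup>2 + 1)) ^ n * ?S"
        using \<delta> el uh uR s0 us z d ev sL
        by (intro prob_graphs_with_degrees_ge_explicit) (auto simp: L_def)
      also have "32 * (15 * s / real n)\<^sup>2 / \<delta> * (real n)\<^sup>2 = 7200 / \<delta> * L"
        using n0 by (simp add: power_mult_distrib power_divide sL)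
      also have "(2 * ((real n)\<^sup>2 + 1)) ^ n * ?S \<le> exp (4 * L) * ?S"
      proof (rule mult_right_mono[OF _ S0])
        have "2 * ((real n)\<^sup>2 + 1) \<le> real n ^ 4"
        proof -
          have "3\<^sup>2 \<le> (real n)\<^sup>2" using el(4) by (intro power_mono) auto
          hence "3 * (real n)\<^sup>2 \<le> (real n)\<^sup>2 * (real n)\<^sup>2" by (intro mult_right_mono) auto
          moreover have "(real n)\<^sup>2 * (real n)\<^sup>2 = real n ^ 4" by (simp flip: power_add)
          ultimately show ?thesis using \<open>3\<^sup>2 \<le> (real n)\<^sup>2\<close> by simp
        qed
        hence "(2 * ((real n)\<^sup>2 + 1)) ^ n \<le> (real n ^ 4) ^ n" by (intro power_mono) auto
        also have "\<dots> = exp (real (4 * n) * ln (real n))"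
          unfolding exp_of_nat_mult using n0 by (simp add: power_mult)
        also have "\<dots> = exp (4 * L)" by (simp add: L_def mult.assoc)
        finally show "(2 * ((real n)\<^sup>2 + 1)) ^ n \<le> exp (4 * L)" .
      qed
      finally have main: "1 / 2 * \<delta> ^ (u\<^sup>2) * exp (- (7200 / \<delta> * L + 1)) \<le> exp (4 * L) * ?S" .
      have "exp (- (ln (1 / \<delta>) * L)) \<le> \<delta> ^ (u\<^sup>2)"
      proof -
        have "real (u\<^sup>2) \<le> L" unfolding sL[symmetric] of_nat_power using us by (intro power_mono) auto
        hence "ln (1 / \<delta>) * real (u\<^sup>2) \<le> ln (1 / \<delta>) * L"
          using \<delta> by (intro mult_left_mono) auto
        moreover have "\<delta> ^ (u\<^sup>2) = exp (- (ln (1 / \<delta>) * real (u\<^sup>2)))"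
        proof -
          have "exp (real (u\<^sup>2) * ln \<delta>) = \<delta> ^ (u\<^sup>2)" unfolding exp_of_nat_mult using \<delta> by simp
          thus ?thesis using \<delta> by (simp add: ln_div mult.commute)
        qed
        ultimately show ?thesis by simp
      qed
      moreover have "exp (- 1) \<le> (1 / 2 :: real)"
        using exp_ge_add_one_self[of 1] by (simp add: exp_minus field_simps)
      ultimately have "exp (- 1) * exp (- (ln (1 / \<delta>) * L)) * exp (- (7200 / \<delta> * L + 1))
          \<le> 1 / 2 * \<delta> ^ (u\<^sup>2) * exp (- (7200 / \<delta> * L + 1))"
        using \<delta> by (intro mult_right_mono mult_mono) auto
      hence "exp (- 1) * exp (- (ln (1 / \<delta>) * L)) * exp (- (7200 / \<delta> * L + 1)) \<le> exp (4 * L) * ?S"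
        using main by linarith
      hence "exp (- (4 * L)) * (exp (- 1) * exp (- (ln (1 / \<delta>) * L)) * exp (- (7200 / \<delta> * L + 1)))
          \<le> exp (- (4 * L)) * (exp (4 * L) * ?S)" by (intro mult_left_mono) auto
      also have "\<dots> = ?S" by (simp add: exp_minus)
      also have "exp (- (4 * L)) * (exp (- 1) * exp (- (ln (1 / \<delta>) * L)) * exp (- (7200 / \<delta> * L + 1)))
          = exp (- (C * L) + 2 * (L - 1))"
        by (simp add: C_def algebra_simps flip: exp_add)
      finally have "exp (- (C * L) + 2 * (L - 1)) \<le> ?S" .
      moreover have "exp (- (C * L)) \<le> exp (- (C * L) + 2 * (L - 1))" using L1 by simp
      ultimately show "exp (- (C * (real n * ln (real n)))) \<le> ?S"
        unfolding L_def by linarith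
    qed
  qed
  thus ?thesis by blast
qed

section \<open>Equal weights from the maximum entropy property\<close>

lemma indicator_in_degrees:
  assumes "G \<in> graphs_with_degrees n d" "k \<in> {1..n}"
  shows "(\<Sum>j\<in>{1..n} - {k}. of_bool ({j, k} \<in> G)) = real (d k)"
proof -
  have G: "G \<subseteq> complete_edges n" "card {e \<in> G. k \<in> e} = d k"
    using assms by (auto simp: graphs_with_degrees_def)
  have fin: "finite G" using G(1) finite_complete_edges by (rule finite_subset)
  have "(\<Sum>j\<in>{1..n} - {k}. of_bool ({j, k} \<in> G) :: real)
      = (\<Sum>e\<in>complete_edges n. of_bool (k \<in> e) * of_bool (e \<in> G))"
    by (rule sum_complete_edges_at[OF assms(2), symmetric])
  also have "\<dots> = (\<Sum>e\<in>G. of_bool (k \<in> e))"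
    using G(1) finite_complete_edges by (intro sum.mono_neutral_cong_right) auto
  finally show ?thesis unfolding sum_of_bool_eq_card[OF fin] G(2) .
qed

lemma DERIV_binary_entropy:
  fixes x g :: real
  assumes "0 < x" "x < 1"
  shows "((\<lambda>t. (x + t * g) * ln (1 / (x + t * g)) + (1 - (x + t * g)) * ln (1 / (1 - (x + t * g))))
    has_real_derivative g * (ln (1 - x) - ln x)) (at 0)"
proof -
  have inv: "ln (1 / y) = - ln y" for y :: real by (cases "y = 0") (auto simp: ln_div)
  show ?thesis
    unfolding inv using assms by (auto intro!: derivative_eq_intros simp: algebra_simps)
      (simp add: field_simps)
qed

text \<open>Moving along the difference of the two indicator functions preserves all degree sums,
  and \<open>z\<close> is at distance \<open>\<delta>\<close> from the bounds 0 and 1, so both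
  directions stay in the polytope and the derivative of the entropy vanishes. Up to sign this
  derivative is the difference of the logarithms of the two weights.\<close>

lemma max_entropy_bern_weight_eq:
  assumes z: "max_entropy_matrix n d z" and \<delta>: "0 < \<delta>"
    and b: "\<And>e. e \<in> complete_edges n \<Longrightarrow> \<delta> \<le> z e \<and> z e \<le> 1 - \<delta>"
    and G: "G \<in> graphs_with_degrees n d" and G': "G' \<in> graphs_with_degrees n d"
  shows "bern_weight z (complete_edges n) G = bern_weight z (complete_edges n) G'"
proof -
  let ?E = "complete_edges n"
  have finE: "finite ?E" by (rule finite_complete_edges)
  define g :: "nat set \<Rightarrow> real" where "g e = of_bool (e \<in> G) - of_bool (e \<in> G')" for e
  \<comment> \<open>The restriction keeps the value \<open>undefined\<close> off the edge set, as
    membership in the polytope requires.\<close>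
  define x where "x t = restrict (\<lambda>e. z e + t * g e) ?E" for t
  have zP: "z \<in> degree_polytope n d"
    and zmax: "\<And>y. y \<in> degree_polytope n d \<Longrightarrow> edge_entropy n y \<le> edge_entropy n z"
    using z by (auto simp: max_entropy_matrix_def is_arg_max_def not_less)
  have xP: "x t \<in> degree_polytope n d" if t: "\<bar>t\<bar> < \<delta>" for t
  proof -
    have "x t \<in> ?E \<rightarrow>\<^sub>E {0..1}"
    proof
      fix e assume e: "e \<in> ?E"
      have "\<bar>t * g e\<bar> \<le> \<delta> * 1" unfolding abs_mult using t by (intro mult_mono) (auto simp: g_def)
      thus "x t e \<in> {0..1}" using b[OF e] e by (auto simp: x_def)
    qed (simp add: x_def)
    moreover have "(\<Sum>j\<in>{1..n} - {k}. x t {j, k}) = real (d k)" if k: "k \<in> {1..n}" for k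
    proof -
      have "(\<Sum>j\<in>{1..n} - {k}. x t {j, k}) = (\<Sum>j\<in>{1..n} - {k}. z {j, k} + t * g {j, k})"
      proof (rule sum.cong[OF refl])
        fix j assume "j \<in> {1..n} - {k}"
        hence "{j, k} \<in> ?E" using k unfolding complete_edges_def by blast
        thus "x t {j, k} = z {j, k} + t * g {j, k}" by (simp add: x_def)
      qed
      also have "\<dots> = (\<Sum>j\<in>{1..n} - {k}. z {j, k}) +
          t * ((\<Sum>j\<in>{1..n} - {k}. of_bool ({j, k} \<in> G)) - (\<Sum>j\<in>{1..n} - {k}. of_bool ({j, k} \<in> G')))"
        by (simp only: sum.distrib sum_distrib_left[symmetric] g_def sum_subtractf)
      also have "\<dots> = (\<Sum>j\<in>{1..n} - {k}. z {j, k})"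
        using indicator_in_degrees[OF G k] indicator_in_degrees[OF G' k] by simp
      finally show ?thesis using zP k by (simp add: degree_polytope_def)
    qed
    ultimately show ?thesis by (simp add: degree_polytope_def)
  qed
  define \<phi> where "\<phi> t = (\<Sum>e\<in>?E. (z e + t * g e) * ln (1 / (z e + t * g e))
      + (1 - (z e + t * g e)) * ln (1 / (1 - (z e + t * g e))))" for t
  have \<phi>x: "\<phi> t = edge_entropy n (x t)" for t
    unfolding \<phi>_def edge_entropy_def by (rule sum.cong) (auto simp: x_def)
  have \<phi>0: "\<phi> 0 = edge_entropy n z" by (simp add: \<phi>_def edge_entropy_def)
  have "(\<phi> has_real_derivative (\<Sum>e\<in>?E. g e * (ln (1 - z e) - ln (z e)))) (at 0)"
    unfolding \<phi>_def
  proof (rule DERIV_sum)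
    fix e assume "e \<in> ?E"
    thus "((\<lambda>t. (z e + t * g e) * ln (1 / (z e + t * g e))
      + (1 - (z e + t * g e)) * ln (1 / (1 - (z e + t * g e))))
      has_real_derivative g e * (ln (1 - z e) - ln (z e))) (at 0)"
      using b[of e] \<delta> by (intro DERIV_binary_entropy) auto
  qed
  hence crit: "(\<Sum>e\<in>?E. g e * (ln (1 - z e) - ln (z e))) = 0"
    by (rule DERIV_local_max[OF _ \<delta>]) (use \<phi>x \<phi>0 xP zmax in auto)
  have ln_w: "ln (bern_weight z ?E X) = (\<Sum>e\<in>?E. of_bool (e \<in> X) * (ln (z e) - ln (1 - z e)) + ln (1 - z e))" for X
  proof -
    have "ln (bern_weight z ?E X) = (\<Sum>e\<in>?E. ln (if e \<in> X then z e else 1 - z e))"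
      unfolding bern_weight_def
    proof (rule ln_prod[OF finE])
      fix e assume "e \<in> ?E"
      thus "(if e \<in> X then z e else 1 - z e) \<noteq> 0" using b[of e] \<delta> by auto
    qed
    also have "\<dots> = (\<Sum>e\<in>?E. of_bool (e \<in> X) * (ln (z e) - ln (1 - z e)) + ln (1 - z e))"
      by (rule sum.cong) auto
    finally show ?thesis .
  qed
  have pos: "bern_weight z ?E X > 0" for X
    unfolding bern_weight_def using b \<delta> by (intro prod_pos) fastforce
  have "ln (bern_weight z ?E G) - ln (bern_weight z ?E G')
      = - (\<Sum>e\<in>?E. g e * (ln (1 - z e) - ln (z e)))"
    unfolding ln_w sum_subtractf[symmetric] sum_negf[symmetric]
    by (rule sum.cong) (auto simp: g_def)
  thus ?thesis using crit pos by simp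
qed

text \<open>Nonemptiness belongs to the conclusion because \<open>pmf_of_set\<close> is meaningful
  only for nonempty finite sets. It comes out of the positive lower bound for the total weight of
  the graphs.\<close>

theorem theorem1p6:
  fixes \<kappa> \<delta> :: real
  assumes "\<kappa> > 0" and "0 < \<delta>" and "\<delta> \<le> 1 / 2"
  shows "\<exists>\<gamma>::real. \<gamma> > 0 \<and>
    (\<forall>(n::nat) (d::nat \<Rightarrow> nat) (z::nat set \<Rightarrow> real) (S::nat set set) (\<epsilon>::real).
       real n \<ge> \<gamma> \<longrightarrow>
       (\<forall>k\<in>{1..n}. d k > 0) \<longrightarrow>
       tame \<delta> n d \<longrightarrow>
       even (\<Sum>k\<in>{1..n}. d k) \<longrightarrow>
       max_entropy_matrix n d z \<longrightarrow>
       S \<subseteq> complete_edges n \<longrightarrow>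
       real (card S) \<ge> \<delta> * (real n)\<^sup>2 \<longrightarrow>
       \<epsilon> = \<delta> * ln (real n) / sqrt (real n) \<longrightarrow>
       \<epsilon> \<le> 1 \<longrightarrow>
       graphs_with_degrees n d \<noteq> {} \<and>
       measure_pmf.prob (pmf_of_set (graphs_with_degrees n d))
         {G. (1 - \<epsilon>) * (\<Sum>e\<in>S. z e) \<le> real (card (G \<inter> S)) \<and>
             real (card (G \<inter> S)) \<le> (1 + \<epsilon>) * (\<Sum>e\<in>S. z e)}
         \<ge> 1 - 2 * real n powr (- (\<kappa> * real n)))"
proof -
  obtain C where "\<forall>\<^sub>F n in sequentially. \<forall>d z.
    (\<forall>e\<in>complete_edges n. \<delta> \<le> z e \<and> z e \<le> 1 - \<delta>) \<longrightarrow>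
    (\<forall>k\<in>{1..n}. (\<Sum>j\<in>{1..n} - {k}. z {j, k}) = real (d k)) \<longrightarrow>
    even (\<Sum>k\<in>{1..n}. d k) \<longrightarrow>
    exp (- (C * (real n * ln (real n))))
      \<le> (\<Sum>X\<in>graphs_with_degrees n d. bern_weight z (complete_edges n) X)"
    using prob_graphs_with_degrees_ge[OF assms(2,3)] by blast
  \<comment> \<open>The power 5 collects \<open>\<delta>\<^sup>2\<close> from
    \<open>\<epsilon>\<^sup>2\<close>, \<open>\<delta>\<^sup>2\<close> from
    \<open>\<sigma> \<ge> \<delta> * card S\<close>, and \<open>\<delta>\<close> from the size of
    \<open>S\<close>. The tail exponent exceeds \<open>n * ln n\<close> by a factor of order
    \<open>ln n\<close>, so large \<open>n\<close> beats any constants \<open>C\<close> and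
    \<open>\<kappa>\<close>.\<close>
  moreover have "\<forall>\<^sub>F n in sequentially. 4 * (C + \<kappa>) / \<delta> ^ 5 \<le> ln (real n)"
    by real_asymp
  ultimately have "\<forall>\<^sub>F n in sequentially. (\<forall>d z.
    (\<forall>e\<in>complete_edges n. \<delta> \<le> z e \<and> z e \<le> 1 - \<delta>) \<longrightarrow>
    (\<forall>k\<in>{1..n}. (\<Sum>j\<in>{1..n} - {k}. z {j, k}) = real (d k)) \<longrightarrow>
    even (\<Sum>k\<in>{1..n}. d k) \<longrightarrow>
    exp (- (C * (real n * ln (real n))))
      \<le> (\<Sum>X\<in>graphs_with_degrees n d. bern_weight z (complete_edges n) X)) \<and>
    4 * (C + \<kappa>) / \<delta> ^ 5 \<le> ln (real n)"
    by (rule eventually_conj)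
  then obtain N where N: "\<And>n d z. n \<ge> N \<Longrightarrow>
      (\<forall>e\<in>complete_edges n. \<delta> \<le> z e \<and> z e \<le> 1 - \<delta>) \<Longrightarrow>
      (\<forall>k\<in>{1..n}. (\<Sum>j\<in>{1..n} - {k}. z {j, k}) = real (d k)) \<Longrightarrow>
      even (\<Sum>k\<in>{1..n}. d k) \<Longrightarrow>
      exp (- (C * (real n * ln (real n))))
        \<le> (\<Sum>X\<in>graphs_with_degrees n d. bern_weight z (complete_edges n) X)"
    and N2: "\<And>n. n \<ge> N \<Longrightarrow> 4 * (C + \<kappa>) / \<delta> ^ 5 \<le> ln (real n)"
    unfolding eventually_sequentially by blast
  show ?thesis
  proof (intro exI[of _ "real N + 2"] conjI allI impI)
    show "real N + 2 > 0" by simp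
    fix n :: nat and d :: "nat \<Rightarrow> nat" and z :: "nat set \<Rightarrow> real" and S :: "nat set set" and \<epsilon> :: real
    assume n: "real n \<ge> real N + 2" and tame: "tame \<delta> n d" and ev: "even (\<Sum>k\<in>{1..n}. d k)"
      and z: "max_entropy_matrix n d z" and S: "S \<subseteq> complete_edges n"
      and cS: "real (card S) \<ge> \<delta> * (real n)\<^sup>2"
      and \<epsilon>: "\<epsilon> = \<delta> * ln (real n) / sqrt (real n)" "\<epsilon> \<le> 1"
    let ?E = "complete_edges n" and ?G = "graphs_with_degrees n d"
    let ?Ev = "{G. (1 - \<epsilon>) * (\<Sum>e\<in>S. z e) \<le> real (card (G \<inter> S)) \<and>
             real (card (G \<inter> S)) \<le> (1 + \<epsilon>) * (\<Sum>e\<in>S. z e)}"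
    define L where "L = real n * ln (real n)"
    define \<sigma> where "\<sigma> = (\<Sum>e\<in>S. z e)"
    define w where "w = bern_weight z ?E"
    have nN: "n \<ge> N" "n \<ge> 2" using n by linarith+
    have n0: "real n > 0" "ln (real n) \<ge> 0" using nN by auto
    have finE: "finite ?E" by (rule finite_complete_edges)
    have finS: "finite S" using S finE by (rule finite_subset)
    have b: "\<delta> \<le> z e \<and> z e \<le> 1 - \<delta>" if "e \<in> ?E" for e
      using tame z that by (auto simp: tame_def)
    have z01: "0 \<le> z e \<and> z e \<le> 1" if "e \<in> ?E" for e using b[OF that] assms(2) by linarith
    have zP: "z \<in> degree_polytope n d"
      using z by (auto simp: max_entropy_matrix_def is_arg_max_def)
    have low: "exp (- (C * L)) \<le> sum w ?G"
      unfolding L_def w_def using zP b ev nN by (intro N) (auto simp: degree_polytope_def)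
    have finG: "finite ?G"
      unfolding graphs_with_degrees_def using finE by simp
    have G: "?G \<noteq> {}"
    proof
      assume "?G = {}"
      thus False using low by simp
    qed
    then obtain G0 where G0: "G0 \<in> ?G" by blast
    have wG: "w X = w G0" if "X \<in> ?G" for X
      unfolding w_def using max_entropy_bern_weight_eq[OF z assms(2) b that G0] .
    have w0: "w X \<ge> 0" for X unfolding w_def using z01 by (intro bern_weight_nonneg) auto
    \<comment> \<open>All graphs have the weight of \<open>G0\<close>, so quotients of weights are
      quotients of cardinalities, i.e. uniform probabilities.\<close>
    have sumG: "sum w F = real (card F) * w G0" if "F \<subseteq> ?G" for F
    proof -
      have "sum w F = (\<Sum>X\<in>F. w G0)" using that wG by (intro sum.cong) auto
      thus ?thesis by simp
    qed
    have cG: "real (card ?G) > 0" using G finG by (simp add: card_gt_0_iff)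
    have wpos: "w G0 > 0"
    proof -
      have "0 < real (card ?G) * w G0"
        using less_le_trans[OF exp_gt_zero low] sumG[of ?G] by simp
      thus ?thesis using cG by (rule zero_less_mult_pos)
    qed
    have \<epsilon>0: "\<epsilon> \<ge> 0" using \<epsilon>(1) assms(2) n0 by simp
    have \<sigma>lo: "\<delta> * real (card S) \<le> \<sigma>"
      unfolding \<sigma>_def using sum_bounded_below[of S \<delta> z] b S by (auto simp: mult.commute subset_iff)
    have \<sigma>hi: "\<sigma> \<le> real (card S)"
      unfolding \<sigma>_def using sum_bounded_above[of S z 1] z01 S by (auto simp: subset_iff)
    have cS0: "real (card S) > 0"
    proof -
      have "0 < \<delta> * (real n)\<^sup>2" using assms(2) n0 by simp
      thus ?thesis using cS by linarith
    qed
    have \<sigma>0: "\<sigma> \<ge> 0" using \<sigma>lo assms(2) cS0 by (meson less_imp_le mult_nonneg_nonneg order_trans)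
    have dev: "(\<Sum>e\<in>?E. of_bool (e \<in> S) * (of_bool (e \<in> X) - z e)) = real (card (X \<inter> S)) - \<sigma>" for X
    proof -
      have "(\<Sum>e\<in>?E. of_bool (e \<in> S) * (of_bool (e \<in> X) - z e)) = (\<Sum>e\<in>S. of_bool (e \<in> X) - z e)"
        using S finE by (intro sum.mono_neutral_cong_right) auto
      moreover have "{e \<in> S. e \<in> X} = X \<inter> S" by auto
      ultimately show ?thesis
        unfolding sum_subtractf sum_of_bool_eq_card[OF finS] \<sigma>_def by simp
    qed
    have expo: "(C + \<kappa>) * L \<le> (\<epsilon> * \<sigma>)\<^sup>2 / (4 * real (card S))"
    proof -
      have "4 * (C + \<kappa>) \<le> \<delta> ^ 5 * ln (real n)"
        using N2[OF nN(1)] assms(2) by (simp add: field_simps)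
      hence "4 * (C + \<kappa>) * L \<le> \<delta> ^ 5 * ln (real n) * L"
        using n0 by (intro mult_right_mono) (auto simp: L_def)
      also have "\<dots> = \<epsilon>\<^sup>2 * (\<delta>\<^sup>2 * (\<delta> * (real n)\<^sup>2))"
        using n0 by (simp add: \<epsilon>(1) L_def power_divide power_mult_distrib power_numeral_reduce field_simps power2_eq_square)
      also have "\<dots> \<le> \<epsilon>\<^sup>2 * (\<delta>\<^sup>2 * real (card S))" using cS by (intro mult_left_mono) auto
      also have "\<dots> = (\<epsilon> * (\<delta> * real (card S)))\<^sup>2 / real (card S)"
        using cS0 by (simp add: power_mult_distrib power2_eq_square)
      also have "\<dots> \<le> (\<epsilon> * \<sigma>)\<^sup>2 / real (card S)"
        using \<sigma>lo \<epsilon>0 assms(2) by (intro divide_right_mono power_mono mult_left_mono) auto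
      finally show ?thesis by (simp add: field_simps)
    qed
    \<comment> \<open>Conditioning is undone here: the bad graphs with degrees \<open>d\<close> are
      among all bad edge sets, to which the tail bound applies.\<close>
    have "sum w (?G - ?Ev) \<le> (\<Sum>X | X \<subseteq> ?E \<and> \<epsilon> * \<sigma> < \<bar>\<Sum>e\<in>?E. of_bool (e \<in> S) * (of_bool (e \<in> X) - z e)\<bar>. w X)"
    proof (rule sum_mono2)
      show "?G - ?Ev \<subseteq> {X. X \<subseteq> ?E \<and> \<epsilon> * \<sigma> < \<bar>\<Sum>e\<in>?E. of_bool (e \<in> S) * (of_bool (e \<in> X) - z e)\<bar>}"
        unfolding dev by (auto simp: graphs_with_degrees_def algebra_simps \<sigma>_def[symmetric])
    qed (use finE w0 in auto)
    also have "\<dots> \<le> 2 * exp (- ((\<epsilon> * \<sigma>)\<^sup>2 / (4 * real (card S))))"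
      unfolding w_def
    proof (rule bern_weight_tail)
      have "(\<Sum>e\<in>?E. \<bar>of_bool (e \<in> S) :: real\<bar>) = (\<Sum>e\<in>S. 1)"
        using finE S by (intro sum.mono_neutral_cong_right) auto
      thus "(\<Sum>e\<in>?E. \<bar>of_bool (e \<in> S) :: real\<bar>) \<le> real (card S)" by simp
      have "\<epsilon> * \<sigma> \<le> 1 * real (card S)" using \<epsilon> \<epsilon>0 \<sigma>hi \<sigma>0 by (intro mult_mono) auto
      thus "\<epsilon> * \<sigma> \<le> 2 * real (card S)" by simp
    qed (use finE cS0 \<epsilon>0 \<sigma>0 z01 in auto)
    also have "\<dots> \<le> 2 * exp (- ((C + \<kappa>) * L))" using expo by simp
    \<comment> \<open>The part of the exponent with \<open>C\<close> is absorbed by the total weight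
      of \<open>?G\<close>; the part with \<open>\<kappa>\<close> is the claimed bound.\<close>
    also have "\<dots> = 2 * exp (- (\<kappa> * L)) * exp (- (C * L))"
      by (simp add: algebra_simps flip: exp_add)
    also have "\<dots> \<le> 2 * exp (- (\<kappa> * L)) * sum w ?G" using low by (intro mult_left_mono) auto
    finally have "real (card (?G - ?Ev)) * w G0 \<le> 2 * exp (- (\<kappa> * L)) * real (card ?G) * w G0"
      using sumG[of ?G] sumG[of "?G - ?Ev"] by (simp add: mult.assoc)
    hence bad: "real (card (?G - ?Ev)) \<le> 2 * exp (- (\<kappa> * L)) * real (card ?G)"
      using wpos by (rule mult_right_le_imp_le)
    have powr: "real n powr (- (\<kappa> * real n)) = exp (- (\<kappa> * L))"
      using n0 by (simp add: powr_def L_def mult.assoc)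
    have "card (?G \<inter> ?Ev) + card (?G - ?Ev) = card ?G"
      using card_Int_Diff[OF finG, of ?Ev] by (rule sym)
    hence "real (card (?G \<inter> ?Ev)) = real (card ?G) - real (card (?G - ?Ev))" by linarith
    hence "(1 - 2 * exp (- (\<kappa> * L))) * real (card ?G) \<le> real (card (?G \<inter> ?Ev))"
      using bad by (simp add: algebra_simps)
    hence "1 - 2 * exp (- (\<kappa> * L)) \<le> real (card (?G \<inter> ?Ev)) / real (card ?G)"
      using cG by (simp add: pos_le_divide_eq)
    also have "\<dots> = measure_pmf.prob (pmf_of_set ?G) ?Ev"
      using G finG by (simp add: measure_pmf_of_set)
    finally show "measure_pmf.prob (pmf_of_set ?G) ?Ev \<ge> 1 - 2 * real n powr (- (\<kappa> * real n))"
      unfolding powr .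
    show "?G \<noteq> {}" by (rule G)
  qed
qed

end
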